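(* Let $\widehat{X}\colon\widehat{\Sigma}\to\mathbf{R}^{4}$ be a nonflat complete nonorientable minimal surface and let $\widehat{G}=(\hat{g}_{1},\hat{g}_{2})\colon\widehat{\Sigma}\to\mathbf{RP}^{2}\times\mathbf{RP}^{2}$ be the generalized Gauss map of $\widehat{X}(\widehat{\Sigma})$. (i) Assume that $\hat{g}_{1}$ and $\hat{g}_{2}$ are both nonconstant and omit $q_{1}$ and $q_{2}$ distinct points in $\mathbf{RP}^{2}$, respectively. If $q_{1}>1$ and $q_{2}>1$, then $$\frac{1}{q_{1}-1}+\frac{1}{q_{2}-1}\geq 2.$$ (ii) If either $\hat{g}_{1}$ or $\hat{g}_{2}$, say $\hat{g}_{2}$, is constant, then $\hat{g}_{1}$ can omit at most $1$ point in $\mathbf{RP}^{2}$.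
   Context: A nonorientable minimal surface in $\mathbf{R}^4$ is a conformal minimal immersion $\widehat{X}\colon\widehat{\Sigma}\to\mathbf{R}^{4}$ of a (connected) nonorientable Riemann surface $\widehat{\Sigma}$. It is complete if the induced metric is complete, and nonflat if the Gaussian curvature of the induced metric is not identically zero. Let $\pi\colon\Sigma\to\widehat{\Sigma}$ be the orientable conformal double cover, with $\Sigma$ a Riemann surface, let $I\colon\Sigma\to\Sigma$ be the associated antiholomorphic deck transformation of order two (without fixed points), and let $X=(x^1,x^2,x^3,x^4):=\widehat{X}\circ\pi\colon\Sigma\to\mathbf{R}^4$, a conformal minimal immersion. For a local complex coordinate $z=u+\sqrt{-1}v$ put $\partial=(\partial/\partial u-\sqrt{-1}\,\partial/\partial v)/2$ and $\phi_i:=\partial x^{i}\,dz$ ($i=1,2,3,4$); these are holomorphic $1$-forms on $\Sigma$. Set $$\omega=\phi_1-\sqrt{-1}\phi_2,\qquad g_1=\frac{\phi_3+\sqrt{-1}\phi_4}{\phi_1-\sqrt{-1}\phi_2},\qquad g_2=\frac{-\phi_3+\sqrt{-1}\phi_4}{\phi_1-\sqrt{-1}\phi_2},$$ where $g_1,g_2$ are meromorphic functions on $\Sigma$, i.e. holomorphic maps to the Riemann sphere $\overline{\mathbf{C}}=\mathbf{C}\cup\{\infty\}$. The induced metric of $X$ is $ds^2=(1+|g_1|^2)(1+|g_2|^2)|\omega|^2$. Since $I^{*}\phi_j=\overline{\phi_j}$, one has $g_k\circ I=-1/\overline{g_k}$ for $k=1,2$. Identify $\mathbf{RP}^2$ with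 $\overline{\mathbf{C}}/\langle I_0\rangle$, where $I_0(z)=-1/\bar z$ is the antipodal map, and let $\pi_0\colon\overline{\mathbf{C}}\to\mathbf{RP}^2$ be the natural projection. Then there are unique maps $\hat g_k\colon\widehat{\Sigma}\to\mathbf{RP}^2$ with $\hat g_k\circ\pi=\pi_0\circ g_k$ ($k=1,2$), and $\widehat G=(\hat g_1,\hat g_2)$ is called the generalized Gauss map of $\widehat X(\widehat\Sigma)$. A map omits a point if it never attains it. *)

theory Defs
  imports "HOL-Analysis.Analysis"
begin

section \<open>Riemann surfaces and nonorientable Riemann surfaces\<close>

text \<open>
  A surface is a type of class \<open>t2_space\<close> together with an atlas. A chart is a pair
  \<open>(U, \<phi>)\<close> of an open set and a homeomorphism of \<open>U\<close> onto an open set of complex numbers; only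
  the values of \<open>\<phi>\<close> on \<open>U\<close> matter. Second countability is automatic for connected surfaces with
  such an atlas (Rado), so it is not required.
\<close>

type_synonym 'a chart = "'a set \<times> ('a \<Rightarrow> complex)"

definition is_chart :: "('a::t2_space) set \<Rightarrow> ('a \<Rightarrow> complex) \<Rightarrow> bool" where
  "is_chart U \<phi> \<longleftrightarrow> open U \<and> open (\<phi> ` U) \<and> homeomorphism U (\<phi> ` U) \<phi> (inv_into U \<phi>)"

definition chart_atlas :: "('a::t2_space) chart set \<Rightarrow> bool" where
  "chart_atlas A \<longleftrightarrow> (\<forall>(U, \<phi>)\<in>A. is_chart U \<phi>) \<and> (\<Union>(U, \<phi>)\<in>A. U) = UNIV"

definition antiholomorphic_on :: "(complex \<Rightarrow> complex) \<Rightarrow> complex set \<Rightarrow> bool" where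
  "antiholomorphic_on f S \<longleftrightarrow> (\<lambda>z. cnj (f z)) holomorphic_on S"

text \<open>
  Dianalytic means holomorphic or antiholomorphic near each point, hence on each connected
  component; which of the two occurs may depend on the component.
\<close>

definition dianalytic_on :: "(complex \<Rightarrow> complex) \<Rightarrow> complex set \<Rightarrow> bool" where
  "dianalytic_on f S \<longleftrightarrow>
     (\<forall>z\<in>S. \<exists>V. open V \<and> z \<in> V \<and> V \<subseteq> S \<and> (f holomorphic_on V \<or> antiholomorphic_on f V))"

definition complex_atlas :: "('a::t2_space) chart set \<Rightarrow> bool" where
  "complex_atlas A \<longleftrightarrow> chart_atlas A \<and>
     (\<forall>(U, \<phi>)\<in>A. \<forall>(V, \<psi>)\<in>A. (\<psi> \<circ> inv_into U \<phi>) holomorphic_on \<phi> ` (U \<inter> V))"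

definition dianalytic_atlas :: "('a::t2_space) chart set \<Rightarrow> bool" where
  "dianalytic_atlas A \<longleftrightarrow> chart_atlas A \<and>
     (\<forall>(U, \<phi>)\<in>A. \<forall>(V, \<psi>)\<in>A. dianalytic_on (\<psi> \<circ> inv_into U \<phi>) (\<phi> ` (U \<inter> V)))"

definition riemann_surface :: "('a::t2_space) chart set \<Rightarrow> bool" where
  "riemann_surface A \<longleftrightarrow> connected (UNIV :: 'a set) \<and> complex_atlas A"

text \<open>
  A dianalytic structure is orientable if it contains a complex structure, i.e. if
  some complex atlas is dianalytically compatible with it.
\<close>

definition orientable_atlas :: "('a::t2_space) chart set \<Rightarrow> bool" where
  "orientable_atlas A \<longleftrightarrow> (\<exists>B. complex_atlas B \<and> dianalytic_atlas (A \<union> B))"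

definition nonorientable_riemann_surface :: "('a::t2_space) chart set \<Rightarrow> bool" where
  "nonorientable_riemann_surface A \<longleftrightarrow>
     connected (UNIV :: 'a set) \<and> dianalytic_atlas A \<and> \<not> orientable_atlas A"

text \<open>
  \<open>\<pi>\<close> is the double cover of the surface with atlas \<open>A\<close> by the Riemann surface with atlas \<open>B\<close>,
  and \<open>I\<close> is its deck transformation. A local homeomorphism that is dianalytic in charts is
  conformal.
\<close>

definition orientable_double_cover ::
  "('b::t2_space) chart set \<Rightarrow> ('a::t2_space) chart set \<Rightarrow> ('b \<Rightarrow> 'a) \<Rightarrow> ('b \<Rightarrow> 'b) \<Rightarrow> bool" where
  "orientable_double_cover B A \<pi> I \<longleftrightarrow>
     riemann_surface B \<and>
     covering_space UNIV \<pi> UNIV \<and>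
     (\<forall>(U, \<phi>)\<in>B. \<forall>(V, \<psi>)\<in>A. dianalytic_on (\<psi> \<circ> \<pi> \<circ> inv_into U \<phi>) (\<phi> ` (U \<inter> \<pi> -` V))) \<and>
     continuous_on UNIV I \<and>
     (\<forall>(U, \<phi>)\<in>B. \<forall>(V, \<psi>)\<in>B.
        antiholomorphic_on (\<psi> \<circ> I \<circ> inv_into U \<phi>) (\<phi> ` (U \<inter> I -` V))) \<and>
     (\<forall>p. I (I p) = p) \<and> (\<forall>p. I p \<noteq> p) \<and>
     (\<forall>p q. \<pi> p = \<pi> q \<longleftrightarrow> q = p \<or> q = I p)"

section \<open>Conformal minimal immersions\<close>

text \<open>Partial derivatives with respect to \<open>z = u + \<i> v\<close>.\<close>

definition du :: "(complex \<Rightarrow> 'v::real_normed_vector) \<Rightarrow> complex \<Rightarrow> 'v" where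
  "du f z = frechet_derivative f (at z) 1"

definition dv :: "(complex \<Rightarrow> 'v::real_normed_vector) \<Rightarrow> complex \<Rightarrow> 'v" where
  "dv f z = frechet_derivative f (at z) \<i>"

text \<open>Both notions below are meant for open \<open>S\<close>.\<close>

primrec Ck_on :: "nat \<Rightarrow> (complex \<Rightarrow> 'v::real_normed_vector) \<Rightarrow> complex set \<Rightarrow> bool" where
  "Ck_on 0 f S = continuous_on S f"
| "Ck_on (Suc k) f S = (f differentiable_on S \<and> Ck_on k (du f) S \<and> Ck_on k (dv f) S)"

definition smooth_map_on :: "(complex \<Rightarrow> 'v::real_normed_vector) \<Rightarrow> complex set \<Rightarrow> bool" where
  "smooth_map_on f S \<longleftrightarrow> (\<forall>k. Ck_on k f S)"

text \<open>
  For an immersion \<open>f\<close> of a plane domain, \<open>normal_part f z w\<close> is the component of \<open>w\<close> orthogonal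
  to the tangent plane spanned by \<open>du f z\<close> and \<open>dv f z\<close>, and \<open>mean_curvature_vector f z\<close> is
  half the trace of the second fundamental form with respect to the first.
\<close>

definition normal_part :: "(complex \<Rightarrow> 'v::real_inner) \<Rightarrow> complex \<Rightarrow> 'v \<Rightarrow> 'v" where
  "normal_part f z w =
     (let fu = du f z; fv = dv f z;
          E = fu \<bullet> fu; F = fu \<bullet> fv; G = fv \<bullet> fv; D = E * G - F\<^sup>2
      in w - ((G * (w \<bullet> fu) - F * (w \<bullet> fv)) / D) *\<^sub>R fu
           - ((E * (w \<bullet> fv) - F * (w \<bullet> fu)) / D) *\<^sub>R fv)"

definition mean_curvature_vector :: "(complex \<Rightarrow> 'v::real_inner) \<Rightarrow> complex \<Rightarrow> 'v" where
  "mean_curvature_vector f z =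
     (let fu = du f z; fv = dv f z;
          E = fu \<bullet> fu; F = fu \<bullet> fv; G = fv \<bullet> fv; D = E * G - F\<^sup>2;
          IIuu = normal_part f z (du (du f) z);
          IIuv = normal_part f z (du (dv f) z);
          IIvv = normal_part f z (dv (dv f) z)
      in (1 / (2 * D)) *\<^sub>R (G *\<^sub>R IIuu - (2 * F) *\<^sub>R IIuv + E *\<^sub>R IIvv))"

definition conformal_minimal_immersion ::
  "('a::t2_space) chart set \<Rightarrow> ('a \<Rightarrow> real^4) \<Rightarrow> bool" where
  "conformal_minimal_immersion A X \<longleftrightarrow>
     (\<forall>(U, \<phi>)\<in>A. let f = X \<circ> inv_into U \<phi> in
        smooth_map_on f (\<phi> ` U) \<and>
        (\<forall>z\<in>\<phi> ` U.
           inj (frechet_derivative f (at z)) \<and>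
           norm (du f z) = norm (dv f z) \<and> du f z \<bullet> dv f z = 0 \<and>
           mean_curvature_vector f z = 0))"

text \<open>
  In a conformal chart the induced metric is \<open>\<lambda> |dz|\<^sup>2\<close> with \<open>\<lambda> = |f\<^sub>u|\<^sup>2\<close>, and the Gaussian
  curvature of such a metric is \<open>- \<Delta> log \<lambda> / (2 \<lambda>)\<close>.
\<close>

definition gaussian_curvature :: "(complex \<Rightarrow> 'v::real_inner) \<Rightarrow> complex \<Rightarrow> real" where
  "gaussian_curvature f z =
     (let l = (\<lambda>w. ln ((norm (du f w))\<^sup>2))
      in - (du (du l) z + dv (dv l) z) / (2 * (norm (du f z))\<^sup>2))"

definition nonflat :: "('a::t2_space) chart set \<Rightarrow> ('a \<Rightarrow> real^4) \<Rightarrow> bool" where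
  "nonflat A X \<longleftrightarrow>
     (\<exists>(U, \<phi>)\<in>A. \<exists>z\<in>\<phi> ` U. gaussian_curvature (X \<circ> inv_into U \<phi>) z \<noteq> 0)"

section \<open>Completeness of the induced metric\<close>

definition pw_C1_path :: "('a::t2_space) chart set \<Rightarrow> (real \<Rightarrow> 'a) \<Rightarrow> bool" where
  "pw_C1_path A \<gamma> \<longleftrightarrow> path \<gamma> \<and>
     (\<forall>(U, \<phi>)\<in>A. \<forall>a b. 0 \<le> a \<and> a \<le> b \<and> b \<le> 1 \<and> \<gamma> ` {a..b} \<subseteq> U \<longrightarrow>
        (\<phi> \<circ> \<gamma>) piecewise_C1_differentiable_on {a..b})"

text \<open>
  The length of \<open>\<gamma>\<close> in the metric induced by an immersion \<open>X\<close> is the Euclidean length of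
  \<open>X \<circ> \<gamma>\<close>. Since \<^term>\<open>\<gamma> piecewise_C1_differentiable_on {a..b}\<close> allows unbounded derivatives
  near the exceptional points, the length is taken in the extended nonnegative reals.
\<close>

definition induced_length :: "('a \<Rightarrow> real^4) \<Rightarrow> (real \<Rightarrow> 'a) \<Rightarrow> ennreal" where
  "induced_length X \<gamma> =
     (\<integral>\<^sup>+t\<in>{0..1}. ennreal (norm (vector_derivative (X \<circ> \<gamma>) (at t))) \<partial>lborel)"

definition induced_dist ::
  "('a::t2_space) chart set \<Rightarrow> ('a \<Rightarrow> real^4) \<Rightarrow> 'a \<Rightarrow> 'a \<Rightarrow> ennreal" where
  "induced_dist A X p q =
     (INF \<gamma> \<in> {\<gamma>. pw_C1_path A \<gamma> \<and> pathstart \<gamma> = p \<and> pathfinish \<gamma> = q}. induced_length X \<gamma>)"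

definition complete_immersion :: "('a::t2_space) chart set \<Rightarrow> ('a \<Rightarrow> real^4) \<Rightarrow> bool" where
  "complete_immersion A X \<longleftrightarrow>
     (\<forall>s :: nat \<Rightarrow> 'a.
        (\<forall>e>0. \<exists>N. \<forall>m\<ge>N. \<forall>n\<ge>N. induced_dist A X (s m) (s n) < e) \<longrightarrow>
        (\<exists>p. (\<lambda>n. induced_dist A X (s n) p) \<longlonglongrightarrow> 0))"

section \<open>The generalized Gauss map\<close>

text \<open>The Riemann sphere; \<^term>\<open>None\<close> is the point at infinity.\<close>

type_synonym sphere = "complex option"

definition sphere_topology :: "sphere topology" where
  "sphere_topology = Alexandroff_compactification euclidean"

definition antipodal :: "sphere \<Rightarrow> sphere" where
  "antipodal w =
     (case w of None \<Rightarrow> Some 0 | Some z \<Rightarrow> if z = 0 then None else Some (- 1 / cnj z))"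

definition antipodal_rel :: "(sphere \<times> sphere) set" where
  "antipodal_rel = {(z, w). w = z \<or> w = antipodal z}"

definition RP2 :: "sphere set set" where
  "RP2 = UNIV // antipodal_rel"

definition proj_RP2 :: "sphere \<Rightarrow> sphere set" where
  "proj_RP2 z = antipodal_rel `` {z}"

text \<open>
  \<open>form_coeff X U \<phi> i\<close> is the coefficient of \<open>dz\<close> in the 1-form \<open>\<phi>\<^sub>i = \<partial>x\<^sup>i dz\<close>
  (not to be confused with the chart map \<open>\<phi>\<close>) in the chart \<open>(U, \<phi>)\<close>.
\<close>

definition form_coeff ::
  "('b \<Rightarrow> real^4) \<Rightarrow> 'b set \<Rightarrow> ('b \<Rightarrow> complex) \<Rightarrow> 4 \<Rightarrow> complex \<Rightarrow> complex" where
  "form_coeff X U \<phi> i z =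
     (let x = (\<lambda>w. X (inv_into U \<phi> w) $ i)
      in (complex_of_real (du x z) - \<i> * complex_of_real (dv x z)) / 2)"

definition g1_coord :: "('b \<Rightarrow> real^4) \<Rightarrow> 'b set \<Rightarrow> ('b \<Rightarrow> complex) \<Rightarrow> complex \<Rightarrow> complex" where
  "g1_coord X U \<phi> z =
     (form_coeff X U \<phi> 3 z + \<i> * form_coeff X U \<phi> 4 z) /
     (form_coeff X U \<phi> 1 z - \<i> * form_coeff X U \<phi> 2 z)"

definition g2_coord :: "('b \<Rightarrow> real^4) \<Rightarrow> 'b set \<Rightarrow> ('b \<Rightarrow> complex) \<Rightarrow> complex \<Rightarrow> complex" where
  "g2_coord X U \<phi> z =
     (- form_coeff X U \<phi> 3 z + \<i> * form_coeff X U \<phi> 4 z) /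
     (form_coeff X U \<phi> 1 z - \<i> * form_coeff X U \<phi> 2 z)"

text \<open>
  The quotients above are undefined at zeros of \<open>\<omega> = \<phi>\<^sub>1 - \<i> \<phi>\<^sub>2\<close>, where numerator and
  denominator may vanish together. The value of the meromorphic function they define, as a map to
  the Riemann sphere, is the limit of the quotient along punctured neighbourhoods.
\<close>

definition sphere_value ::
  "'b chart set \<Rightarrow> ('b set \<Rightarrow> ('b \<Rightarrow> complex) \<Rightarrow> complex \<Rightarrow> complex) \<Rightarrow> 'b \<Rightarrow> sphere" where
  "sphere_value B r p =
     (THE w. \<forall>(U, \<phi>)\<in>B. p \<in> U \<longrightarrow>
        limitin sphere_topology (\<lambda>z. Some (r U \<phi> z)) w (at (\<phi> p)))"

definition gauss1 :: "'b chart set \<Rightarrow> ('b \<Rightarrow> real^4) \<Rightarrow> 'b \<Rightarrow> sphere" where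
  "gauss1 B X = sphere_value B (g1_coord X)"

definition gauss2 :: "'b chart set \<Rightarrow> ('b \<Rightarrow> real^4) \<Rightarrow> 'b \<Rightarrow> sphere" where
  "gauss2 B X = sphere_value B (g2_coord X)"

definition generalized_gauss_map ::
  "'b chart set \<Rightarrow> ('b \<Rightarrow> 'a) \<Rightarrow> ('a \<Rightarrow> real^4) \<Rightarrow> 'a \<Rightarrow> sphere set \<times> sphere set" where
  "generalized_gauss_map B \<pi> X =
     (THE G. \<forall>p. G (\<pi> p) = (proj_RP2 (gauss1 B (X \<circ> \<pi>) p), proj_RP2 (gauss2 B (X \<circ> \<pi>) p)))"

definition omits_points :: "('a \<Rightarrow> sphere set) \<Rightarrow> nat \<Rightarrow> bool" where
  "omits_points h q \<longleftrightarrow> (\<exists>D\<subseteq>RP2. finite D \<and> card D = q \<and> D \<inter> range h = {})"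

end

theory Submission
  imports Defs "HOL-Complex_Analysis.Complex_Analysis"
begin

text \<open>
  Write \<open>g1\<close>, \<open>g2\<close> for the Gauss maps on the orientable double cover. The deck transformation
  composes each of them with the antipodal map, which has no fixed points. If a Gauss map of the nonorientable
  surface were constant, the lift would take two antipodal values only, hence be constant on the connected cover,
  which is absurd (\<open>equivariant_not_two_valued\<close>). So the statements about constant Gauss maps hold
  vacuously. In the remaining case the inequality for integers \<open>q1, q2 > 1\<close> says \<open>q1 = q2 = 2\<close>, so what has to be excluded is
  that one map omits three points of the projective plane and the other one two. Upstairs they omit six and four points of
  the sphere.

  The forms \<open>\<omega>\<close>, \<open>g1 * \<omega>\<close>, \<open>g2 * \<omega>\<close>, \<open>g1 * g2 * \<omega>\<close> are the entries of a nowhere vanishing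
  rank one matrix of holomorphic 1-forms, built from the coordinate forms of the immersion. Moving an omitted value of
  each map to infinity by a change of basis, one obtains a nowhere vanishing 1-form \<open>f\<close> and holomorphic functions
  \<open>h1\<close>, \<open>h2\<close> omitting five and three finite values such that the induced metric is at most a constant times
  \<open>|f| (1 + |h1|) (1 + |h2|)\<close> (\<open>weierstrass_data\<close>).

  A function on a disc that omits finitely many values satisfies a derivative bound in terms of the distances to
  these values (\<open>omitted_values_derivative_bound\<close>). It follows from Schottky's theorem, applied to tenth roots of
  \<open>(g - a) / (b - a)\<close> and of its reciprocal for omitted values \<open>a\<close>, \<open>b\<close>. With five and three omitted values the exponents leave enough room to
  choose a holomorphic vector field \<open>v\<close>, a product of integral powers of \<open>h1'\<close>, \<open>h2'\<close>, \<open>1 / f\<close> and \<open>1 / (h - a)\<close>, such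
  that on a disc of radius \<open>R\<close> on which \<open>v\<close> is the constant field \<open>1\<close> the induced metric is at most
  \<open>K * (R - |w|) powr (-30/31)\<close> times the Euclidean one. This is integrable along radii.

  The dual form \<open>1 / v\<close> defines a flat metric away from the zeros of \<open>v\<close>, and one develops the surface on
  flat discs about a point with \<open>v \<noteq> 0\<close>. If such a disc is given, its radii have finite length, so they converge by completeness
  (\<open>ray_limit\<close>). Being integral curves of \<open>v\<close>, they do not run into a zero of \<open>v\<close> in finite time. So the map extends beyond every
  boundary point, and by compactness to a larger disc (\<open>translation_map_on_all_discs\<close>). Hence flat discs of every
  radius exist, and the derivative bound at their centres gives \<open>h1' = 0\<close> there, contrary to \<open>v \<noteq> 0\<close>
  (\<open>no_complete_metric\<close>).
\<close>

no_notation fps_nth (infixl \<open>$\<close> 75)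

section \<open>Derivative bounds for functions with omitted values\<close>

text \<open>
  Landau's theorem: Schottky bounds \<open>f\<close> on the disc of radius one half, and Cauchy's estimate turns
  this into a bound of the derivative.
\<close>

lemma Landau_derivative_bound:
  obtains K where "K > 0"
    "\<And>f. f holomorphic_on cball 0 1 \<Longrightarrow> norm (f 0) \<le> 1 \<Longrightarrow>
       (\<And>z. z \<in> cball 0 1 \<Longrightarrow> f z \<noteq> 0 \<and> f z \<noteq> 1) \<Longrightarrow> norm (deriv f 0) \<le> K"
proof -
  define K where "K = 2 * exp (pi * exp (pi * (2 + 2 * 1 + 12 * (1/2) / (1 - 1/2))))"
  show thesis
  proof (rule that[of K])
    show "K > 0" by (simp add: K_def)
    fix f :: "complex \<Rightarrow> complex"
    assume f: "f holomorphic_on cball 0 1" "norm (f 0) \<le> 1"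
      "\<And>z. z \<in> cball 0 1 \<Longrightarrow> f z \<noteq> 0 \<and> f z \<noteq> 1"
    have "norm (f z) \<le> K / 2" if "norm z \<le> 1/2" for z
      unfolding K_def using Schottky[OF f(1) f(2) _ _ _ that] f(3) by simp
    then have "norm ((deriv ^^ 1) f 0) \<le> fact 1 * (K/2) / (1/2) ^ 1"
      by (intro Cauchy_inequality holomorphic_on_subset[OF f(1)]
            holomorphic_on_imp_continuous_on[OF holomorphic_on_subset[OF f(1)]])
         (auto simp: dist_norm)
    then show "norm (deriv f 0) \<le> K" by simp
  qed
qed

lemma nonvanishing_holomorphic_root:
  assumes "g holomorphic_on cball 0 1" "\<And>z. z \<in> cball 0 1 \<Longrightarrow> g z \<noteq> 0" "N > 0"
  obtains G where "G holomorphic_on cball 0 1" "\<And>z. z \<in> cball 0 1 \<Longrightarrow> G z ^ N = g z"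
proof -
  obtain L where L: "L holomorphic_on cball 0 1" "\<And>z. z \<in> cball 0 1 \<Longrightarrow> g z = exp (L z)"
    using contractible_imp_holomorphic_log[OF assms(1) convex_imp_contractible[OF convex_cball] assms(2)]
    by blast
  show thesis
    by (rule that[of "\<lambda>z. exp (L z / of_nat N)"])
       (use assms(3) in \<open>auto intro!: holomorphic_intros L(1) simp: L(2) simp flip: exp_of_nat_mult\<close>)
qed

text \<open>
  A function omitting \<open>0\<close> and \<open>1\<close> has an \<open>N\<close>-th root which again omits \<open>0\<close> and \<open>1\<close>. Landau's
  bound for the root, raised to the power \<open>N\<close>, shows that \<open>g'\<close> is small where \<open>g\<close> is close to the omitted value
  \<open>0\<close>, almost to the first order in \<open>g\<close>. This replaces the hyperbolic metric of a punctured sphere, with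
  a power in place of its logarithmic factor.
\<close>

lemma Landau_near_omitted_value:
  assumes "N > 0"
  obtains K where "K > 0"
    "\<And>g. g holomorphic_on cball 0 1 \<Longrightarrow> norm (g 0) \<le> 1 \<Longrightarrow>
       (\<And>z. z \<in> cball 0 1 \<Longrightarrow> g z \<noteq> 0 \<and> g z \<noteq> 1) \<Longrightarrow>
       norm (deriv g 0) ^ N \<le> K * norm (g 0) ^ (N - 1)"
proof -
  obtain K where K: "K > 0"
    "\<And>f. f holomorphic_on cball 0 1 \<Longrightarrow> norm (f 0) \<le> 1 \<Longrightarrow>
       (\<And>z. z \<in> cball 0 1 \<Longrightarrow> f z \<noteq> 0 \<and> f z \<noteq> 1) \<Longrightarrow> norm (deriv f 0) \<le> K"
    using Landau_derivative_bound by blast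
  show thesis
  proof (rule that[of "(of_nat N * K) ^ N"])
    show "(of_nat N * K) ^ N > 0" using K(1) assms by simp
    fix g :: "complex \<Rightarrow> complex"
    assume g: "g holomorphic_on cball 0 1" "norm (g 0) \<le> 1"
      "\<And>z. z \<in> cball 0 1 \<Longrightarrow> g z \<noteq> 0 \<and> g z \<noteq> 1"
    obtain G where G: "G holomorphic_on cball 0 1" "\<And>z. z \<in> cball 0 1 \<Longrightarrow> G z ^ N = g z"
      using nonvanishing_holomorphic_root[OF g(1) _ assms] g(3) by metis
    have G0: "norm (G 0) \<le> 1"
    proof (rule ccontr)
      assume "\<not> ?thesis"
      then have "1 < norm (G 0) ^ N" using assms by (simp add: one_less_power)
      then show False using G(2)[of 0] g(2) by (simp flip: norm_power)
    qed
    have nz: "G z \<noteq> 0 \<and> G z \<noteq> 1" if "z \<in> cball 0 1" for z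
      using G(2)[OF that] g(3)[OF that] assms by (metis power_one zero_power)
    have bd: "norm (deriv G 0) \<le> K" by (rule K(2)[OF G(1) G0 nz])
    have dG: "(G has_field_derivative deriv G 0) (at 0)"
      by (rule holomorphic_derivI[where S="ball 0 1"])
         (auto intro: holomorphic_on_subset[OF G(1)])
    have "((\<lambda>z. G z ^ N) has_field_derivative of_nat N * G 0 ^ (N - 1) * deriv G 0) (at 0)"
      by (auto intro!: derivative_eq_intros dG)
    then have "(g has_field_derivative of_nat N * G 0 ^ (N - 1) * deriv G 0) (at 0)"
      by (rule has_field_derivative_transform_within_open[where S="ball 0 1"])
         (use G(2) in auto)
    then have d: "deriv g 0 = of_nat N * G 0 ^ (N - 1) * deriv G 0"
      by (rule DERIV_imp_deriv)
    have "norm (deriv g 0) ^ N = (of_nat N) ^ N * (norm (G 0) ^ N) ^ (N - 1) * norm (deriv G 0) ^ N"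
      by (simp add: d norm_mult norm_power power_mult_distrib flip: power_mult)
         (simp add: mult.commute)
    also have "norm (G 0) ^ N = norm (g 0)" using G(2)[of 0] by (simp flip: norm_power)
    also have "(of_nat N) ^ N * norm (g 0) ^ (N - 1) * norm (deriv G 0) ^ N
        \<le> (of_nat N) ^ N * norm (g 0) ^ (N - 1) * K ^ N"
      by (intro mult_left_mono power_mono bd) auto
    finally show "norm (deriv g 0) ^ N \<le> (of_nat N * K) ^ N * norm (g 0) ^ (N - 1)"
      by (simp add: power_mult_distrib mult_ac)
  qed
qed

text \<open>
  The quadratic factor accounts for the omitted value \<open>\<infinity>\<close>: where \<open>g\<close> is large the previous lemma
  is applied to \<open>1/g\<close>.
\<close>

lemma Landau_two_omitted_values:
  assumes "N > 0"
  obtains K where "K > 0"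
    "\<And>g. g holomorphic_on cball 0 1 \<Longrightarrow> (\<And>z. z \<in> cball 0 1 \<Longrightarrow> g z \<noteq> 0 \<and> g z \<noteq> 1) \<Longrightarrow>
       norm (deriv g 0) ^ N \<le> K * norm (g 0) ^ (N - 1) * (1 + norm (g 0)) ^ 2"
proof -
  obtain K where K: "K > 0"
    "\<And>g. g holomorphic_on cball 0 1 \<Longrightarrow> norm (g 0) \<le> 1 \<Longrightarrow>
       (\<And>z. z \<in> cball 0 1 \<Longrightarrow> g z \<noteq> 0 \<and> g z \<noteq> 1) \<Longrightarrow>
       norm (deriv g 0) ^ N \<le> K * norm (g 0) ^ (N - 1)"
    using Landau_near_omitted_value[OF assms] by blast
  show thesis
  proof (rule that[OF K(1)])
    fix g :: "complex \<Rightarrow> complex"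
    assume g: "g holomorphic_on cball 0 1"
      "\<And>z. z \<in> cball 0 1 \<Longrightarrow> g z \<noteq> 0 \<and> g z \<noteq> 1"
    show "norm (deriv g 0) ^ N \<le> K * norm (g 0) ^ (N - 1) * (1 + norm (g 0)) ^ 2"
    proof (cases "norm (g 0) \<le> 1")
      case True
      have "norm (deriv g 0) ^ N \<le> K * norm (g 0) ^ (N - 1)" by (rule K(2)[OF g(1) True g(2)])
      also have "\<dots> \<le> K * norm (g 0) ^ (N - 1) * (1 + norm (g 0)) ^ 2"
        using K(1) mult_left_mono[of 1 "(1 + norm (g 0)) ^ 2" "K * norm (g 0) ^ (N - 1)"] by simp
      finally show ?thesis .
    next
      case False
      define k where "k = (\<lambda>z. inverse (g z))"
      have k: "k holomorphic_on cball 0 1" unfolding k_def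
        using g by (intro holomorphic_on_inverse) auto
      have g0: "g 0 \<noteq> 0" using g(2)[of 0] by simp
      have dg: "(g has_field_derivative deriv g 0) (at 0)"
        by (rule holomorphic_derivI[where S="ball 0 1"])
           (auto intro: holomorphic_on_subset[OF g(1)])
      have "deriv k 0 = - (inverse (g 0) * deriv g 0 * inverse (g 0))"
        unfolding k_def by (rule DERIV_imp_deriv) (auto intro!: derivative_eq_intros dg g0)
      then have "deriv g 0 = - deriv k 0 * g 0 ^ 2"
        using g0 by (simp add: field_simps power2_eq_square)
      then have dgk: "norm (deriv g 0) = norm (deriv k 0) * norm (g 0) ^ 2"
        by (simp add: norm_mult norm_power)
      have bk: "norm (deriv k 0) ^ N \<le> K * norm (k 0) ^ (N - 1)"
        by (rule K(2)[OF k]) (use False g(2) in \<open>auto simp: k_def norm_inverse inverse_le_1_iff\<close>)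
      have "norm (deriv g 0) ^ N = norm (deriv k 0) ^ N * (norm (g 0) ^ 2) ^ N"
        by (simp add: dgk power_mult_distrib)
      also have "\<dots> \<le> (K * norm (k 0) ^ (N - 1)) * (norm (g 0) ^ 2) ^ N"
        by (intro mult_right_mono bk) auto
      also have "\<dots> = K * norm (g 0) ^ (N - 1) * norm (g 0) ^ 2"
      proof -
        obtain m where m: "N = Suc m" using assms by (cases N) auto
        show ?thesis using g0
          by (simp add: m k_def norm_inverse power2_eq_square power_mult_distrib power_inverse)
      qed
      also have "\<dots> \<le> K * norm (g 0) ^ (N - 1) * (1 + norm (g 0)) ^ 2"
        using K(1) by (intro mult_left_mono power_mono) auto
      finally show ?thesis .
    qed
  qed
qed

lemma one_plus_norm_bound:
  fixes b :: complex
  assumes "a \<noteq> b"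
  shows "1 + norm w \<le> ((1 + norm b) * 2 / norm (a - b) + 1) * max (norm (w - a)) (norm (w - b))"
proof -
  let ?m = "max (norm (w - a)) (norm (w - b))"
  have "norm (a - b) \<le> norm (w - a) + norm (w - b)"
    by (metis norm_minus_commute norm_triangle_sub add.commute dist_norm dist_triangle2 dist_commute)
  then have 1: "1 \<le> 2 / norm (a - b) * ?m" using assms by (simp add: field_simps max_def)
  have "norm w \<le> norm b + norm (w - b)" using norm_triangle_ineq[of b "w - b"] by simp
  then have "1 + norm w \<le> (1 + norm b) * 1 + ?m" by simp
  also have "\<dots> \<le> (1 + norm b) * (2 / norm (a - b) * ?m) + ?m"
    by (intro add_right_mono mult_left_mono 1) auto
  finally show ?thesis by (simp add: algebra_simps)
qed

text \<open>
  A point cannot be close to two elements of \<open>S\<close>, so all factors of the product but the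
  smallest one are comparable with \<open>1 + |w|\<close>.
\<close>

lemma closest_factor_bound:
  fixes S :: "complex set"
  assumes "finite S" "S \<noteq> {}"
  obtains C where "C > 0"
    "\<And>w. \<exists>a\<in>S. norm (w - a) * (1 + norm w) ^ (card S - 1) \<le> C * (\<Prod>b\<in>S. norm (w - b))"
proof -
  define c where "c = (\<lambda>a b::complex. (1 + norm b) * 2 / norm (a - b) + 1)"
  define M where "M = Max (insert 1 ((\<lambda>(a,b). c a b) ` (S \<times> S)))"
  have fin: "finite (insert 1 ((\<lambda>(a,b). c a b) ` (S \<times> S)))" using assms by simp
  have M1: "M \<ge> 1" unfolding M_def using fin by (intro Max_ge) auto
  have Mc: "c a b \<le> M" if "a \<in> S" "b \<in> S" for a b
    unfolding M_def using fin that by (intro Max_ge) auto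
  show thesis
  proof (rule that[of "M ^ (card S - 1)"])
    show "M ^ (card S - 1) > 0" using M1 by simp
    fix w
    obtain a where a: "a \<in> S" "\<And>b. b \<in> S \<Longrightarrow> norm (w - a) \<le> norm (w - b)"
      using ex_min_if_finite[of "(\<lambda>b. norm (w - b)) ` S"] assms
      by (metis (no_types, lifting) arg_min_if_finite(1) arg_min_least)
    have le: "1 + norm w \<le> M * norm (w - b)" if b: "b \<in> S - {a}" for b
    proof -
      have "1 + norm w \<le> c a b * max (norm (w - a)) (norm (w - b))"
        unfolding c_def using one_plus_norm_bound[of a b w] b by auto
      also have "\<dots> \<le> M * norm (w - b)"
        using a(2)[of b] Mc[of a b] a(1) b M1 by (intro mult_mono) (auto simp: max_def c_def)
      finally show ?thesis .
    qed
    have "(1 + norm w) ^ (card S - 1) = (\<Prod>b\<in>S - {a}. 1 + norm w)"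
      using a assms by simp
    also have "\<dots> \<le> (\<Prod>b\<in>S - {a}. M * norm (w - b))" by (intro prod_mono) (use le in auto)
    also have "\<dots> = M ^ (card S - 1) * (\<Prod>b\<in>S - {a}. norm (w - b))"
      using a assms by (simp add: prod.distrib)
    finally have "norm (w - a) * (1 + norm w) ^ (card S - 1)
       \<le> norm (w - a) * (M ^ (card S - 1) * (\<Prod>b\<in>S - {a}. norm (w - b)))"
      by (intro mult_left_mono) auto
    also have "\<dots> = M ^ (card S - 1) * (\<Prod>b\<in>S. norm (w - b))"
      using a(1) assms(1) by (simp add: prod.remove mult_ac)
    finally show "\<exists>a\<in>S. norm (w - a) * (1 + norm w) ^ (card S - 1) \<le> M ^ (card S - 1) * (\<Prod>b\<in>S. norm (w - b))"
      using a(1) by blast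
  qed
qed

lemma Landau_one_omitted_factor:
  fixes a b :: complex
  assumes "a \<noteq> b" "N > 0"
  obtains K where "K > 0"
    "\<And>g. g holomorphic_on cball 0 1 \<Longrightarrow> (\<And>z. z \<in> cball 0 1 \<Longrightarrow> g z \<noteq> a \<and> g z \<noteq> b) \<Longrightarrow>
       norm (deriv g 0) ^ N \<le> K * norm (g 0 - a) ^ (N - 1) * (1 + norm (g 0)) ^ 2"
proof -
  obtain K where K: "K > 0"
    "\<And>g. g holomorphic_on cball 0 1 \<Longrightarrow> (\<And>z. z \<in> cball 0 1 \<Longrightarrow> g z \<noteq> 0 \<and> g z \<noteq> 1) \<Longrightarrow>
       norm (deriv g 0) ^ N \<le> K * norm (g 0) ^ (N - 1) * (1 + norm (g 0)) ^ 2"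
    using Landau_two_omitted_values[OF assms(2)] by blast
  define d where "d = norm (b - a)"
  have d: "d > 0" using assms by (simp add: d_def)
  define c where "c = 1 + (1 + norm a) / d"
  have c: "c \<ge> 1" using d by (simp add: c_def)
  show thesis
  proof (rule that[of "K * d * c ^ 2"])
    show "K * d * c ^ 2 > 0" using K d c by simp
    fix g :: "complex \<Rightarrow> complex"
    assume g: "g holomorphic_on cball 0 1"
      "\<And>z. z \<in> cball 0 1 \<Longrightarrow> g z \<noteq> a \<and> g z \<noteq> b"
    define G where "G = (\<lambda>z. (g z - a) / (b - a))"
    have dg: "(g has_field_derivative deriv g 0) (at 0)"
      by (rule holomorphic_derivI[where S="ball 0 1"])
         (auto intro: holomorphic_on_subset[OF g(1)])
    have "deriv G 0 = deriv g 0 / (b - a)"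
      unfolding G_def by (rule DERIV_imp_deriv) (use assms in \<open>auto intro!: derivative_eq_intros dg\<close>)
    then have dG: "norm (deriv g 0) = d * norm (deriv G 0)"
      using assms by (simp add: d_def norm_divide)
    have nG: "norm (G 0) = norm (g 0 - a) / d" by (simp add: G_def norm_divide d_def)
    have 1: "norm (deriv G 0) ^ N \<le> K * norm (G 0) ^ (N - 1) * (1 + norm (G 0)) ^ 2"
      by (rule K(2)) (use g assms in \<open>auto simp: G_def intro!: holomorphic_intros\<close>)
    have 2: "1 + norm (G 0) \<le> c * (1 + norm (g 0))"
    proof -
      have "norm (g 0 - a) \<le> norm (g 0) + norm a" by (rule norm_triangle_ineq4)
      then have "norm (G 0) \<le> (norm (g 0) + norm a) / d"
        unfolding nG using d by (simp add: divide_right_mono)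
      also have "\<dots> \<le> (1 + norm a) * (1 + norm (g 0)) / d"
        using d by (intro divide_right_mono) (auto simp: algebra_simps)
      finally have "norm (G 0) \<le> (1 + norm a) / d * (1 + norm (g 0))" by simp
      then show ?thesis unfolding c_def distrib_right using norm_ge_zero[of "g 0"] unfolding mult_1 by (smt (verit))
    qed
    have "norm (deriv g 0) ^ N = d ^ N * norm (deriv G 0) ^ N"
      by (simp add: dG power_mult_distrib)
    also have "\<dots> \<le> d ^ N * (K * norm (G 0) ^ (N - 1) * (c * (1 + norm (g 0))) ^ 2)"
      using d K(1) 2 by (intro mult_left_mono order_trans[OF 1] power_mono) auto
    also have "\<dots> = K * d * c ^ 2 * norm (g 0 - a) ^ (N - 1) * (1 + norm (g 0)) ^ 2"
    proof -
      obtain m where m: "N = Suc m" using assms by (cases N) auto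
      show ?thesis using d by (simp add: m nG power_divide power_mult_distrib mult_ac)
    qed
    finally show "norm (deriv g 0) ^ N \<le> K * d * c ^ 2 * norm (g 0 - a) ^ (N - 1) * (1 + norm (g 0)) ^ 2" .
  qed
qed

text \<open>
  Each omitted value \<open>a\<close> gives a bound by a power of \<open>|g 0 - a|\<close>, and the one for the value closest
  to \<open>g 0\<close> is the best. Compared with it, the product over all omitted values gains a factor of order
  \<open>1 + |g 0|\<close> for each of the other values. This growth for large \<open>g\<close> is what absorbs the factor
  \<open>1 + |g|\<close> of the induced metric.
\<close>

lemma Landau_finitely_many_omitted_values:
  fixes S :: "complex set"
  assumes "finite S" "card S \<ge> 2" "N > 0"
  obtains K where "K > 0"
    "\<And>g. g holomorphic_on cball 0 1 \<Longrightarrow> g ` cball 0 1 \<inter> S = {} \<Longrightarrow>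
       norm (deriv g 0) ^ N * (1 + norm (g 0)) ^ ((N - 1) * (card S - 1))
       \<le> K * (\<Prod>a\<in>S. norm (g 0 - a)) ^ (N - 1) * (1 + norm (g 0)) ^ 2"
proof -
  have "\<forall>a\<in>S. \<exists>K>0. \<forall>g. g holomorphic_on cball 0 1 \<longrightarrow> g ` cball 0 1 \<inter> S = {} \<longrightarrow>
       norm (deriv g 0) ^ N \<le> K * norm (g 0 - a) ^ (N - 1) * (1 + norm (g 0)) ^ 2"
  proof
    fix a assume a: "a \<in> S"
    obtain b where b: "b \<in> S" "b \<noteq> a"
      using assms(1,2) a by (metis card_le_Suc0_iff_eq not_less_eq_eq numeral_2_eq_2)
    show "\<exists>K>0. \<forall>g. g holomorphic_on cball 0 1 \<longrightarrow> g ` cball 0 1 \<inter> S = {} \<longrightarrow>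
       norm (deriv g 0) ^ N \<le> K * norm (g 0 - a) ^ (N - 1) * (1 + norm (g 0)) ^ 2"
      by (rule Landau_one_omitted_factor[OF b(2)[symmetric] assms(3)])
         (use a b in \<open>blast\<close>)
  qed
  then obtain K where K: "\<And>a. a \<in> S \<Longrightarrow> K a > 0"
    "\<And>a g. a \<in> S \<Longrightarrow> g holomorphic_on cball 0 1 \<Longrightarrow> g ` cball 0 1 \<inter> S = {} \<Longrightarrow>
       norm (deriv g 0) ^ N \<le> K a * norm (g 0 - a) ^ (N - 1) * (1 + norm (g 0)) ^ 2"
    by metis
  have S0: "S \<noteq> {}" using assms by auto
  obtain C where C: "C > 0"
    "\<And>w. \<exists>a\<in>S. norm (w - a) * (1 + norm w) ^ (card S - 1) \<le> C * (\<Prod>b\<in>S. norm (w - b))"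
    using closest_factor_bound[OF assms(1) S0] by blast
  define K1 where "K1 = Max (K ` S)"
  have K1: "K a \<le> K1" if "a \<in> S" for a using that assms by (simp add: K1_def)
  have K1p: "K1 > 0" using K(1) K1 S0 by (metis ex_in_conv less_le_trans)
  show thesis
  proof (rule that[of "K1 * C ^ (N - 1)"])
    show "K1 * C ^ (N - 1) > 0" using K1p C by simp
    fix g :: "complex \<Rightarrow> complex"
    assume g: "g holomorphic_on cball 0 1" "g ` cball 0 1 \<inter> S = {}"
    let ?w = "g 0" and ?P = "\<Prod>b\<in>S. norm (g 0 - b)"
    obtain a where a: "a \<in> S" "norm (?w - a) * (1 + norm ?w) ^ (card S - 1) \<le> C * ?P"
      using C(2) by blast
    have "norm (deriv g 0) ^ N * (1 + norm ?w) ^ ((N - 1) * (card S - 1))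
       \<le> (K1 * norm (?w - a) ^ (N - 1) * (1 + norm ?w) ^ 2) * (1 + norm ?w) ^ ((N - 1) * (card S - 1))"
      by (intro mult_right_mono order_trans[OF K(2)[OF a(1) g]] K1 a) auto
    also have "\<dots> = K1 * (norm (?w - a) * (1 + norm ?w) ^ (card S - 1)) ^ (N - 1) * (1 + norm ?w) ^ 2"
      by (simp add: power_mult_distrib mult_ac flip: power_mult)
    also have "\<dots> \<le> K1 * (C * ?P) ^ (N - 1) * (1 + norm ?w) ^ 2"
      using K1p by (intro mult_right_mono mult_left_mono power_mono a) auto
    finally show "norm (deriv g 0) ^ N * (1 + norm ?w) ^ ((N - 1) * (card S - 1))
       \<le> K1 * C ^ (N - 1) * ?P ^ (N - 1) * (1 + norm ?w) ^ 2"
      by (simp add: power_mult_distrib mult_ac)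
  qed
qed

text \<open>
  The distance of \<open>w\<close> to the boundary enters by rescaling the disc of half that radius about
  \<open>w\<close>, and in the power \<open>N\<close>.
\<close>

lemma omitted_values_derivative_bound:
  fixes S :: "complex set"
  assumes "finite S" "card S \<ge> 2" "N > 0"
  obtains K where "K > 0"
    "\<And>g R w. g holomorphic_on ball 0 R \<Longrightarrow> g ` ball 0 R \<inter> S = {} \<Longrightarrow> norm (w::complex) < R \<Longrightarrow>
       (norm (deriv g w) * (R - norm w)) ^ N * (1 + norm (g w)) ^ ((N - 1) * (card S - 1))
       \<le> K * (\<Prod>a\<in>S. norm (g w - a)) ^ (N - 1) * (1 + norm (g w)) ^ 2"
proof -
  obtain K where K: "K > 0"
    "\<And>g. g holomorphic_on cball 0 1 \<Longrightarrow> g ` cball 0 1 \<inter> S = {} \<Longrightarrow>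
       norm (deriv g 0) ^ N * (1 + norm (g 0)) ^ ((N - 1) * (card S - 1))
       \<le> K * (\<Prod>a\<in>S. norm (g 0 - a)) ^ (N - 1) * (1 + norm (g 0)) ^ 2"
    using Landau_finitely_many_omitted_values[OF assms] by blast
  show thesis
  proof (rule that[of "2 ^ N * K"])
    show "2 ^ N * K > 0" using K by simp
    fix g :: "complex \<Rightarrow> complex" and R :: real and w :: complex
    assume g: "g holomorphic_on ball 0 R" "g ` ball 0 R \<inter> S = {}" "norm w < R"
    define \<rho> where "\<rho> = (R - norm w) / 2"
    have \<rho>: "\<rho> > 0" using g(3) by (simp add: \<rho>_def)
    have inb: "w + of_real \<rho> * u \<in> ball 0 R" if "u \<in> cball 0 1" for u
    proof -
      have "norm (w + of_real \<rho> * u) \<le> norm w + \<rho> * norm u"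
        using \<rho> norm_triangle_ineq[of w "of_real \<rho> * u"] by (simp add: norm_mult)
      also have "\<dots> \<le> norm w + \<rho>" using that \<rho> by (simp add: mult_left_le)
      also have "\<dots> < R" using g(3) by (simp add: \<rho>_def field_simps)
      finally show ?thesis by simp
    qed
    define k where "k = (\<lambda>u. g (w + of_real \<rho> * u))"
    have k: "k holomorphic_on cball 0 1" unfolding k_def
      by (rule holomorphic_on_compose_gen[where g=g and t="ball 0 R", unfolded o_def])
         (use inb g(1) in \<open>auto intro!: holomorphic_intros\<close>)
    have "(g has_field_derivative deriv g w) (at w)"
      using g by (intro holomorphic_derivI[where S="ball 0 R"]) auto
    then have "(k has_field_derivative deriv g w * of_real \<rho>) (at 0)"
      unfolding k_def by (intro DERIV_chain'[where g=g]) (auto intro!: derivative_eq_intros)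
    then have dk: "deriv k 0 = deriv g w * of_real \<rho>" by (rule DERIV_imp_deriv)
    have k0: "k 0 = g w" by (simp add: k_def)
    have "k ` cball 0 1 \<inter> S = {}" using g(2) inb unfolding k_def by blast
    from K(2)[OF k this] have
      "(norm (deriv g w) * \<rho>) ^ N * (1 + norm (g w)) ^ ((N - 1) * (card S - 1))
       \<le> K * (\<Prod>a\<in>S. norm (g w - a)) ^ (N - 1) * (1 + norm (g w)) ^ 2"
      using \<rho> by (simp add: dk k0 norm_mult)
    then have "2 ^ N * ((norm (deriv g w) * \<rho>) ^ N * (1 + norm (g w)) ^ ((N - 1) * (card S - 1)))
       \<le> 2 ^ N * (K * (\<Prod>a\<in>S. norm (g w - a)) ^ (N - 1) * (1 + norm (g w)) ^ 2)"
      by (intro mult_left_mono) auto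
    moreover have "2 ^ N * (norm (deriv g w) * \<rho>) ^ N = (norm (deriv g w) * (R - norm w)) ^ N"
      by (simp add: \<rho>_def flip: power_mult_distrib)
    ultimately show "(norm (deriv g w) * (R - norm w)) ^ N * (1 + norm (g w)) ^ ((N - 1) * (card S - 1))
       \<le> 2 ^ N * K * (\<Prod>a\<in>S. norm (g w - a)) ^ (N - 1) * (1 + norm (g w)) ^ 2"
      by (simp only: mult.assoc[symmetric])
  qed
qed

section \<open>Translation structures and developing maps\<close>

text \<open>
  Charts whose transition maps are locally translations. The holomorphic 1-form \<open>dF\<close> does not depend on the
  chart \<open>F\<close>, and \<open>|dF|\<close> is a flat metric.
\<close>

definition translation_atlas :: "('a::t2_space) chart set \<Rightarrow> bool" where
  "translation_atlas T \<longleftrightarrow> (\<forall>(V, F)\<in>T. is_chart V F) \<and>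
     (\<forall>(V, F)\<in>T. \<forall>(W, G)\<in>T. \<forall>p\<in>V \<inter> W. \<exists>N c. open N \<and> p \<in> N \<and> N \<subseteq> V \<inter> W \<and> (\<forall>q\<in>N. G q = F q + c))"

text \<open>
  Such a map parametrises the surface by the plane so that \<open>dF\<close> pulls back to \<open>dz\<close>: it is a local
  isometry from the Euclidean to the flat metric, that is, a developed piece of the surface.
\<close>

definition translation_map :: "('a::t2_space) chart set \<Rightarrow> (complex \<Rightarrow> 'a) \<Rightarrow> complex set \<Rightarrow> bool" where
  "translation_map T \<Phi> S \<longleftrightarrow>
     (\<forall>z\<in>S. \<exists>e>0. \<exists>(V, F)\<in>T. \<exists>c. ball z e \<subseteq> S \<and> \<Phi> ` ball z e \<subseteq> V \<and> (\<forall>w\<in>ball z e. F (\<Phi> w) = w + c))"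

lemma is_chartD:
  assumes "is_chart V F"
  shows "open V" "open (F ` V)" "inj_on F V" "continuous_on V F" "continuous_on (F ` V) (inv_into V F)"
    "\<And>p. p \<in> V \<Longrightarrow> inv_into V F (F p) = p"
  using assms unfolding is_chart_def homeomorphism_def
  by (auto simp: inj_on_def) metis+

lemma translation_atlas_chart: "translation_atlas T \<Longrightarrow> (V, F) \<in> T \<Longrightarrow> is_chart V F"
  unfolding translation_atlas_def by blast

lemma translation_atlas_transition:
  assumes "translation_atlas T" "(V, F) \<in> T" "(W, G) \<in> T" "p \<in> V \<inter> W"
  obtains N c where "open N" "p \<in> N" "N \<subseteq> V \<inter> W" "\<And>q. q \<in> N \<Longrightarrow> G q = F q + c"
proof -
  have "\<forall>(V, F)\<in>T. \<forall>(W, G)\<in>T. \<forall>p\<in>V \<inter> W. \<exists>N c. open N \<and> p \<in> N \<and> N \<subseteq> V \<inter> W \<and> (\<forall>q\<in>N. G q = F q + c)"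
    using assms(1) unfolding translation_atlas_def by (rule conjunct2)
  from bspec[OF bspec[OF this assms(2), simplified] assms(3), simplified] assms(4) that
  show thesis by blast
qed

lemma translation_mapE:
  assumes "translation_map T \<Phi> S" "z \<in> S"
  obtains e V F c where "e > 0" "(V, F) \<in> T" "ball z e \<subseteq> S" "\<Phi> ` ball z e \<subseteq> V"
     "\<And>w. w\<in>ball z e \<Longrightarrow> F (\<Phi> w) = w + c"
  using bspec[OF assms[unfolded translation_map_def]] by (auto simp: case_prod_beta)

lemma translation_mapI:
  assumes "\<And>z. z \<in> S \<Longrightarrow> \<exists>e V F c. e > 0 \<and> (V, F) \<in> T \<and> ball z e \<subseteq> S \<and> \<Phi> ` ball z e \<subseteq> V \<and>
     (\<forall>w\<in>ball z e. F (\<Phi> w) = w + c)"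
  shows "translation_map T \<Phi> S"
  unfolding translation_map_def using assms by blast

lemma translation_map_open: "translation_map T \<Phi> S \<Longrightarrow> open S"
  unfolding translation_map_def open_contains_ball by blast

lemma translation_map_subset:
  assumes "translation_map T \<Phi> S" "open S'" "S' \<subseteq> S"
  shows "translation_map T \<Phi> S'"
proof (rule translation_mapI)
  fix z assume z: "z \<in> S'"
  then obtain e V F c where e: "e > 0" "(V, F) \<in> T" "ball z e \<subseteq> S" "\<Phi> ` ball z e \<subseteq> V"
     "\<And>w. w\<in>ball z e \<Longrightarrow> F (\<Phi> w) = w + c"
    using translation_mapE[OF assms(1)] assms(3) by (metis subsetD)
  obtain d where d: "d > 0" "ball z d \<subseteq> S'" using assms(2) z open_contains_ball by blast
  show "\<exists>e V F c. e > 0 \<and> (V, F) \<in> T \<and> ball z e \<subseteq> S' \<and> \<Phi> ` ball z e \<subseteq> V \<and> (\<forall>w\<in>ball z e. F (\<Phi> w) = w + c)"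
    using d e by (intro exI[of _ "min d e"] exI[of _ V] exI[of _ F] exI[of _ c]) auto
qed

lemma translation_map_continuous:
  assumes "translation_atlas T" "translation_map T \<Phi> S"
  shows "continuous_on S \<Phi>"
proof -
  have "isCont \<Phi> z" if z: "z \<in> S" for z
  proof -
    obtain e V F c where e: "e > 0" "(V, F) \<in> T" "ball z e \<subseteq> S" "\<Phi> ` ball z e \<subseteq> V"
       "\<And>w. w\<in>ball z e \<Longrightarrow> F (\<Phi> w) = w + c"
      using translation_mapE[OF assms(2) z] by metis
    have V: "is_chart V F" using translation_atlas_chart assms(1) e(2) .
    have eq: "inv_into V F (w + c) = \<Phi> w" if "w \<in> ball z e" for w
      using is_chartD(6)[OF V, of "\<Phi> w"] e(4) e(5)[OF that] that by (metis image_subset_iff)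
    have im: "(\<lambda>w. w + c) ` ball z e \<subseteq> F ` V" using e(4,5) by force
    have "continuous_on (ball z e) (\<lambda>w. inv_into V F (w + c))"
      by (rule continuous_on_compose2[OF is_chartD(5)[OF V] _ im]) (intro continuous_intros)
    then have "continuous_on (ball z e) \<Phi>" by (rule continuous_on_eq) (rule eq)
    then show ?thesis using e(1) by (simp add: continuous_on_eq_continuous_at)
  qed
  then show ?thesis by (simp add: continuous_at_imp_continuous_on)
qed

lemma translation_map_in_chart:
  assumes T: "translation_atlas T" and \<Phi>: "translation_map T \<Phi> S" and z: "z \<in> S"
    and G: "(W, G) \<in> T" "\<Phi> z \<in> W"
  obtains e c where "e > 0" "ball z e \<subseteq> S" "\<Phi> ` ball z e \<subseteq> W"
    "\<And>w. w \<in> ball z e \<Longrightarrow> G (\<Phi> w) = w + c"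
proof -
  obtain e V F c where e: "e > 0" "(V, F) \<in> T" "ball z e \<subseteq> S" "\<Phi> ` ball z e \<subseteq> V"
     "\<And>w. w\<in>ball z e \<Longrightarrow> F (\<Phi> w) = w + c"
    using translation_mapE[OF \<Phi> z] by metis
  have "\<Phi> z \<in> V \<inter> W" using e G by force
  then obtain N d where N: "open N" "\<Phi> z \<in> N" "N \<subseteq> V \<inter> W" "\<And>q. q \<in> N \<Longrightarrow> G q = F q + d"
    using translation_atlas_transition[OF T e(2) G(1)] by metis
  have "continuous_on S \<Phi>" by (rule translation_map_continuous[OF T \<Phi>])
  moreover have "open S" by (rule translation_map_open[OF \<Phi>])
  ultimately have "open (S \<inter> \<Phi> -` N)" using N(1) by (simp add: continuous_on_open_vimage Int_commute)
  then obtain r where r: "r > 0" "ball z r \<subseteq> S \<inter> \<Phi> -` N"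
    using z N(2) by (metis IntI open_contains_ball vimageI)
  show thesis
    by (rule that[of "min r e" "c + d"]) (use r e N in \<open>auto simp: subset_iff\<close>)
qed

text \<open>
  The points where two translation maps agree form a closed set because the surface is
  Hausdorff, and an open one because both are translations in a common chart.
\<close>

lemma translation_map_unique:
  assumes T: "translation_atlas T" and \<Phi>: "translation_map T \<Phi> S" and \<Psi>: "translation_map T \<Psi> S"
    and S: "connected S" and z0: "z0 \<in> S" "\<Phi> z0 = \<Psi> z0" and z: "z \<in> S"
  shows "\<Phi> z = \<Psi> z"
proof -
  have oS: "open S" by (rule translation_map_open[OF \<Phi>])
  note cont = translation_map_continuous[OF T \<Phi>] translation_map_continuous[OF T \<Psi>]
  define E where "E = {z \<in> S. \<Phi> z = \<Psi> z}"
  have "open (S - E)"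
  proof (intro open_subopen[THEN iffD2] ballI)
    fix z assume "z \<in> S - E"
    then have z: "z \<in> S" "\<Phi> z \<noteq> \<Psi> z" by (auto simp: E_def)
    obtain U V where UV: "open U" "open V" "\<Phi> z \<in> U" "\<Psi> z \<in> V" "U \<inter> V = {}"
      using hausdorff[OF z(2)] by metis
    let ?N = "(S \<inter> \<Phi> -` U) \<inter> (S \<inter> \<Psi> -` V)"
    have "open ?N" using cont UV oS by (intro open_Int continuous_open_preimage) auto
    moreover have "z \<in> ?N" using UV z by auto
    moreover have "?N \<subseteq> S - E" using UV(5) by (auto simp: E_def)
    ultimately show "\<exists>T. open T \<and> z \<in> T \<and> T \<subseteq> S - E" by blast
  qed
  then have "openin (top_of_set S) (S - E)" by (intro open_subset) auto
  then have "closedin (top_of_set S) E" unfolding closedin_def E_def by auto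
  moreover have "openin (top_of_set S) E"
  proof -
    have "open E" unfolding open_contains_ball
    proof
      fix z assume "z \<in> E"
      then have z: "z \<in> S" "\<Phi> z = \<Psi> z" by (auto simp: E_def)
      obtain V F where V: "(V, F) \<in> T" "\<Phi> z \<in> V" using translation_mapE[OF \<Phi> z(1)] z(1)
        by (metis centre_in_ball imageI subsetD)
      obtain e c where e: "e > 0" "ball z e \<subseteq> S" "\<Phi> ` ball z e \<subseteq> V" "\<And>w. w \<in> ball z e \<Longrightarrow> F (\<Phi> w) = w + c"
        using translation_map_in_chart[OF T \<Phi> z(1) V] by blast
      obtain e' c' where e': "e' > 0" "ball z e' \<subseteq> S" "\<Psi> ` ball z e' \<subseteq> V" "\<And>w. w \<in> ball z e' \<Longrightarrow> F (\<Psi> w) = w + c'"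
        using translation_map_in_chart[OF T \<Psi> z(1) V(1)] V(2) z(2) by metis
      have "z + c = z + c'" using e(1) e'(1) e(4)[of z] e'(4)[of z] z(2) by auto
      then have cc: "c = c'" by simp
      have inj: "inj_on F V" using translation_atlas_chart[OF T V(1)] is_chartD(3) by blast
      have "ball z (min e e') \<subseteq> E"
      proof
        fix w assume w: "w \<in> ball z (min e e')"
        then have "F (\<Phi> w) = F (\<Psi> w)" using e(4)[of w] e'(4)[of w] cc by simp
        moreover have "\<Phi> w \<in> V" "\<Psi> w \<in> V" using e(3) e'(3) w by auto
        ultimately have "\<Phi> w = \<Psi> w" using inj by (simp add: inj_on_eq_iff)
        then show "w \<in> E" using w e(2) by (auto simp: E_def)
      qed
      then show "\<exists>e>0. ball z e \<subseteq> E" using e(1) e'(1) by (intro exI[of _ "min e e'"]) auto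
    qed
    then show ?thesis by (intro open_subset) (auto simp: E_def)
  qed
  moreover have "E \<noteq> {}" using z0 by (auto simp: E_def)
  ultimately have "E = S" using S unfolding connected_clopen by blast
  then show ?thesis using z by (auto simp: E_def)
qed

text \<open>
  Near the limit point a chart inverse, shifted by the constant with which \<open>\<Phi>\<close> appears in this chart, is a
  translation map agreeing with \<open>\<Phi>\<close>. It is defined on a disc about a point of the radius close to the limit, large enough
  to contain a neighbourhood of the boundary point.
\<close>

lemma translation_map_extend_at_boundary_point:
  assumes T: "translation_atlas T" and \<Phi>: "translation_map T \<Phi> (ball 0 R)" and \<zeta>: "norm \<zeta> = R" and "R > 0"
    and lim: "((\<lambda>t. \<Phi> (of_real t * \<zeta>)) \<longlongrightarrow> p) (at_left 1)" and p: "(V, F) \<in> T" "p \<in> V"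
  obtains e \<Psi> where "e > 0" "translation_map T \<Psi> (ball \<zeta> e)"
    "\<And>z. z \<in> ball \<zeta> e \<inter> ball 0 R \<Longrightarrow> \<Psi> z = \<Phi> z"
proof -
  have V: "is_chart V F" using translation_atlas_chart T p(1) .
  obtain r where r: "r > 0" "ball (F p) r \<subseteq> F ` V"
    using is_chartD(2)[OF V] p(2) by (meson imageI open_contains_ball)
  have "open (V \<inter> F -` ball (F p) (r/4))"
    by (intro continuous_open_preimage is_chartD[OF V] open_ball)
  then have "\<forall>\<^sub>F t in at_left 1. \<Phi> (of_real t * \<zeta>) \<in> V \<inter> F -` ball (F p) (r/4)"
    using lim r(1) p(2) by (intro topological_tendstoD) auto
  moreover have "\<forall>\<^sub>F t in at_left (1::real). t \<in> {max 0 (1 - r / (4 * R))<..<1}"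
    using r(1) \<open>R > 0\<close> by (intro eventually_at_leftI[of "max 0 (1 - r / (4 * R))"]) auto
  ultimately have "\<forall>\<^sub>F t in at_left 1. \<Phi> (of_real t * \<zeta>) \<in> V \<inter> F -` ball (F p) (r/4) \<and> t \<in> {max 0 (1 - r / (4 * R))<..<1}"
    by (rule eventually_conj)
  then obtain t where t: "\<Phi> (of_real t * \<zeta>) \<in> V" "dist (F p) (F (\<Phi> (of_real t * \<zeta>))) < r/4"
      "0 < t" "t < 1" "1 - r / (4 * R) < t"
    using eventually_happens[of _ "at_left (1::real)"] trivial_limit_at_left_real by fastforce
  define z where "z = of_real t * \<zeta>"
  have z: "z \<in> ball 0 R" using t \<zeta> \<open>R > 0\<close> by (simp add: z_def norm_mult)
  have dz: "dist z \<zeta> < r/4"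
  proof -
    have "dist z \<zeta> = norm (of_real (1 - t) * \<zeta>)" by (simp add: z_def dist_norm algebra_simps norm_minus_commute)
    also have "\<dots> = (1 - t) * R" unfolding norm_mult norm_of_real using \<zeta> t by simp
    also have "\<dots> < r / (4 * R) * R" using t \<open>R > 0\<close> by (intro mult_strict_right_mono) auto
    finally show ?thesis using \<open>R > 0\<close> by simp
  qed
  obtain e c where e: "e > 0" "ball z e \<subseteq> ball 0 R" "\<Phi> ` ball z e \<subseteq> V" "\<And>w. w \<in> ball z e \<Longrightarrow> F (\<Phi> w) = w + c"
    using translation_map_in_chart[OF T \<Phi> z p(1)] t(1) unfolding z_def by blast
  define \<Psi> where "\<Psi> = (\<lambda>w. inv_into V F (w + c))"
  have sub: "w + c \<in> F ` V" if "w \<in> ball z (3*r/4)" for w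
  proof -
    have "F (\<Phi> z) = z + c" using e by simp
    then have "dist (F p) (z + c) < r/4" using t(2) by (simp add: z_def)
    moreover have "dist (z + c) (w + c) < 3 * r / 4" using that by simp
    ultimately have "dist (F p) (w + c) < r" using dist_triangle[of "F p" "w + c" "z + c"] by simp
    then show ?thesis using r by auto
  qed
  have tr: "translation_map T \<Psi> (ball z (3*r/4))"
  proof (rule translation_mapI)
    fix w assume "w \<in> ball z (3*r/4)"
    then obtain d where d: "d > 0" "ball w d \<subseteq> ball z (3*r/4)" by (meson open_ball open_contains_ball)
    then have "\<Psi> ` ball w d \<subseteq> V \<and> (\<forall>w\<in>ball w d. F (\<Psi> w) = w + c)"
      unfolding \<Psi>_def using sub by (auto simp: f_inv_into_f subset_iff intro: inv_into_into)
    then show "\<exists>e V F c. e > 0 \<and> (V, F) \<in> T \<and> ball w e \<subseteq> ball z (3*r/4) \<and> \<Psi> ` ball w e \<subseteq> V \<and> (\<forall>w\<in>ball w e. F (\<Psi> w) = w + c)"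
      using d p(1) by blast
  qed
  show thesis
  proof (rule that[of "r/2" \<Psi>])
    show "r/2 > 0" using r by simp
    have sb: "ball \<zeta> (r/2) \<subseteq> ball z (3*r/4)"
    proof
      fix w assume "w \<in> ball \<zeta> (r/2)"
      then show "w \<in> ball z (3*r/4)" using dz dist_triangle[of z w \<zeta>] by simp
    qed
    show "translation_map T \<Psi> (ball \<zeta> (r/2))" by (rule translation_map_subset[OF tr _ sb]) simp
    fix w assume w: "w \<in> ball \<zeta> (r/2) \<inter> ball 0 R"
    let ?S = "ball z (3*r/4) \<inter> ball 0 R"
    show "\<Psi> w = \<Phi> w"
    proof (rule translation_map_unique[OF T _ _ _, of _ ?S _ z])
      show "translation_map T \<Psi> ?S" by (rule translation_map_subset[OF tr]) auto
      show "translation_map T \<Phi> ?S" by (rule translation_map_subset[OF \<Phi>]) auto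
      show "connected ?S" by (intro convex_connected convex_Int convex_ball)
      show "z \<in> ?S" using z r by simp
      show "w \<in> ?S" using w sb by auto
      have "F (\<Phi> z) = z + c" "\<Phi> z \<in> V" using e by auto
      then show "\<Psi> z = \<Phi> z" unfolding \<Psi>_def using is_chartD(6)[OF V, of "\<Phi> z"] by simp
    qed
  qed
qed

text \<open>
  By compactness of the boundary circle the local extensions live on discs of a common radius.
  Two such discs that meet also meet inside the given disc, so the extensions agree on the overlap.
\<close>

lemma translation_map_extend_disc:
  assumes T: "translation_atlas T" and \<Phi>: "translation_map T \<Phi> (ball 0 R)" and "R > 0"
    and lim: "\<And>\<zeta>. norm \<zeta> = R \<Longrightarrow> \<exists>p\<in>(\<Union>(V, F)\<in>T. V). ((\<lambda>t. \<Phi> (of_real t * \<zeta>)) \<longlongrightarrow> p) (at_left 1)"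
  obtains R' \<Psi> where "R' > R" "translation_map T \<Psi> (ball 0 R')" "\<And>z. z \<in> ball 0 R \<Longrightarrow> \<Psi> z = \<Phi> z"
proof -
  have "\<forall>\<zeta>\<in>sphere (0::complex) R. \<exists>e \<Psi>. e > 0 \<and> translation_map T \<Psi> (ball \<zeta> e) \<and> (\<forall>z\<in>ball \<zeta> e \<inter> ball 0 R. \<Psi> z = \<Phi> z)"
  proof
    fix \<zeta> :: complex assume "\<zeta> \<in> sphere 0 R"
    then have \<zeta>: "norm \<zeta> = R" by simp
    from lim[OF \<zeta>] obtain p V F where p: "(V, F) \<in> T" "p \<in> V" "((\<lambda>t. \<Phi> (of_real t * \<zeta>)) \<longlongrightarrow> p) (at_left 1)"
      by auto
    obtain e \<Psi> where "e > 0" "translation_map T \<Psi> (ball \<zeta> e)" "\<And>z. z \<in> ball \<zeta> e \<inter> ball 0 R \<Longrightarrow> \<Psi> z = \<Phi> z"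
      using translation_map_extend_at_boundary_point[OF T \<Phi> \<zeta> \<open>R > 0\<close> p(3,1,2)] by metis
    then show "\<exists>e \<Psi>. e > 0 \<and> translation_map T \<Psi> (ball \<zeta> e) \<and> (\<forall>z\<in>ball \<zeta> e \<inter> ball 0 R. \<Psi> z = \<Phi> z)"
      by blast
  qed
  then obtain e \<Psi> where e: "\<And>\<zeta>. \<zeta> \<in> sphere 0 R \<Longrightarrow> e \<zeta> > 0"
     "\<And>\<zeta>. \<zeta> \<in> sphere 0 R \<Longrightarrow> translation_map T (\<Psi> \<zeta>) (ball \<zeta> (e \<zeta>))"
     "\<And>\<zeta> z. \<zeta> \<in> sphere 0 R \<Longrightarrow> z \<in> ball \<zeta> (e \<zeta>) \<inter> ball 0 R \<Longrightarrow> \<Psi> \<zeta> z = \<Phi> z"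
    by metis
  have "compact (sphere (0::complex) R)" by simp
  then obtain d where d: "d > 0" "\<And>x. x \<in> sphere (0::complex) R \<Longrightarrow> \<exists>G\<in>(\<lambda>\<zeta>. ball \<zeta> (e \<zeta>)) ` sphere 0 R. ball x d \<subseteq> G"
    using Heine_Borel_lemma[of "sphere (0::complex) R" "(\<lambda>\<zeta>. ball \<zeta> (e \<zeta>)) ` sphere 0 R"] e(1)
    by (smt (verit, ccfv_threshold) UN_I centre_in_ball imageE open_ball subsetI)
  have "\<forall>x\<in>sphere (0::complex) R. \<exists>\<Psi>. translation_map T \<Psi> (ball x d) \<and> (\<forall>z\<in>ball x d \<inter> ball 0 R. \<Psi> z = \<Phi> z)"
  proof
    fix x :: complex assume "x \<in> sphere 0 R"
    then obtain \<zeta> where \<zeta>: "\<zeta> \<in> sphere 0 R" "ball x d \<subseteq> ball \<zeta> (e \<zeta>)" using d(2) by blast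
    then show "\<exists>\<Psi>. translation_map T \<Psi> (ball x d) \<and> (\<forall>z\<in>ball x d \<inter> ball 0 R. \<Psi> z = \<Phi> z)"
      using e(3)[OF \<zeta>(1)] translation_map_subset[OF e(2)[OF \<zeta>(1)] _ \<zeta>(2)] by (intro exI[of _ "\<Psi> \<zeta>"]) auto
  qed
  then obtain \<Psi> where \<Psi>: "\<And>x. x \<in> sphere 0 R \<Longrightarrow> translation_map T (\<Psi> x) (ball x d)"
     "\<And>x z. x \<in> sphere 0 R \<Longrightarrow> z \<in> ball x d \<inter> ball 0 R \<Longrightarrow> \<Psi> x z = \<Phi> z"
    by metis
  have agree: "\<Psi> x z = \<Psi> y z" if x: "x \<in> sphere 0 R" and y: "y \<in> sphere 0 R" and z: "z \<in> ball x d \<inter> ball y d" for x y z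
  proof -
    \<comment> \<open>A common point of the two discs inside the given disc: the midpoint of the centres, or a
      point slightly inside on the radius if the centres coincide.\<close>
    define q where "q = min d R / (2 * R)"
    have q: "0 < q" "q < 1" "q * R < d" using d(1) \<open>R > 0\<close> by (auto simp: q_def field_simps min_def)
    define m where "m = (if x = y then of_real (1 - q) * x else (x + y) / 2)"
    have m: "m \<in> ball x d \<inter> ball y d \<inter> ball 0 R"
    proof (cases "x = y")
      case True
      have "dist x m = norm (of_real q * x)"
        using True by (simp add: m_def dist_norm algebra_simps)
      also have "\<dots> = q * R" unfolding norm_mult norm_of_real using x q by simp
      finally have "dist x m < d" using q by simp
      moreover have "norm m = (1 - q) * R"
        unfolding m_def if_P[OF True] norm_mult norm_of_real using x q by simp
      moreover have "(1 - q) * R < 1 * R" using q \<open>R > 0\<close> by (intro mult_strict_right_mono) auto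
      ultimately show ?thesis using True by simp
    next
      case False
      have dd: "dist x y < 2 * d" using z dist_triangle[of x y z] by (simp add: dist_commute)
      have "dist x m = dist x y / 2" "dist y m = dist x y / 2"
        using False by (simp_all add: m_def dist_midpoint[unfolded midpoint_def scaleR_conv_of_real, simplified] dist_norm flip: norm_divide_numeral)
           (simp_all add: field_simps norm_divide norm_minus_commute)
      moreover have "norm m < R"
      proof -
        have "midpoint x y \<in> open_segment x y" using False by simp
        then have "norm (midpoint x y) < R"
          using x y dist_decreases_open_segment[of "midpoint x y" x y 0] by auto
        then show ?thesis using False by (simp add: m_def midpoint_def scaleR_conv_of_real)
      qed
      ultimately show ?thesis using dd by simp
    qed
    show ?thesis
    proof (rule translation_map_unique[OF T, of _ "ball x d \<inter> ball y d" _ m])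
      show "translation_map T (\<Psi> x) (ball x d \<inter> ball y d)" by (rule translation_map_subset[OF \<Psi>(1)[OF x]]) auto
      show "translation_map T (\<Psi> y) (ball x d \<inter> ball y d)" by (rule translation_map_subset[OF \<Psi>(1)[OF y]]) auto
      show "connected (ball x d \<inter> ball y d)" by (intro convex_connected convex_Int convex_ball)
    qed (use m z \<Psi>(2) x y in auto)
  qed
  define u where "u = (\<lambda>z::complex. of_real (R / norm z) * z)"
  define \<Theta> where "\<Theta> = (\<lambda>z. if z \<in> ball 0 R then \<Phi> z else \<Psi> (u z) z)"
  have near: "\<Theta> z = \<Psi> x z" if x: "x \<in> sphere 0 R" and z: "z \<in> ball x d \<inter> ball 0 (R + d)" for x z
  proof (cases "z \<in> ball 0 R")
    case True then show ?thesis using \<Psi>(2)[OF x] z by (simp add: \<Theta>_def)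
  next
    case False
    then have nz: "norm z \<ge> R" "norm z > 0" using \<open>R > 0\<close> by auto
    have "norm (u z) = R" using nz \<open>R > 0\<close> by (simp add: u_def norm_mult norm_divide)
    moreover have "dist (u z) z < d"
    proof -
      have "dist (u z) z = norm (of_real (R / norm z - 1) * z)" by (simp add: u_def dist_norm algebra_simps)
      also have "\<dots> = \<bar>R / norm z - 1\<bar> * norm z" unfolding norm_mult norm_of_real by simp
      also have "\<bar>R / norm z - 1\<bar> = 1 - R / norm z" using nz by (simp add: field_simps)
      also have "(1 - R / norm z) * norm z = norm z - R" using nz by (simp add: left_diff_distrib)
      finally show ?thesis using z by simp
    qed
    ultimately have "\<Psi> (u z) z = \<Psi> x z" using agree[of "u z" x z] x z by simp
    then show ?thesis using False by (simp add: \<Theta>_def)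
  qed
  show thesis
  proof (rule that[of "R + d" \<Theta>])
    show "R + d > R" using d by simp
    show "\<Theta> z = \<Phi> z" if "z \<in> ball 0 R" for z using that by (simp add: \<Theta>_def)
    show "translation_map T \<Theta> (ball 0 (R + d))"
    proof (rule translation_mapI)
      fix z :: complex assume z: "z \<in> ball 0 (R + d)"
      have "\<exists>\<Psi>' S. translation_map T \<Psi>' S \<and> z \<in> S \<and> S \<subseteq> ball 0 (R + d) \<and> (\<forall>w\<in>S. \<Theta> w = \<Psi>' w)"
      proof (cases "z \<in> ball 0 R")
        case True
        then show ?thesis using \<Phi> d(1) by (intro exI[of _ \<Phi>] exI[of _ "ball 0 R"]) (auto simp: \<Theta>_def)
      next
        case False
        then have nz: "norm z \<ge> R" "norm z > 0" using \<open>R > 0\<close> by auto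
        have ns: "u z \<in> sphere 0 R" using nz \<open>R > 0\<close> by (simp add: u_def norm_mult norm_divide)
        have "dist (u z) z = norm (of_real (R / norm z - 1) * z)" by (simp add: u_def dist_norm algebra_simps)
        also have "\<dots> = \<bar>R / norm z - 1\<bar> * norm z" unfolding norm_mult norm_of_real by simp
        also have "\<bar>R / norm z - 1\<bar> = 1 - R / norm z" using nz by (simp add: field_simps)
        also have "(1 - R / norm z) * norm z = norm z - R" using nz by (simp add: left_diff_distrib)
        finally have "dist (u z) z < d" using z by simp
        then show ?thesis using near[OF ns] translation_map_subset[OF \<Psi>(1)[OF ns], of "ball (u z) d \<inter> ball 0 (R + d)"] z
          by (intro exI[of _ "\<Psi> (u z)"] exI[of _ "ball (u z) d \<inter> ball 0 (R + d)"]) auto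
      qed
      then obtain \<Psi>' S where S: "translation_map T \<Psi>' S" "z \<in> S" "S \<subseteq> ball 0 (R + d)" "\<And>w. w \<in> S \<Longrightarrow> \<Theta> w = \<Psi>' w"
        by blast
      from translation_mapE[OF S(1,2)] obtain e V F c where e: "e > 0" "(V, F) \<in> T" "ball z e \<subseteq> S" "\<Psi>' ` ball z e \<subseteq> V"
        "\<And>w. w\<in>ball z e \<Longrightarrow> F (\<Psi>' w) = w + c" by metis
      have eq: "\<Theta> w = \<Psi>' w" if "w \<in> ball z e" for w using S(4) e(3) that by blast
      show "\<exists>e V F c. e > 0 \<and> (V, F) \<in> T \<and> ball z e \<subseteq> ball 0 (R + d) \<and> \<Theta> ` ball z e \<subseteq> V \<and> (\<forall>w\<in>ball z e. F (\<Theta> w) = w + c)"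
        using e S(3) eq by (intro exI[of _ e] exI[of _ V] exI[of _ F] exI[of _ c]) (auto simp: image_subset_iff)
    qed
  qed
qed

text \<open>
  A continuity argument in the radius: by uniqueness the maps on smaller discs fit together to a map on the disc of
  the supremal radius, and this map extends further.
\<close>

theorem translation_map_on_all_discs:
  assumes T: "translation_atlas T" and p0: "p0 \<in> (\<Union>(V, F)\<in>T. V)"
    and lim: "\<And>\<Phi> R \<zeta>. R > 0 \<Longrightarrow> translation_map T \<Phi> (ball 0 R) \<Longrightarrow> \<Phi> 0 = p0 \<Longrightarrow> norm \<zeta> = R \<Longrightarrow>
      \<exists>p\<in>(\<Union>(V, F)\<in>T. V). ((\<lambda>t. \<Phi> (of_real t * \<zeta>)) \<longlongrightarrow> p) (at_left 1)"
  shows "\<exists>\<Phi>. translation_map T \<Phi> (ball 0 R) \<and> \<Phi> 0 = p0"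
proof (rule ccontr)
  assume contra: "\<nexists>\<Phi>. translation_map T \<Phi> (ball 0 R) \<and> \<Phi> 0 = p0"
  define A where "A = {r. r > 0 \<and> (\<exists>\<Phi>. translation_map T \<Phi> (ball 0 r) \<and> \<Phi> 0 = p0)}"
  have bd: "r \<le> R" if "r \<in> A" for r
  proof (rule ccontr)
    assume "\<not> r \<le> R"
    then have "ball (0::complex) R \<subseteq> ball 0 r" by auto
    then show False using contra that translation_map_subset[OF _ open_ball] unfolding A_def by blast
  qed
  obtain V F where V: "(V, F) \<in> T" "p0 \<in> V" using p0 by auto
  note ch = is_chartD[OF translation_atlas_chart[OF T V(1)]]
  obtain r0 where r0: "r0 > 0" "ball (F p0) r0 \<subseteq> F ` V" using ch(2) V(2) by (meson imageI open_contains_ball)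
  have "r0 \<in> A"
  proof -
    define \<Phi> where "\<Phi> = (\<lambda>w. inv_into V F (w + F p0))"
    have sub: "w + F p0 \<in> F ` V" if "w \<in> ball 0 r0" for w using that r0(2) by (auto simp: subset_iff dist_norm)
    have "translation_map T \<Phi> (ball 0 r0)"
    proof (rule translation_mapI)
      fix z :: complex assume "z \<in> ball 0 r0"
      then obtain e where "e > 0" "ball z e \<subseteq> ball 0 r0" by (meson open_ball open_contains_ball)
      then show "\<exists>e V F c. e > 0 \<and> (V, F) \<in> T \<and> ball z e \<subseteq> ball 0 r0 \<and> \<Phi> ` ball z e \<subseteq> V \<and> (\<forall>w\<in>ball z e. F (\<Phi> w) = w + c)"
        using V sub by (intro exI[of _ e] exI[of _ V] exI[of _ F] exI[of _ "F p0"])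
          (auto simp: \<Phi>_def f_inv_into_f subset_iff intro: inv_into_into)
    qed
    moreover have "\<Phi> 0 = p0" using ch(6)[OF V(2)] by (simp add: \<Phi>_def)
    ultimately show ?thesis using r0(1) unfolding A_def by blast
  qed
  then have Ane: "A \<noteq> {}" by blast
  have bdd: "bdd_above A" by (rule bdd_aboveI[of A R]) (rule bd)
  define s where "s = Sup A"
  have s0: "s > 0" using cSup_upper[OF \<open>r0 \<in> A\<close> bdd] r0(1) by (simp add: s_def)
  have ex: "\<exists>\<Phi>. translation_map T \<Phi> (ball 0 r) \<and> \<Phi> 0 = p0" if rs: "r < s" for r
  proof -
    obtain r' where "r' \<in> A" "r < r'" using less_cSupD[OF Ane rs[unfolded s_def]] by blast
    then obtain \<Phi> where \<Phi>: "translation_map T \<Phi> (ball 0 r')" "\<Phi> 0 = p0" by (auto simp: A_def)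
    have "ball (0::complex) r \<subseteq> ball 0 r'" using \<open>r < r'\<close> by auto
    then show ?thesis using \<Phi> translation_map_subset[OF \<Phi>(1) open_ball] by blast
  qed
  then obtain \<Psi> where \<Psi>: "\<And>r. r < s \<Longrightarrow> translation_map T (\<Psi> r) (ball 0 r) \<and> \<Psi> r 0 = p0" by metis
  have agree: "\<Psi> r z = \<Psi> r' z" if "r < s" "r' < s" "norm z < r" "norm z < r'" for r r' z
  proof (rule translation_map_unique[OF T, of _ "ball 0 (min r r')" _ 0])
    show "translation_map T (\<Psi> r) (ball 0 (min r r'))" "translation_map T (\<Psi> r') (ball 0 (min r r'))"
      using \<Psi> that by (auto intro!: translation_map_subset[OF \<Psi>[THEN conjunct1]])
    show "0 \<in> ball (0::complex) (min r r')" using le_less_trans[OF norm_ge_zero that(3)] le_less_trans[OF norm_ge_zero that(4)] by simp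
  qed (use \<Psi> that in auto)
  \<comment> \<open>Any radius between that of the point and the supremum would do.\<close>
  define \<Phi> where "\<Phi> = (\<lambda>z. \<Psi> ((norm z + s) / 2) z)"
  have eq: "\<Phi> z = \<Psi> r z" if "r < s" "norm z < r" for r z
    unfolding \<Phi>_def using that by (intro agree) auto
  have \<Phi>: "translation_map T \<Phi> (ball 0 s)"
  proof (rule translation_mapI)
    fix z :: complex assume "z \<in> ball 0 s"
    then obtain r where r: "norm z < r" "r < s" using dense by auto
    then have zr: "z \<in> ball 0 r" by simp
    from translation_mapE[OF \<Psi>[OF r(2), THEN conjunct1] zr] obtain e V F c where
      e: "e > 0" "(V, F) \<in> T" "ball z e \<subseteq> ball 0 r" "\<Psi> r ` ball z e \<subseteq> V" "\<And>w. w\<in>ball z e \<Longrightarrow> F (\<Psi> r w) = w + c"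
      by metis
    have q: "\<Phi> w = \<Psi> r w" if "w \<in> ball z e" for w using eq[OF r(2), of w] e(3) that by auto
    have "ball z e \<subseteq> ball 0 s" using e(3) r(2) by auto
    then show "\<exists>e V F c. e > 0 \<and> (V, F) \<in> T \<and> ball z e \<subseteq> ball 0 s \<and> \<Phi> ` ball z e \<subseteq> V \<and> (\<forall>w\<in>ball z e. F (\<Phi> w) = w + c)"
      using e q by (intro exI[of _ e] exI[of _ V] exI[of _ F] exI[of _ c]) (auto simp: image_subset_iff)
  qed
  have \<Phi>0: "\<Phi> 0 = p0" using \<Psi>[of "s/2"] s0 by (simp add: \<Phi>_def)
  obtain R' \<Psi>' where R': "R' > s" "translation_map T \<Psi>' (ball 0 R')" "\<And>z. z \<in> ball 0 s \<Longrightarrow> \<Psi>' z = \<Phi> z"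
    using translation_map_extend_disc[OF T \<Phi> s0 lim[OF s0 \<Phi> \<Phi>0]] by metis
  have "R' \<in> A" using R' s0 \<Phi>0 by (auto simp: A_def intro!: exI[of _ \<Psi>'])
  then show False using cSup_upper[OF _ bdd] R'(1) unfolding s_def by force
qed

section \<open>Holomorphic functions, forms and vector fields on a Riemann surface\<close>

definition hol_fun :: "('b::t2_space) chart set \<Rightarrow> ('b \<Rightarrow> complex) \<Rightarrow> bool" where
  "hol_fun B h \<longleftrightarrow> (\<forall>(U, \<phi>)\<in>B. (h \<circ> inv_into U \<phi>) holomorphic_on \<phi> ` U)"

text \<open>
  A 1-form is represented by its coefficient in each chart.
\<close>

definition hol_form :: "('b::t2_space) chart set \<Rightarrow> ('b set \<Rightarrow> ('b \<Rightarrow> complex) \<Rightarrow> complex \<Rightarrow> complex) \<Rightarrow> bool" where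
  "hol_form B k \<longleftrightarrow> (\<forall>(U, \<phi>)\<in>B. k U \<phi> holomorphic_on \<phi> ` U) \<and>
     (\<forall>(U, \<phi>)\<in>B. \<forall>(V, \<psi>)\<in>B. \<forall>p\<in>U \<inter> V.
        k U \<phi> (\<phi> p) = k V \<psi> (\<psi> p) * deriv (\<psi> \<circ> inv_into U \<phi>) (\<phi> p))"

text \<open>
  A vector field, represented like a 1-form by its coefficients; they transform with the derivative of
  the transition map instead of its inverse.
\<close>

definition hol_field :: "('b::t2_space) chart set \<Rightarrow> ('b set \<Rightarrow> ('b \<Rightarrow> complex) \<Rightarrow> complex \<Rightarrow> complex) \<Rightarrow> bool" where
  "hol_field B v \<longleftrightarrow> (\<forall>(U, \<phi>)\<in>B. v U \<phi> holomorphic_on \<phi> ` U) \<and>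
     (\<forall>(U, \<phi>)\<in>B. \<forall>(V, \<psi>)\<in>B. \<forall>p\<in>U \<inter> V.
        v V \<psi> (\<psi> p) = v U \<phi> (\<phi> p) * deriv (\<psi> \<circ> inv_into U \<phi>) (\<phi> p))"

definition hol_disc :: "('b::t2_space) chart set \<Rightarrow> (complex \<Rightarrow> 'b) \<Rightarrow> real \<Rightarrow> bool" where
  "hol_disc B \<Phi> R \<longleftrightarrow> continuous_on (ball 0 R) \<Phi> \<and>
     (\<forall>(U, \<phi>)\<in>B. (\<phi> \<circ> \<Phi>) holomorphic_on (ball 0 R \<inter> \<Phi> -` U))"

lemma chart_image_Int:
  assumes "is_chart U \<phi>" "open W"
  shows "open (\<phi> ` (U \<inter> W))"
proof -
  have "\<phi> ` (U \<inter> W) = \<phi> ` U \<inter> inv_into U \<phi> -` W"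
    using is_chartD(3)[OF assms(1)] by (auto simp: image_iff inv_into_f_f)
  then show ?thesis
    using continuous_open_preimage[OF is_chartD(5,2)[OF assms(1)] assms(2)] by simp
qed

lemma chart_preimage:
  assumes "is_chart U \<phi>" "open D"
  shows "open (U \<inter> \<phi> -` D)"
  using continuous_open_preimage[OF is_chartD(4,1)[OF assms(1)] assms(2)] by simp

locale surface =
  fixes B :: "('b::t2_space) chart set"
  assumes B: "riemann_surface B"
begin

lemma chart: "(U, \<phi>) \<in> B \<Longrightarrow> is_chart U \<phi>"
  using B unfolding riemann_surface_def complex_atlas_def chart_atlas_def by blast

lemma conn: "connected (UNIV :: 'b set)"
  using B unfolding riemann_surface_def by blast

lemma clopen_trivial:
  assumes "closed (S :: 'b set)" "open S"
  shows "S = {} \<or> S = UNIV"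
proof -
  have "closedin (top_of_set UNIV) S \<and> openin (top_of_set UNIV) S" using assms by simp
  then show ?thesis using conn[unfolded connected_clopen] by blast
qed

lemma ex_chart: obtains U \<phi> where "(U, \<phi>) \<in> B" "p \<in> U"
proof -
  have "(\<Union>(U, \<phi>)\<in>B. U) = UNIV"
    using B unfolding riemann_surface_def complex_atlas_def chart_atlas_def by (elim conjE)
  then have "p \<in> (\<Union>(U, \<phi>)\<in>B. U)" by (metis UNIV_I)
  then show thesis using that by blast
qed

lemma transition:
  assumes "(U, \<phi>) \<in> B" "(V, \<psi>) \<in> B"
  shows "(\<psi> \<circ> inv_into U \<phi>) holomorphic_on \<phi> ` (U \<inter> V)"
proof -
  have "\<forall>(U, \<phi>)\<in>B. \<forall>(V, \<psi>)\<in>B. (\<psi> \<circ> inv_into U \<phi>) holomorphic_on \<phi> ` (U \<inter> V)"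
    using B unfolding riemann_surface_def complex_atlas_def by blast
  from bspec[OF bspec[OF this assms(1), simplified] assms(2)] show ?thesis by simp
qed

lemmas chartD = is_chartD[OF chart]

lemma transition_deriv:
  assumes "(U, \<phi>) \<in> B" "(V, \<psi>) \<in> B" "p \<in> U \<inter> V"
  shows "((\<psi> \<circ> inv_into U \<phi>) has_field_derivative deriv (\<psi> \<circ> inv_into U \<phi>) (\<phi> p)) (at (\<phi> p))"
  by (rule holomorphic_derivI[OF transition[OF assms(1,2)]])
     (use assms chart_image_Int[OF chart[OF assms(1)] chartD(1)[OF assms(2)]] in auto)

lemma transition_deriv_nonzero:
  assumes "(U, \<phi>) \<in> B" "(V, \<psi>) \<in> B" "p \<in> U \<inter> V"
  shows "deriv (\<psi> \<circ> inv_into U \<phi>) (\<phi> p) \<noteq> 0"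
proof (rule holomorphic_injective_imp_regular[OF transition[OF assms(1,2)]])
  show "open (\<phi> ` (U \<inter> V))" using chart_image_Int[OF chart[OF assms(1)] chartD(1)[OF assms(2)]] .
  show "inj_on (\<psi> \<circ> inv_into U \<phi>) (\<phi> ` (U \<inter> V))"
    using chartD(6)[OF assms(1)] chartD(3)[OF assms(2)]
    by (auto simp: inj_on_def)
  show "\<phi> p \<in> \<phi> ` (U \<inter> V)" using assms(3) by blast
qed

lemma hol_funD: "hol_fun B h \<Longrightarrow> (U, \<phi>) \<in> B \<Longrightarrow> (h \<circ> inv_into U \<phi>) holomorphic_on \<phi> ` U"
  unfolding hol_fun_def by blast

lemma hol_fun_deriv:
  assumes "hol_fun B h" "(U, \<phi>) \<in> B" "p \<in> U"
  shows "((h \<circ> inv_into U \<phi>) has_field_derivative deriv (h \<circ> inv_into U \<phi>) (\<phi> p)) (at (\<phi> p))"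
  by (rule holomorphic_derivI[OF hol_funD[OF assms(1,2)] chartD(2)[OF assms(2)]]) (use assms in auto)

lemma hol_formD:
  assumes "hol_form B k" "(U, \<phi>) \<in> B"
  shows "k U \<phi> holomorphic_on \<phi> ` U"
    "(V, \<psi>) \<in> B \<Longrightarrow> p \<in> U \<Longrightarrow> p \<in> V \<Longrightarrow>
        k U \<phi> (\<phi> p) = k V \<psi> (\<psi> p) * deriv (\<psi> \<circ> inv_into U \<phi>) (\<phi> p)"
proof -
  show "k U \<phi> holomorphic_on \<phi> ` U" using assms unfolding hol_form_def by blast
  have "\<forall>(U, \<phi>)\<in>B. \<forall>(V, \<psi>)\<in>B. \<forall>p\<in>U \<inter> V.
        k U \<phi> (\<phi> p) = k V \<psi> (\<psi> p) * deriv (\<psi> \<circ> inv_into U \<phi>) (\<phi> p)"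
    using assms(1) unfolding hol_form_def by blast
  from bspec[OF this assms(2)] show "(V, \<psi>) \<in> B \<Longrightarrow> p \<in> U \<Longrightarrow> p \<in> V \<Longrightarrow>
        k U \<phi> (\<phi> p) = k V \<psi> (\<psi> p) * deriv (\<psi> \<circ> inv_into U \<phi>) (\<phi> p)"
    by (auto dest!: bspec)
qed

lemma hol_fieldD:
  assumes "hol_field B v" "(U, \<phi>) \<in> B"
  shows "v U \<phi> holomorphic_on \<phi> ` U"
    "(V, \<psi>) \<in> B \<Longrightarrow> p \<in> U \<Longrightarrow> p \<in> V \<Longrightarrow>
        v V \<psi> (\<psi> p) = v U \<phi> (\<phi> p) * deriv (\<psi> \<circ> inv_into U \<phi>) (\<phi> p)"
proof -
  show "v U \<phi> holomorphic_on \<phi> ` U" using assms unfolding hol_field_def by blast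
  have "\<forall>(U, \<phi>)\<in>B. \<forall>(V, \<psi>)\<in>B. \<forall>p\<in>U \<inter> V.
        v V \<psi> (\<psi> p) = v U \<phi> (\<phi> p) * deriv (\<psi> \<circ> inv_into U \<phi>) (\<phi> p)"
    using assms(1) unfolding hol_field_def by blast
  from bspec[OF this assms(2)] show "(V, \<psi>) \<in> B \<Longrightarrow> p \<in> U \<Longrightarrow> p \<in> V \<Longrightarrow>
        v V \<psi> (\<psi> p) = v U \<phi> (\<phi> p) * deriv (\<psi> \<circ> inv_into U \<phi>) (\<phi> p)"
    by (auto dest!: bspec)
qed

lemma hol_formI:
  assumes "\<And>U \<phi>. (U, \<phi>) \<in> B \<Longrightarrow> k U \<phi> holomorphic_on \<phi> ` U"
    "\<And>U \<phi> V \<psi> p. (U, \<phi>) \<in> B \<Longrightarrow> (V, \<psi>) \<in> B \<Longrightarrow> p \<in> U \<Longrightarrow> p \<in> V \<Longrightarrow>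
        k U \<phi> (\<phi> p) = k V \<psi> (\<psi> p) * deriv (\<psi> \<circ> inv_into U \<phi>) (\<phi> p)"
  shows "hol_form B k"
  unfolding hol_form_def using assms by (blast intro: assms)

lemma hol_fieldI:
  assumes "\<And>U \<phi>. (U, \<phi>) \<in> B \<Longrightarrow> v U \<phi> holomorphic_on \<phi> ` U"
    "\<And>U \<phi> V \<psi> p. (U, \<phi>) \<in> B \<Longrightarrow> (V, \<psi>) \<in> B \<Longrightarrow> p \<in> U \<Longrightarrow> p \<in> V \<Longrightarrow>
        v V \<psi> (\<psi> p) = v U \<phi> (\<phi> p) * deriv (\<psi> \<circ> inv_into U \<phi>) (\<phi> p)"
  shows "hol_field B v"
  unfolding hol_field_def using assms by (blast intro: assms)

lemma near_transition:
  assumes "(U, \<phi>) \<in> B" "(V, \<psi>) \<in> B" "p \<in> U" "p \<in> V"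
  shows "open (\<phi> ` (U \<inter> V))" "\<phi> p \<in> \<phi> ` (U \<inter> V)"
    "\<And>z. z \<in> \<phi> ` (U \<inter> V) \<Longrightarrow> inv_into V \<psi> ((\<psi> \<circ> inv_into U \<phi>) z) = inv_into U \<phi> z"
  using chart_image_Int[OF chart[OF assms(1)] chartD(1)[OF assms(2)]] assms
    chartD(6)[OF assms(1)] chartD(6)[OF assms(2)] by auto

lemma deriv_form:
  assumes "hol_fun B h"
  shows "hol_form B (\<lambda>U \<phi>. deriv (h \<circ> inv_into U \<phi>))"
proof -
  have "deriv (h \<circ> inv_into U \<phi>) (\<phi> p) = deriv (h \<circ> inv_into V \<psi>) (\<psi> p) * deriv (\<psi> \<circ> inv_into U \<phi>) (\<phi> p)"
    if U: "(U, \<phi>) \<in> B" and V: "(V, \<psi>) \<in> B" and p: "p \<in> U" "p \<in> V" for U \<phi> V \<psi> p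
  proof (rule DERIV_imp_deriv)
    note n = near_transition[OF U V p]
    have t: "(\<psi> \<circ> inv_into U \<phi>) (\<phi> p) = \<psi> p" using chartD(6)[OF U p(1)] by simp
    have "((h \<circ> inv_into V \<psi>) \<circ> (\<psi> \<circ> inv_into U \<phi>) has_field_derivative
      deriv (h \<circ> inv_into V \<psi>) (\<psi> p) * deriv (\<psi> \<circ> inv_into U \<phi>) (\<phi> p)) (at (\<phi> p))"
      by (rule DERIV_chain) (use hol_fun_deriv[OF assms V p(2)] transition_deriv[OF U V] p in \<open>simp_all add: t del: o_apply\<close>)
    then show "((h \<circ> inv_into U \<phi>) has_field_derivative
      deriv (h \<circ> inv_into V \<psi>) (\<psi> p) * deriv (\<psi> \<circ> inv_into U \<phi>) (\<phi> p)) (at (\<phi> p))"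
      by (rule has_field_derivative_transform_within_open[OF _ n(1,2)]) (use n(3) in auto)
  qed
  then show ?thesis
    by (intro hol_formI holomorphic_deriv[OF hol_funD[OF assms] chartD(2)])
qed

text \<open>
  The set \<open>Z\<close> is locally the zero set of a holomorphic function, so its interior is closed by analytic
  continuation in a chart disc.
\<close>

lemma identity_theorem:
  assumes loc: "\<And>U \<phi>. (U, \<phi>) \<in> B \<Longrightarrow> \<exists>k. k holomorphic_on \<phi> ` U \<and> (\<forall>p\<in>U. p \<in> Z \<longleftrightarrow> k (\<phi> p) = 0)"
    and O: "open O'" "O' \<noteq> {}" "O' \<subseteq> Z"
  shows "Z = UNIV"
proof -
  have "closed (interior Z)"
    unfolding closed_def
  proof (intro open_subopen[THEN iffD2] ballI)
    fix p assume p: "p \<in> - interior Z"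
    obtain U \<phi> where U: "(U, \<phi>) \<in> B" "p \<in> U" using ex_chart by metis
    obtain k where k: "k holomorphic_on \<phi> ` U" "\<And>q. q \<in> U \<Longrightarrow> q \<in> Z \<longleftrightarrow> k (\<phi> q) = 0" using loc[OF U(1)] by blast
    obtain r where r: "r > 0" "ball (\<phi> p) r \<subseteq> \<phi> ` U"
      using chartD(2)[OF U(1)] U(2) by (meson imageI open_contains_ball)
    define N where "N = U \<inter> \<phi> -` ball (\<phi> p) r"
    have N: "open N" "p \<in> N" unfolding N_def using chart_preimage[OF chart[OF U(1)] open_ball] U r by auto
    have "N \<inter> interior Z = {}"
    proof (rule ccontr)
      assume "N \<inter> interior Z \<noteq> {}"
      then obtain q where q: "q \<in> N" "q \<in> interior Z" by blast
      have "open (\<phi> ` (U \<inter> (N \<inter> interior Z)))" by (rule chart_image_Int[OF chart[OF U(1)]]) (use N in auto)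
      then have o: "open (\<phi> ` (N \<inter> interior Z))" by (simp add: N_def Int_assoc[symmetric])
      have "k z = 0" if z: "z \<in> ball (\<phi> p) r" for z
      proof (rule analytic_continuation_open[of "\<phi> ` (N \<inter> interior Z)" "ball (\<phi> p) r" k "\<lambda>_. 0"])
        show "k holomorphic_on ball (\<phi> p) r" using k(1) r(2) holomorphic_on_subset by blast
        show "\<And>z. z \<in> \<phi> ` (N \<inter> interior Z) \<Longrightarrow> k z = 0" using k(2) interior_subset by (force simp: N_def)
      qed (use o q z in \<open>auto simp: N_def\<close>)
      then have "N \<subseteq> Z" using k(2) by (auto simp: N_def)
      then have "p \<in> interior Z" using N by (meson interiorI)
      then show False using p by simp
    qed
    then show "\<exists>T. open T \<and> p \<in> T \<and> T \<subseteq> - interior Z" using N by blast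
  qed
  then have "interior Z = {} \<or> interior Z = UNIV" by (intro clopen_trivial open_interior)
  moreover have "interior Z \<noteq> {}" using interior_maximal[OF O(3,1)] O(2) by auto
  ultimately show ?thesis using interior_subset[of Z] by auto
qed

definition zeros :: "('b set \<Rightarrow> ('b \<Rightarrow> complex) \<Rightarrow> complex \<Rightarrow> complex) \<Rightarrow> 'b set" where
  "zeros k = {p. \<exists>(U, \<phi>)\<in>B. p \<in> U \<and> k U \<phi> (\<phi> p) = 0}"

lemma form_zeros_chart:
  assumes "hol_form B k" "(U, \<phi>) \<in> B" "p \<in> U"
  shows "p \<in> zeros k \<longleftrightarrow> k U \<phi> (\<phi> p) = 0"
proof
  assume "p \<in> zeros k"
  then obtain V \<psi> where V: "(V, \<psi>) \<in> B" "p \<in> V" "k V \<psi> (\<psi> p) = 0" unfolding zeros_def by blast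
  show "k U \<phi> (\<phi> p) = 0" unfolding hol_formD(2)[OF assms(1,2) V(1) assms(3) V(2)] V(3) by simp
qed (use assms in \<open>auto simp: zeros_def\<close>)

lemma field_zeros_chart:
  assumes "hol_field B k" "(U, \<phi>) \<in> B" "p \<in> U"
  shows "p \<in> zeros k \<longleftrightarrow> k U \<phi> (\<phi> p) = 0"
proof
  assume "p \<in> zeros k"
  then obtain V \<psi> where V: "(V, \<psi>) \<in> B" "p \<in> V" "k V \<psi> (\<psi> p) = 0" unfolding zeros_def by blast
  show "k U \<phi> (\<phi> p) = 0" unfolding hol_fieldD(2)[OF assms(1) V(1) assms(2) V(2) assms(3)] V(3) by simp
qed (use assms in \<open>auto simp: zeros_def\<close>)

lemma form_zeros_identity:
  assumes "hol_form B k" "open O'" "O' \<noteq> {}" "O' \<subseteq> zeros k"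
  shows "zeros k = UNIV"
proof (rule identity_theorem[OF _ assms(2-4)])
  fix U \<phi> assume U: "(U, \<phi>) \<in> B"
  show "\<exists>f. f holomorphic_on \<phi> ` U \<and> (\<forall>p\<in>U. (p \<in> zeros k) = (f (\<phi> p) = 0))"
    using hol_formD(1)[OF assms(1) U] form_zeros_chart[OF assms(1) U] by blast
qed

lemma zeros_closed:
  assumes "hol_form B k"
  shows "closed (zeros k)"
  unfolding closed_def
proof (intro open_subopen[THEN iffD2] ballI)
  fix p assume p: "p \<in> - zeros k"
  obtain U \<phi> where U: "(U, \<phi>) \<in> B" "p \<in> U" using ex_chart by metis
  have "open (\<phi> ` U \<inter> k U \<phi> -` (- {0}))"
    using holomorphic_on_imp_continuous_on[OF hol_formD(1)[OF assms U(1)]] chartD(2)[OF U(1)]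
    by (intro continuous_open_preimage) auto
  then have "open (U \<inter> \<phi> -` (\<phi> ` U \<inter> k U \<phi> -` (- {0})))" by (rule chart_preimage[OF chart[OF U(1)]])
  then show "\<exists>T. open T \<and> p \<in> T \<and> T \<subseteq> - zeros k"
    using U p form_zeros_chart[OF assms U(1)]
    by (intro exI[of _ "U \<inter> \<phi> -` (\<phi> ` U \<inter> k U \<phi> -` (- {0}))"]) auto
qed

lemma zero_deriv_imp_constant:
  assumes h: "hol_fun B h" and z: "zeros (\<lambda>U \<phi>. deriv (h \<circ> inv_into U \<phi>)) = UNIV"
  shows "h constant_on UNIV"
proof -
  fix p0 :: 'b
  have opn: "open {p. h p = c}" for c
  proof (intro open_subopen[THEN iffD2] ballI)
    fix p assume p: "p \<in> {p. h p = c}"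
    obtain U \<phi> where U: "(U, \<phi>) \<in> B" "p \<in> U" using ex_chart by metis
    obtain r where r: "r > 0" "ball (\<phi> p) r \<subseteq> \<phi> ` U"
      using chartD(2)[OF U(1)] U(2) by (meson imageI open_contains_ball)
    define N where "N = U \<inter> \<phi> -` ball (\<phi> p) r"
    have N: "open N" "p \<in> N" unfolding N_def using chart_preimage[OF chart[OF U(1)] open_ball] U r by auto
    have "\<exists>c. \<forall>z\<in>ball (\<phi> p) r. (h \<circ> inv_into U \<phi>) z = c"
    proof (rule has_field_derivative_zero_constant)
      fix z assume "z \<in> ball (\<phi> p) r"
      then obtain q where q: "q \<in> U" "z = \<phi> q" using r(2) by blast
      have "deriv (h \<circ> inv_into U \<phi>) (\<phi> q) = 0"
        using z form_zeros_chart[OF deriv_form[OF h] U(1) q(1)] by simp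
      then show "((h \<circ> inv_into U \<phi>) has_field_derivative 0) (at z within ball (\<phi> p) r)"
        using hol_fun_deriv[OF h U(1) q(1)] q(2) has_field_derivative_at_within by metis
    qed simp
    then obtain d where d: "\<And>z. z\<in>ball (\<phi> p) r \<Longrightarrow> h (inv_into U \<phi> z) = d" by auto
    have "h q = d" if "q \<in> N" for q using d[of "\<phi> q"] that chartD(6)[OF U(1), of q] by (auto simp: N_def)
    then show "\<exists>T. open T \<and> p \<in> T \<and> T \<subseteq> {p. h p = c}" using N p by (intro exI[of _ N]) auto
  qed
  have "- {p. h p = h p0} = (\<Union>c\<in>-{h p0}. {p. h p = c})" by auto
  then have "closed {p. h p = h p0}" unfolding closed_def using opn by (simp add: open_UN)
  then have "{p. h p = h p0} = UNIV" using clopen_trivial[OF _ opn] by blast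
  then show ?thesis unfolding constant_on_def by auto
qed

text \<open>
  The charts of the flat structure of a vector field \<open>v\<close> are the primitives of the dual 1-form \<open>1/v\<close>; the condition
  on the derivative keeps them away from the zeros of \<open>v\<close>. In these charts \<open>v\<close> is the constant field \<open>1\<close>.
\<close>

definition flat_atlas :: "('b set \<Rightarrow> ('b \<Rightarrow> complex) \<Rightarrow> complex \<Rightarrow> complex) \<Rightarrow> 'b chart set" where
  "flat_atlas v = {(V, F). is_chart V F \<and> (\<forall>(U, \<phi>)\<in>B. \<forall>p\<in>U \<inter> V. \<exists>D.
      ((F \<circ> inv_into U \<phi>) has_field_derivative D) (at (\<phi> p)) \<and> D * v U \<phi> (\<phi> p) = 1)}"

lemma flat_atlasD:
  assumes "(V, F) \<in> flat_atlas v"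
  shows "is_chart V F"
   "(U, \<phi>) \<in> B \<Longrightarrow> p \<in> U \<Longrightarrow> p \<in> V \<Longrightarrow> v U \<phi> (\<phi> p) \<noteq> 0 \<and>
      ((F \<circ> inv_into U \<phi>) has_field_derivative (inverse (v U \<phi> (\<phi> p)))) (at (\<phi> p))"
proof -
  show "is_chart V F" using assms unfolding flat_atlas_def by blast
  have *: "\<forall>(U, \<phi>)\<in>B. \<forall>p\<in>U \<inter> V. \<exists>D.
      ((F \<circ> inv_into U \<phi>) has_field_derivative D) (at (\<phi> p)) \<and> D * v U \<phi> (\<phi> p) = 1"
    using assms unfolding flat_atlas_def by blast
  assume U: "(U, \<phi>) \<in> B" "p \<in> U" "p \<in> V"
  from bspec[OF * U(1)] U obtain D where D: "((F \<circ> inv_into U \<phi>) has_field_derivative D) (at (\<phi> p))" "D * v U \<phi> (\<phi> p) = 1"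
    by auto
  then have "v U \<phi> (\<phi> p) \<noteq> 0" "D = inverse (v U \<phi> (\<phi> p))"
    using inverse_unique[of "v U \<phi> (\<phi> p)" D] by (auto simp: mult.commute)
  then show "v U \<phi> (\<phi> p) \<noteq> 0 \<and>
      ((F \<circ> inv_into U \<phi>) has_field_derivative (inverse (v U \<phi> (\<phi> p)))) (at (\<phi> p))" using D by simp
qed

lemma flat_translation_atlas: "translation_atlas (flat_atlas v)"
proof -
  have "\<exists>N c. open N \<and> p \<in> N \<and> N \<subseteq> V \<inter> W \<and> (\<forall>q\<in>N. G q = F q + c)"
    if V: "(V, F) \<in> flat_atlas v" and W: "(W, G) \<in> flat_atlas v" and p: "p \<in> V \<inter> W" for V F W G p
  proof -
    obtain U \<phi> where U: "(U, \<phi>) \<in> B" "p \<in> U" using ex_chart by metis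
    have "open (\<phi> ` (U \<inter> (V \<inter> W)))"
      by (intro chart_image_Int[OF chart[OF U(1)]] open_Int is_chartD(1)[OF flat_atlasD(1)[OF V]]
            is_chartD(1)[OF flat_atlasD(1)[OF W]])
    then obtain r where r: "r > 0" "ball (\<phi> p) r \<subseteq> \<phi> ` (U \<inter> (V \<inter> W))"
      by (rule openE) (use U p in auto)
    define N where "N = U \<inter> \<phi> -` ball (\<phi> p) r"
    have N: "open N" "p \<in> N" unfolding N_def using chart_preimage[OF chart[OF U(1)] open_ball] U r by auto
    have NV: "N \<subseteq> V \<inter> W"
      using r(2) chartD(3)[OF U(1)] unfolding N_def inj_on_def by blast
    \<comment> \<open>Two primitives of the same form differ by a constant.\<close>
    have "\<exists>c. \<forall>z\<in>ball (\<phi> p) r. ((G \<circ> inv_into U \<phi>) z - (F \<circ> inv_into U \<phi>) z) = c"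
    proof (rule has_field_derivative_zero_constant)
      fix z assume "z \<in> ball (\<phi> p) r"
      then obtain q where q: "q \<in> U" "q \<in> V" "q \<in> W" "z = \<phi> q" using r(2) by blast
      have "((\<lambda>z. (G \<circ> inv_into U \<phi>) z - (F \<circ> inv_into U \<phi>) z) has_field_derivative
          inverse (v U \<phi> (\<phi> q)) - inverse (v U \<phi> (\<phi> q))) (at (\<phi> q))"
        by (intro DERIV_diff flat_atlasD(2)[OF V U(1), THEN conjunct2] flat_atlasD(2)[OF W U(1), THEN conjunct2] q)
      then show "((\<lambda>z. (G \<circ> inv_into U \<phi>) z - (F \<circ> inv_into U \<phi>) z) has_field_derivative 0)
          (at z within ball (\<phi> p) r)"
        using q by (simp add: has_field_derivative_at_within)
    qed simp
    then obtain c where c: "\<And>z. z\<in>ball (\<phi> p) r \<Longrightarrow> (G (inv_into U \<phi> z) - F (inv_into U \<phi> z)) = c" by auto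
    have "G q = F q + c" if q: "q \<in> N" for q
      using c[of "\<phi> q"] chartD(6)[OF U(1), of q] q by (auto simp: N_def)
    then show ?thesis using N NV by blast
  qed
  then show ?thesis using flat_atlasD(1) unfolding translation_atlas_def by blast
qed

lemma flat_atlas_cover:
  assumes v: "hol_field B v"
  shows "(\<Union>(V, F)\<in>flat_atlas v. V) = - zeros v"
proof (intro equalityI subsetI)
  fix p assume "p \<in> (\<Union>(V, F)\<in>flat_atlas v. V)"
  then obtain V F where V: "(V, F) \<in> flat_atlas v" "p \<in> V" by blast
  then show "p \<in> - zeros v" using flat_atlasD(2)[OF V(1)] unfolding zeros_def by auto
next
  fix p assume p: "p \<in> - zeros v"
  obtain U \<phi> where U: "(U, \<phi>) \<in> B" "p \<in> U" using ex_chart by metis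
  have vp: "v U \<phi> (\<phi> p) \<noteq> 0" using p field_zeros_chart[OF v U] by simp
  note hv = hol_fieldD(1)[OF v U(1)]
  have "open (\<phi> ` U \<inter> v U \<phi> -` (- {0}))"
    using holomorphic_on_imp_continuous_on[OF hv] chartD(2)[OF U(1)]
    by (intro continuous_open_preimage) auto
  then obtain r where r: "r > 0" "ball (\<phi> p) r \<subseteq> \<phi> ` U \<inter> v U \<phi> -` (- {0})"
    by (rule openE) (use U vp in auto)
  have "(\<lambda>z. inverse (v U \<phi> z)) holomorphic_on ball (\<phi> p) r"
    using hv r by (intro holomorphic_on_inverse) (auto intro: holomorphic_on_subset)
  then obtain G where G0: "\<And>z. z \<in> ball (\<phi> p) r \<Longrightarrow> (G has_field_derivative inverse (v U \<phi> z)) (at z within ball (\<phi> p) r)"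
    using holomorphic_convex_primitive'[of "ball (\<phi> p) r"] by auto
  have G: "(G has_field_derivative inverse (v U \<phi> z)) (at z)" if "z \<in> ball (\<phi> p) r" for z
    using G0[OF that] that by (simp add: at_within_open[OF that open_ball])
  have holG: "G holomorphic_on ball (\<phi> p) r" using G unfolding holomorphic_on_open[OF open_ball] by blast
  have "deriv G (\<phi> p) \<noteq> 0" using DERIV_imp_deriv[OF G[of "\<phi> p"]] r vp by simp
  then obtain s where s: "s > 0" "ball (\<phi> p) s \<subseteq> ball (\<phi> p) r" "open (G ` ball (\<phi> p) s)" "inj_on G (ball (\<phi> p) s)"
    using has_complex_derivative_locally_invertible[OF holG _ open_ball] r(1) by (metis centre_in_ball)
  define V where "V = U \<inter> \<phi> -` ball (\<phi> p) s"
  define F where "F = G \<circ> \<phi>"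
  have V: "open V" "p \<in> V" unfolding V_def using chart_preimage[OF chart[OF U(1)] open_ball] U s by auto
  have \<phi>V: "\<phi> ` V = ball (\<phi> p) s" using s(2) r(2) unfolding V_def by blast
  have contG: "continuous_on (ball (\<phi> p) s) G"
    using holG s(2) holomorphic_on_imp_continuous_on holomorphic_on_subset by blast
  have "is_chart V F" unfolding is_chart_def
  proof (intro conjI)
    show "open V" by fact
    show "open (F ` V)" using s(3) unfolding F_def image_comp[symmetric] \<phi>V .
    have injF: "inj_on F V" unfolding F_def
      using s(4) chartD(3)[OF U(1)] by (intro comp_inj_on) (auto simp: \<phi>V V_def intro: inj_on_subset)
    have contF: "continuous_on V F" unfolding F_def
      by (intro continuous_on_compose contG[folded \<phi>V] continuous_on_subset[OF chartD(4)[OF U(1)]]) (auto simp: V_def)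
    obtain G' where G': "homeomorphism (ball (\<phi> p) s) (G ` ball (\<phi> p) s) G G'"
      using invariance_of_domain_homeomorphism[OF open_ball contG _ s(4)] by auto
    have "inv_into V F y = inv_into U \<phi> (G' y)" if yF: "y \<in> F ` V" for y
    proof -
      obtain q where q: "q \<in> V" "y = F q" using yF by blast
      have "G' y = \<phi> q" using G' q \<phi>V unfolding F_def homeomorphism_def by auto
      then show ?thesis using q injF chartD(6)[OF U(1), of q] by (simp add: V_def inv_into_f_f)
    qed
    moreover have "continuous_on (F ` V) (\<lambda>y. inv_into U \<phi> (G' y))"
    proof (rule continuous_on_compose2[OF chartD(5)[OF U(1)]])
      have "F ` V = G ` ball (\<phi> p) s" unfolding F_def image_comp[symmetric] \<phi>V ..
      then show "continuous_on (F ` V) G'" "G' ` (F ` V) \<subseteq> \<phi> ` U"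
        using G' s(2) r(2) unfolding homeomorphism_def by auto
    qed
    ultimately have ci: "continuous_on (F ` V) (inv_into V F)" by (metis continuous_on_cong)
    show "homeomorphism V (F ` V) F (inv_into V F)"
      unfolding homeomorphism_def using contF ci injF
      by (auto simp: inv_into_f_f f_inv_into_f inv_into_into image_iff intro: inv_into_f_f[symmetric])
  qed
  moreover have "\<exists>D. ((F \<circ> inv_into W \<psi>) has_field_derivative D) (at (\<psi> q)) \<and> D * v W \<psi> (\<psi> q) = 1"
    if W: "(W, \<psi>) \<in> B" and q: "q \<in> W" "q \<in> V" for W \<psi> q
  proof -
    have qU: "q \<in> U" "\<phi> q \<in> ball (\<phi> p) s" using q(2) by (auto simp: V_def)
    have "(F \<circ> inv_into W \<psi>) = G \<circ> (\<phi> \<circ> inv_into W \<psi>)" by (simp add: F_def o_assoc)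
    moreover have "(G \<circ> (\<phi> \<circ> inv_into W \<psi>) has_field_derivative
        inverse (v U \<phi> (\<phi> q)) * deriv (\<phi> \<circ> inv_into W \<psi>) (\<psi> q)) (at (\<psi> q))"
    proof (rule DERIV_chain)
      have "(\<phi> \<circ> inv_into W \<psi>) (\<psi> q) = \<phi> q" using chartD(6)[OF W q(1)] by simp
      then show "(G has_field_derivative inverse (v U \<phi> (\<phi> q))) (at ((\<phi> \<circ> inv_into W \<psi>) (\<psi> q)))"
        using G[of "\<phi> q"] qU s(2) by auto
    qed (use transition_deriv[OF W U(1)] q qU in auto)
    moreover have "inverse (v U \<phi> (\<phi> q)) * deriv (\<phi> \<circ> inv_into W \<psi>) (\<psi> q) * v W \<psi> (\<psi> q) = 1"
    proof -
      have "v U \<phi> (\<phi> q) = v W \<psi> (\<psi> q) * deriv (\<phi> \<circ> inv_into W \<psi>) (\<psi> q)"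
        by (rule hol_fieldD(2)[OF v W U(1) q(1) qU(1)])
      moreover have "v U \<phi> (\<phi> q) \<noteq> 0" using qU s(2) r(2) by auto
      ultimately show ?thesis by (simp add: field_simps)
    qed
    ultimately show ?thesis by auto
  qed
  ultimately have "(V, F) \<in> flat_atlas v" unfolding flat_atlas_def by blast
  then show "p \<in> (\<Union>(V, F)\<in>flat_atlas v. V)" using V(2) by blast
qed

text \<open>
  Translation maps for the flat structure are the complex integral curves of \<open>v\<close>.
\<close>

lemma flat_map_deriv:
  assumes \<Phi>: "translation_map (flat_atlas v) \<Phi> S" and w: "w \<in> S" and U: "(U, \<phi>) \<in> B" "\<Phi> w \<in> U"
  shows "((\<phi> \<circ> \<Phi>) has_field_derivative v U \<phi> (\<phi> (\<Phi> w))) (at w)" "v U \<phi> (\<phi> (\<Phi> w)) \<noteq> 0"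
proof -
  from translation_mapE[OF \<Phi> w] obtain e V F c where e: "e > 0" "(V, F) \<in> flat_atlas v" "ball w e \<subseteq> S" "\<Phi> ` ball w e \<subseteq> V"
     "\<And>u. u\<in>ball w e \<Longrightarrow> F (\<Phi> u) = u + c" by metis
  have cont: "continuous_on S \<Phi>" by (rule translation_map_continuous[OF flat_translation_atlas \<Phi>])
  have "open (ball w e \<inter> \<Phi> -` U)"
    by (intro continuous_open_preimage continuous_on_subset[OF cont] e chartD(1)[OF U(1)]) simp
  moreover have wN: "w \<in> ball w e \<inter> \<Phi> -` U" using e U by simp
  ultimately have N: "open (ball w e \<inter> \<Phi> -` U)" "w \<in> ball w e \<inter> \<Phi> -` U" by blast+
  have pV: "\<Phi> w \<in> V" using e by auto
  note D = flat_atlasD(2)[OF e(2) U pV]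
  then show nz: "v U \<phi> (\<phi> (\<Phi> w)) \<noteq> 0" by blast
  have "continuous_on (ball w e \<inter> \<Phi> -` U) (\<phi> \<circ> \<Phi>)"
    by (intro continuous_on_compose continuous_on_subset[OF cont] continuous_on_subset[OF chartD(4)[OF U(1)]])
       (use e(3) in auto)
  then have c: "continuous (at w) (\<phi> \<circ> \<Phi>)" using N continuous_on_eq_continuous_at[OF N(1)] by blast
  have "((\<phi> \<circ> \<Phi>) has_field_derivative inverse (inverse (v U \<phi> (\<phi> (\<Phi> w))))) (at w)"
  proof (rule has_field_derivative_inverse_basic[OF _ _ c N])
    show "((\<lambda>z. (F \<circ> inv_into U \<phi>) z - c) has_field_derivative inverse (v U \<phi> (\<phi> (\<Phi> w)))) (at ((\<phi> \<circ> \<Phi>) w))"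
      using DERIV_diff[OF conjunct2[OF D] DERIV_const[of c]] by simp
    show "\<And>z. z \<in> ball w e \<inter> \<Phi> -` U \<Longrightarrow> (F \<circ> inv_into U \<phi>) ((\<phi> \<circ> \<Phi>) z) - c = z"
      using e(5) chartD(6)[OF U(1)] by auto
  qed (use nz in simp)
  then show "((\<phi> \<circ> \<Phi>) has_field_derivative v U \<phi> (\<phi> (\<Phi> w))) (at w)" by simp
qed

end

section \<open>Incompleteness of metrics with many omitted values\<close>

text \<open>
  A holomorphic function vanishes at least to first order at its zeros.
\<close>

lemma zero_lipschitz:
  assumes "f holomorphic_on S" "open S" "a \<in> S" "f a = 0"
  obtains r C where "r > 0" "C > 0" "ball a r \<subseteq> S" "\<And>z. z \<in> ball a r \<Longrightarrow> norm (f z) \<le> C * norm (z - a)"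
proof -
  have "(f has_field_derivative deriv f a) (at a)" by (rule holomorphic_derivI[OF assms(1-3)])
  then have "((\<lambda>z. (f z - f a) / (z - a)) \<longlongrightarrow> deriv f a) (at a)" by (simp add: has_field_derivative_iff)
  then have "((\<lambda>z. norm (f z / (z - a))) \<longlongrightarrow> norm (deriv f a)) (at a)"
    using assms(4) by (intro tendsto_norm) simp
  then have "\<forall>\<^sub>F z in at a. norm (f z / (z - a)) < norm (deriv f a) + 1" by (rule order_tendstoD) simp
  then obtain d where d: "d > 0" "\<And>z. z \<noteq> a \<Longrightarrow> dist z a < d \<Longrightarrow> norm (f z / (z - a)) < norm (deriv f a) + 1"
    unfolding eventually_at by auto
  obtain r where r: "r > 0" "ball a r \<subseteq> S" using assms by (meson open_contains_ball)
  show thesis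
  proof (rule that[of "min r d" "norm (deriv f a) + 1"])
    show "norm (f z) \<le> (norm (deriv f a) + 1) * norm (z - a)" if "z \<in> ball a (min r d)" for z
    proof (cases "z = a")
      case False
      then show ?thesis using d(2)[of z] that by (simp add: norm_divide field_simps dist_commute)
    qed (simp add: assms)
  qed (use r d in \<open>auto intro: add_nonneg_pos\<close>)
qed

text \<open>
  Gronwall: the squared distance to the zero, multiplied by \<open>exp (2 * C * t)\<close>, is nondecreasing,
  so it cannot tend to \<open>0\<close> in finite time.
\<close>

lemma integral_curve_avoids_zero:
  fixes z :: "real \<Rightarrow> complex"
  assumes t0: "t0 < 1" and der: "\<And>t. t0 < t \<Longrightarrow> t < 1 \<Longrightarrow> (z has_vector_derivative z' t) (at t)"
    and bd: "\<And>t. t0 < t \<Longrightarrow> t < 1 \<Longrightarrow> norm (z' t) \<le> C * norm (z t - a)"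
    and ne: "\<And>t. t0 < t \<Longrightarrow> t < 1 \<Longrightarrow> z t \<noteq> a"
  shows "\<not> (z \<longlongrightarrow> a) (at_left 1)"
proof
  assume lim: "(z \<longlongrightarrow> a) (at_left 1)"
  define E where "E = (\<lambda>t. ((z t - a) \<bullet> (z t - a)) * exp (2 * C * t))"
  have limE: "(E \<longlongrightarrow> ((a - a) \<bullet> (a - a)) * exp (2 * C * 1)) (at_left 1)"
    unfolding E_def by (intro tendsto_intros lim)
  define s where "s = (t0 + 1) / 2"
  have s: "t0 < s" "s < 1" using t0 by (auto simp: s_def)
  have dE: "\<exists>y. (E has_real_derivative y) (at t) \<and> 0 \<le> y" if t: "t0 < t" "t < 1" for t
  proof -
    have "((\<lambda>t. z t - a) has_vector_derivative z' t) (at t)"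
      using has_vector_derivative_diff[OF der[OF t] has_vector_derivative_const[of a]] by simp
    from bounded_bilinear.has_vector_derivative[OF bounded_bilinear_inner this this]
    have 1: "((\<lambda>t. (z t - a) \<bullet> (z t - a)) has_real_derivative 2 * ((z t - a) \<bullet> z' t)) (at t)"
      by (simp add: has_real_derivative_iff_has_vector_derivative inner_commute)
    have "(E has_real_derivative (2 * ((z t - a) \<bullet> z' t) + 2 * C * ((z t - a) \<bullet> (z t - a))) * exp (2 * C * t)) (at t)"
      unfolding E_def by (rule derivative_eq_intros 1 refl | simp add: algebra_simps)+
    moreover have "\<bar>(z t - a) \<bullet> z' t\<bar> \<le> norm (z t - a) * (C * norm (z t - a))"
      by (rule order_trans[OF Cauchy_Schwarz_ineq2]) (intro mult_left_mono bd t norm_ge_zero)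
    then have "0 \<le> 2 * ((z t - a) \<bullet> z' t) + 2 * C * ((z t - a) \<bullet> (z t - a))"
      unfolding dot_square_norm power2_eq_square by (simp add: algebra_simps)
    ultimately show ?thesis by (blast intro: mult_nonneg_nonneg exp_ge_zero)
  qed
  have mono: "E s \<le> E t" if "s \<le> t" "t < 1" for t
    by (rule DERIV_nonneg_imp_nondecreasing[OF that(1)]) (use dE s that in auto)
  have "E s \<le> ((a - a) \<bullet> (a - a)) * exp (2 * C * 1)"
  proof (rule tendsto_lowerbound[OF limE])
    show "\<forall>\<^sub>F t in at_left 1. E s \<le> E t"
      using mono s by (intro eventually_at_leftI[of s]) auto
  qed simp
  moreover have "E s > 0" using ne[OF s] by (simp add: E_def)
  ultimately show False by simp
qed

text \<open>
  The arithmetic behind the length estimate. Here \<open>X\<close> is the modulus of the form \<open>f\<close>, \<open>x\<close> and \<open>y\<close>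
  are the moduli of the derivatives of \<open>h1\<close> and \<open>h2\<close>, \<open>p\<close> and \<open>q\<close> the products of the distances to the
  omitted values, \<open>u1 = 1 + |h1|\<close> and \<open>u2 = 1 + |h2|\<close>, all in the flat coordinate, and \<open>d\<close> is the distance to the boundary of
  the disc. The equation says that the vector field is \<open>1\<close> in this coordinate. The available powers \<open>u1 ^ 34\<close> and \<open>u2 ^ 32\<close>
  exceed the required \<open>31\<close>, and the resulting exponent \<open>-30/31\<close> of \<open>d\<close> is greater than \<open>-1\<close>, hence integrable.
\<close>

lemma power_estimate:
  fixes X d x y p q K1 K2 u1 u2 :: real
  assumes pos: "X \<ge> 0" "x \<ge> 0" "y \<ge> 0" "d > 0" "p > 0" "q > 0" "u1 \<ge> 1" "u2 \<ge> 1" "K1 > 0" "K2 > 0"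
    and eq: "X ^ 31 * p ^ 9 * q ^ 18 = x ^ 10 * y ^ 20"
    and 1: "(x * d) ^ 10 * u1 ^ 36 \<le> K1 * p ^ 9 * u1 ^ 2"
    and 2: "(y * d) ^ 10 * u2 ^ 18 \<le> K2 * q ^ 9 * u2 ^ 2"
  shows "X * u1 * u2 \<le> (K1 * K2 ^ 2) powr (1/31) * d powr (-30/31)"
proof -
  have "(x * d) ^ 10 * u1 ^ 34 * u1 ^ 2 \<le> K1 * p ^ 9 * u1 ^ 2"
    using 1 by (simp add: mult.assoc flip: power_add)
  then have a1: "(x * d) ^ 10 * u1 ^ 34 \<le> K1 * p ^ 9" using pos by simp
  have "(y * d) ^ 10 * u2 ^ 16 * u2 ^ 2 \<le> K2 * q ^ 9 * u2 ^ 2"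
    using 2 by (simp add: mult.assoc flip: power_add)
  then have a2: "(y * d) ^ 10 * u2 ^ 16 \<le> K2 * q ^ 9" using pos by simp
  have b1: "(x * d) ^ 10 * u1 ^ 31 \<le> K1 * p ^ 9"
    by (rule order_trans[OF _ a1]) (use pos in \<open>intro mult_left_mono power_increasing; simp\<close>)
  have "((y * d) ^ 10 * u2 ^ 16) ^ 2 \<le> (K2 * q ^ 9) ^ 2"
    by (intro power_mono a2) (use pos in auto)
  then have a2': "(y * d) ^ 20 * u2 ^ 32 \<le> K2 ^ 2 * q ^ 18"
    by (simp add: power_mult_distrib flip: power_mult)
  have b2: "(y * d) ^ 20 * u2 ^ 31 \<le> K2 ^ 2 * q ^ 18"
    by (rule order_trans[OF _ a2']) (use pos in \<open>intro mult_left_mono power_increasing; simp\<close>)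
  have "(X * u1 * u2) ^ 31 * d ^ 30 * (p ^ 9 * q ^ 18) = (X ^ 31 * p ^ 9 * q ^ 18) * (d ^ 30 * u1 ^ 31 * u2 ^ 31)"
    by (simp add: power_mult_distrib mult_ac)
  also have "\<dots> = ((x * d) ^ 10 * u1 ^ 31) * ((y * d) ^ 20 * u2 ^ 31)"
  proof -
    have "d ^ 30 = d ^ 10 * d ^ 20" by (simp flip: power_add)
    then show ?thesis unfolding eq by (simp only: power_mult_distrib mult_ac)
  qed
  also have "\<dots> \<le> (K1 * p ^ 9) * (K2 ^ 2 * q ^ 18)" by (intro mult_mono b1 b2) (use pos in auto)
  finally have "(X * u1 * u2) ^ 31 * d ^ 30 * (p ^ 9 * q ^ 18) \<le> K1 * K2 ^ 2 * (p ^ 9 * q ^ 18)"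
    by (simp add: mult_ac)
  then have "(X * u1 * u2) ^ 31 * d ^ 30 \<le> K1 * K2 ^ 2" using pos by simp
  then have "(X * u1 * u2) ^ 31 \<le> K1 * K2 ^ 2 / d ^ 30" using pos by (simp add: field_simps)
  then have "((X * u1 * u2) ^ 31) powr (1/31) \<le> (K1 * K2 ^ 2 / d ^ 30) powr (1/31)"
    using pos by (intro powr_mono2) auto
  moreover have "((X * u1 * u2) ^ 31) powr (1/31) = X * u1 * u2"
  proof (cases "X * u1 * u2 = 0")
    case False
    then have x: "X * u1 * u2 > 0" using pos by (simp add: less_le)
    show ?thesis unfolding powr_numeral[OF less_imp_le[OF x], symmetric] powr_powr using x by simp
  qed auto
  moreover have "(K1 * K2 ^ 2 / d ^ 30) powr (1/31) = (K1 * K2 ^ 2) powr (1/31) * d powr (-30/31)"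
  proof -
    have "(d ^ 30) powr (1/31) = d powr (30/31)"
      unfolding powr_numeral[OF less_imp_le[OF pos(4)], symmetric] powr_powr by simp
    then show ?thesis using pos by (simp add: powr_divide powr_minus_divide)
  qed
  ultimately show ?thesis by simp
qed

context surface
begin

lemma disc_chart_deriv:
  assumes "hol_disc B \<Phi> R" "w \<in> ball 0 R" "(U, \<phi>) \<in> B" "\<Phi> w \<in> U"
  shows "open (ball 0 R \<inter> \<Phi> -` U)" "((\<phi> \<circ> \<Phi>) has_field_derivative deriv (\<phi> \<circ> \<Phi>) w) (at w)"
proof -
  have h: "continuous_on (ball 0 R) \<Phi>" "(\<phi> \<circ> \<Phi>) holomorphic_on (ball 0 R \<inter> \<Phi> -` U)"
    using assms(1,3) unfolding hol_disc_def by blast+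
  show o: "open (ball 0 R \<inter> \<Phi> -` U)" by (intro continuous_open_preimage h chartD(1)[OF assms(3)]) simp
  show "((\<phi> \<circ> \<Phi>) has_field_derivative deriv (\<phi> \<circ> \<Phi>) w) (at w)"
    by (rule holomorphic_derivI[OF h(2) o]) (use assms in auto)
qed

lemma disc_hol_fun:
  assumes h: "hol_fun B h" and \<Phi>: "hol_disc B \<Phi> R" and w: "w \<in> ball 0 R" and U: "(U, \<phi>) \<in> B" "\<Phi> w \<in> U"
  shows "((h \<circ> \<Phi>) has_field_derivative (deriv (h \<circ> inv_into U \<phi>) (\<phi> (\<Phi> w)) * deriv (\<phi> \<circ> \<Phi>) w)) (at w)"
proof -
  note d = disc_chart_deriv[OF \<Phi> w U]
  have "((h \<circ> inv_into U \<phi>) \<circ> (\<phi> \<circ> \<Phi>) has_field_derivative (deriv (h \<circ> inv_into U \<phi>) (\<phi> (\<Phi> w)) * deriv (\<phi> \<circ> \<Phi>) w)) (at w)"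
    by (rule DERIV_chain[OF _ d(2)]) (use hol_fun_deriv[OF h U] in simp)
  then show ?thesis
    by (rule has_field_derivative_transform_within_open[OF _ d(1)]) (use w U chartD(6)[OF U(1)] in auto)
qed

lemma disc_hol_fun_holomorphic:
  assumes h: "hol_fun B h" and \<Phi>: "hol_disc B \<Phi> R"
  shows "(h \<circ> \<Phi>) holomorphic_on ball 0 R"
  unfolding holomorphic_on_open[OF open_ball]
proof
  fix w :: complex assume w: "w \<in> ball 0 R"
  obtain U \<phi> where U: "(U, \<phi>) \<in> B" "\<Phi> w \<in> U" using ex_chart by metis
  show "\<exists>D. ((h \<circ> \<Phi>) has_field_derivative D) (at w)" using disc_hol_fun[OF h \<Phi> w U] by blast
qed

lemma flat_map_disc:
  assumes "translation_map (flat_atlas v) \<Phi> (ball 0 R)"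
  shows "hol_disc B \<Phi> R"
proof -
  have c: "continuous_on (ball 0 R) \<Phi>" by (rule translation_map_continuous[OF flat_translation_atlas assms])
  have "(\<phi> \<circ> \<Phi>) holomorphic_on (ball 0 R \<inter> \<Phi> -` U)" if U: "(U, \<phi>) \<in> B" for U \<phi>
  proof -
    have o: "open (ball 0 R \<inter> \<Phi> -` U)" by (intro continuous_open_preimage c chartD(1)[OF U]) simp
    then show ?thesis using flat_map_deriv(1)[OF assms _ U] unfolding holomorphic_on_open[OF o] by blast
  qed
  then show ?thesis using c unfolding hol_disc_def by blast
qed

lemma flat_map_limit_not_zero:
  assumes \<Phi>: "translation_map (flat_atlas v) \<Phi> (ball 0 R)" and v: "hol_field B v" and R: "R > 0" "norm \<zeta> = R"
    and lim: "((\<lambda>t. \<Phi> (of_real t * \<zeta>)) \<longlongrightarrow> p) (at_left 1)"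
  shows "p \<notin> zeros v"
proof
  assume p: "p \<in> zeros v"
  obtain U \<phi> where U: "(U, \<phi>) \<in> B" "p \<in> U" using ex_chart by metis
  have vp: "v U \<phi> (\<phi> p) = 0" using p field_zeros_chart[OF v U] by simp
  obtain r C where r: "r > 0" "C > 0" "ball (\<phi> p) r \<subseteq> \<phi> ` U"
     "\<And>z. z \<in> ball (\<phi> p) r \<Longrightarrow> norm (v U \<phi> z) \<le> C * norm (z - \<phi> p)"
    using zero_lipschitz[OF hol_fieldD(1)[OF v U(1)] chartD(2)[OF U(1)] _ vp] U(2) by blast
  have "\<forall>\<^sub>F t in at_left 1. \<Phi> (of_real t * \<zeta>) \<in> U \<inter> \<phi> -` ball (\<phi> p) r"
    using lim U r(1) chart_preimage[OF chart[OF U(1)] open_ball] by (intro topological_tendstoD) auto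
  then obtain b where b: "b < 1" "\<And>t. b < t \<Longrightarrow> t < 1 \<Longrightarrow> \<Phi> (of_real t * \<zeta>) \<in> U \<inter> \<phi> -` ball (\<phi> p) r"
    unfolding eventually_at_left_field by blast
  define t0 where "t0 = max b 0"
  have inb: "of_real t * \<zeta> \<in> ball 0 R" if "t0 < t" "t < 1" for t
    using that R by (simp add: norm_mult t0_def)
  have inU: "\<Phi> (of_real t * \<zeta>) \<in> U" "\<phi> (\<Phi> (of_real t * \<zeta>)) \<in> ball (\<phi> p) r" if "t0 < t" "t < 1" for t
    using b(2)[of t] that by (auto simp: t0_def)
  let ?z = "\<lambda>t. \<phi> (\<Phi> (of_real t * \<zeta>))"
  have "\<not> (?z \<longlongrightarrow> \<phi> p) (at_left 1)"
  proof (rule integral_curve_avoids_zero[of t0 _ "\<lambda>t. \<zeta> * v U \<phi> (?z t)" "R * C"])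
    fix t assume t: "t0 < t" "t < 1"
    note d = flat_map_deriv[OF \<Phi> inb[OF t] U(1) inU(1)[OF t]]
    have "((\<lambda>t. of_real t * \<zeta>) has_vector_derivative \<zeta>) (at t)"
      by (auto intro!: derivative_eq_intros)
    from field_vector_diff_chain_at[OF this d(1)]
    show "(?z has_vector_derivative \<zeta> * v U \<phi> (?z t)) (at t)" by (simp add: o_def)
    show "norm (\<zeta> * v U \<phi> (?z t)) \<le> R * C * norm (?z t - \<phi> p)"
      unfolding norm_mult R(2) mult.assoc using r(4)[OF inU(2)[OF t]] R(1) by (intro mult_left_mono) auto
    show "?z t \<noteq> \<phi> p" using d(2) vp by auto
  qed (use b in \<open>auto simp: t0_def\<close>)
  moreover have "(?z \<longlongrightarrow> \<phi> p) (at_left 1)"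
    using chartD(1,4)[OF U(1)] U(2) by (intro isCont_tendsto_compose[OF _ lim]) (simp add: continuous_on_eq_continuous_at)
  ultimately show False by blast
qed

text \<open>
  Fujimoto's argument. The metric \<open>|f| (1 + |h1|) (1 + |h2|)\<close> is compared with the flat metric of
  the vector field
  \<open>v = h1'^10 * h2'^20 / (f^31 * (\<Prod>a\<in>S1. h1 - a)^9 * (\<Prod>b\<in>S2. h2 - b)^18)\<close>; since
  \<open>10 + 20 - 31 = -1\<close>, this is indeed a vector field. On a flat disc of radius \<open>R\<close> the bounds for functions with omitted values
  give the density at most \<open>K * (R - |w|) powr (-30/31)\<close>, so radii have finite length. By the
  completeness assumption they converge, and not to zeros of \<open>v\<close>. Thus flat discs of every radius
  exist, and the derivative bound at their centre forces \<open>h1'\<close> to vanish there.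
\<close>

theorem no_complete_metric:
  fixes f :: "'b set \<Rightarrow> ('b \<Rightarrow> complex) \<Rightarrow> complex \<Rightarrow> complex"
  assumes f: "hol_form B f" "zeros f = {}" and h1: "hol_fun B h1" and h2: "hol_fun B h2"
    and nc: "\<not> h1 constant_on UNIV" "\<not> h2 constant_on UNIV"
    and S1: "finite S1" "card S1 = 5" "range h1 \<inter> S1 = {}"
    and S2: "finite S2" "card S2 = 3" "range h2 \<inter> S2 = {}"
    and complete: "\<And>\<Phi> R K \<zeta>. R > 0 \<Longrightarrow> hol_disc B \<Phi> R \<Longrightarrow> norm \<zeta> = R \<Longrightarrow>
      (\<And>w U \<phi>. norm w < R \<Longrightarrow> (U, \<phi>) \<in> B \<Longrightarrow> \<Phi> w \<in> U \<Longrightarrow>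
         norm (f U \<phi> (\<phi> (\<Phi> w)) * deriv (\<phi> \<circ> \<Phi>) w) * (1 + norm (h1 (\<Phi> w))) * (1 + norm (h2 (\<Phi> w)))
         \<le> K * (R - norm w) powr (-30/31)) \<Longrightarrow>
      \<exists>p. ((\<lambda>t. \<Phi> (of_real t * \<zeta>)) \<longlongrightarrow> p) (at_left 1)"
  shows False
proof -
  define d1 where "d1 = (\<lambda>U \<phi>. deriv (h1 \<circ> inv_into U \<phi>))"
  define d2 where "d2 = (\<lambda>U \<phi>. deriv (h2 \<circ> inv_into U \<phi>))"
  have d1: "hol_form B d1" and d2: "hol_form B d2" unfolding d1_def d2_def by (rule deriv_form h1 h2)+
  define P1 where "P1 = (\<lambda>w. \<Prod>a\<in>S1. w - a)"
  define P2 where "P2 = (\<lambda>w. \<Prod>a\<in>S2. w - a)"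
  have P1: "P1 (h1 p) \<noteq> 0" for p using S1 by (auto simp: P1_def)
  have P2: "P2 (h2 p) \<noteq> 0" for p using S2 by (auto simp: P2_def)
  have P1h: "P1 holomorphic_on X" and P2h: "P2 holomorphic_on X" for X
    unfolding P1_def P2_def by (intro holomorphic_intros)+
  define v where "v = (\<lambda>U \<phi> z. d1 U \<phi> z ^ 10 * d2 U \<phi> z ^ 20 /
     (f U \<phi> z ^ 31 * P1 ((h1 \<circ> inv_into U \<phi>) z) ^ 9 * P2 ((h2 \<circ> inv_into U \<phi>) z) ^ 18))"
  have fz: "f U \<phi> (\<phi> p) \<noteq> 0" if "(U, \<phi>) \<in> B" "p \<in> U" for U \<phi> p
    using form_zeros_chart[OF f(1) that] f(2) by simp
  have v: "hol_field B v"
  proof (rule hol_fieldI)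
    fix U \<phi> assume U: "(U, \<phi>) \<in> B"
    have "(P1 \<circ> (h1 \<circ> inv_into U \<phi>)) holomorphic_on \<phi> ` U" "(P2 \<circ> (h2 \<circ> inv_into U \<phi>)) holomorphic_on \<phi> ` U"
      by (intro holomorphic_on_compose hol_funD[OF h1 U] hol_funD[OF h2 U] P1h P2h)+
    then show "v U \<phi> holomorphic_on \<phi> ` U"
      unfolding v_def using P1 P2 fz[OF U]
      by (intro holomorphic_intros hol_formD(1)[OF d1 U] hol_formD(1)[OF d2 U] hol_formD(1)[OF f(1) U])
         (auto simp: o_def)
  next
    fix U \<phi> V \<psi> p assume U: "(U, \<phi>) \<in> B" and V: "(V, \<psi>) \<in> B" and p: "p \<in> U" "p \<in> V"
    define T where "T = deriv (\<psi> \<circ> inv_into U \<phi>) (\<phi> p)"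
    have T: "T \<noteq> 0" unfolding T_def using transition_deriv_nonzero[OF U V] p by simp
    have e: "d1 U \<phi> (\<phi> p) = d1 V \<psi> (\<psi> p) * T" "d2 U \<phi> (\<phi> p) = d2 V \<psi> (\<psi> p) * T"
       "f U \<phi> (\<phi> p) = f V \<psi> (\<psi> p) * T"
      unfolding T_def using hol_formD(2)[OF d1 U V p] hol_formD(2)[OF d2 U V p] hol_formD(2)[OF f(1) U V p] by auto
    have i: "inv_into U \<phi> (\<phi> p) = p" "inv_into V \<psi> (\<psi> p) = p" using chartD(6)[OF U p(1)] chartD(6)[OF V p(2)] .
    have t: "T ^ 31 = T ^ 10 * T ^ 20 * T" by (simp flip: power_add power_Suc2)
    show "v V \<psi> (\<psi> p) = v U \<phi> (\<phi> p) * deriv (\<psi> \<circ> inv_into U \<phi>) (\<phi> p)"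
      unfolding T_def[symmetric] v_def o_apply i e power_mult_distrib t using T by (simp add: divide_simps)
  qed
  have zv: "p \<in> zeros v \<longleftrightarrow> p \<in> zeros d1 \<or> p \<in> zeros d2" for p
  proof -
    obtain U \<phi> where U: "(U, \<phi>) \<in> B" "p \<in> U" using ex_chart by metis
    have "v U \<phi> (\<phi> p) = 0 \<longleftrightarrow> d1 U \<phi> (\<phi> p) = 0 \<or> d2 U \<phi> (\<phi> p) = 0"
      using P1 P2 fz[OF U] chartD(6)[OF U] by (simp add: v_def)
    then show ?thesis
      by (simp only: field_zeros_chart[OF v U] form_zeros_chart[OF d1 U] form_zeros_chart[OF d2 U])
  qed
  have "zeros d1 \<noteq> UNIV" "zeros d2 \<noteq> UNIV"
    using zero_deriv_imp_constant[OF h1] zero_deriv_imp_constant[OF h2] nc unfolding d1_def d2_def by blast+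
  \<comment> \<open>Zero sets of forms are closed with empty interior, so two of them do not cover the surface.\<close>
  then have "\<not> - zeros d1 \<subseteq> zeros d2"
    using form_zeros_identity[OF d2, of "- zeros d1"] zeros_closed[OF d1] by (auto simp: open_Compl)
  then obtain p0 where p0: "p0 \<notin> zeros d1" "p0 \<notin> zeros d2" by blast
  obtain K1 where K1: "K1 > 0" "\<And>g R w. g holomorphic_on ball 0 R \<Longrightarrow> g ` ball 0 R \<inter> S1 = {} \<Longrightarrow> norm (w::complex) < R \<Longrightarrow>
       (norm (deriv g w) * (R - norm w)) ^ 10 * (1 + norm (g w)) ^ ((10 - 1) * (card S1 - 1))
       \<le> K1 * (\<Prod>a\<in>S1. norm (g w - a)) ^ (10 - 1) * (1 + norm (g w)) ^ 2"
    using omitted_values_derivative_bound[OF S1(1), of 10] S1(2) by auto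
  obtain K2 where K2: "K2 > 0" "\<And>g R w. g holomorphic_on ball 0 R \<Longrightarrow> g ` ball 0 R \<inter> S2 = {} \<Longrightarrow> norm (w::complex) < R \<Longrightarrow>
       (norm (deriv g w) * (R - norm w)) ^ 10 * (1 + norm (g w)) ^ ((10 - 1) * (card S2 - 1))
       \<le> K2 * (\<Prod>a\<in>S2. norm (g w - a)) ^ (10 - 1) * (1 + norm (g w)) ^ 2"
    using omitted_values_derivative_bound[OF S2(1), of 10] S2(2) by auto
  have P1n: "(\<Prod>a\<in>S1. norm (w - a)) = norm (P1 w)" and P2n: "(\<Prod>a\<in>S2. norm (w - a)) = norm (P2 w)" for w
    by (simp_all add: P1_def P2_def prod_norm)
  have E1: "(norm (deriv (h1 \<circ> \<Phi>) w) * (R - norm w)) ^ 10 * (1 + norm (h1 (\<Phi> w))) ^ 36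
      \<le> K1 * norm (P1 (h1 (\<Phi> w))) ^ 9 * (1 + norm (h1 (\<Phi> w))) ^ 2"
    if "hol_disc B \<Phi> R" "norm w < R" for \<Phi> R w
  proof -
    have "(h1 \<circ> \<Phi>) ` ball 0 R \<inter> S1 = {}" using S1(3) by auto
    from K1(2)[OF disc_hol_fun_holomorphic[OF h1 that(1)] this that(2)] show ?thesis
      by (simp add: S1(2) P1n)
  qed
  have E2: "(norm (deriv (h2 \<circ> \<Phi>) w) * (R - norm w)) ^ 10 * (1 + norm (h2 (\<Phi> w))) ^ 18
      \<le> K2 * norm (P2 (h2 (\<Phi> w))) ^ 9 * (1 + norm (h2 (\<Phi> w))) ^ 2"
    if "hol_disc B \<Phi> R" "norm w < R" for \<Phi> R w
  proof -
    have "(h2 \<circ> \<Phi>) ` ball 0 R \<inter> S2 = {}" using S2(3) by auto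
    from K2(2)[OF disc_hol_fun_holomorphic[OF h2 that(1)] this that(2)] show ?thesis
      by (simp add: S2(2) P2n)
  qed
  have "\<exists>\<Phi>. translation_map (flat_atlas v) \<Phi> (ball 0 R) \<and> \<Phi> 0 = p0" for R
  proof (rule translation_map_on_all_discs[OF flat_translation_atlas])
    show "p0 \<in> (\<Union>(V, F)\<in>flat_atlas v. V)" unfolding flat_atlas_cover[OF v] using zv p0 by simp
    fix \<Phi> R and \<zeta> :: complex
    assume R: "R > 0" and \<Phi>: "translation_map (flat_atlas v) \<Phi> (ball 0 R)" and \<zeta>: "norm \<zeta> = R"
    note disc = flat_map_disc[OF \<Phi>]
    have "\<exists>p. ((\<lambda>t. \<Phi> (of_real t * \<zeta>)) \<longlongrightarrow> p) (at_left 1)"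
    proof (rule complete[OF R disc \<zeta>])
      fix w U \<phi> assume w: "norm w < R" and U: "(U, \<phi>) \<in> B" "\<Phi> w \<in> U"
      have wb: "w \<in> ball 0 R" using w by simp
      define D where "D = deriv (\<phi> \<circ> \<Phi>) w"
      have D: "D = v U \<phi> (\<phi> (\<Phi> w))"
        unfolding D_def by (rule DERIV_imp_deriv[OF flat_map_deriv(1)[OF \<Phi> wb U]])
      have e1: "deriv (h1 \<circ> \<Phi>) w = d1 U \<phi> (\<phi> (\<Phi> w)) * D" and e2: "deriv (h2 \<circ> \<Phi>) w = d2 U \<phi> (\<phi> (\<Phi> w)) * D"
        unfolding D_def d1_def d2_def
        by (rule DERIV_imp_deriv[OF disc_hol_fun[OF h1 disc wb U]] DERIV_imp_deriv[OF disc_hol_fun[OF h2 disc wb U]])+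
      define F where "F = f U \<phi> (\<phi> (\<Phi> w))"
      have "F \<noteq> 0" unfolding F_def by (rule fz[OF U])
      then have Deq: "D * (F ^ 31 * P1 (h1 (\<Phi> w)) ^ 9 * P2 (h2 (\<Phi> w)) ^ 18)
          = d1 U \<phi> (\<phi> (\<Phi> w)) ^ 10 * d2 U \<phi> (\<phi> (\<Phi> w)) ^ 20"
        unfolding D v_def F_def[symmetric] o_apply chartD(6)[OF U] using P1 P2 by simp
      have "(F * D) ^ 31 * P1 (h1 (\<Phi> w)) ^ 9 * P2 (h2 (\<Phi> w)) ^ 18
          = D ^ 30 * (D * (F ^ 31 * P1 (h1 (\<Phi> w)) ^ 9 * P2 (h2 (\<Phi> w)) ^ 18))"
      proof -
        have "D ^ 31 = D ^ 30 * D" by (simp flip: power_Suc2)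
        then show ?thesis by (simp only: power_mult_distrib mult_ac)
      qed
      also have "\<dots> = deriv (h1 \<circ> \<Phi>) w ^ 10 * deriv (h2 \<circ> \<Phi>) w ^ 20"
      proof -
        have "D ^ 30 = D ^ 10 * D ^ 20" by (simp flip: power_add)
        then show ?thesis unfolding Deq e1 e2 by (simp only: power_mult_distrib mult_ac)
      qed
      finally have "norm ((F * D) ^ 31 * P1 (h1 (\<Phi> w)) ^ 9 * P2 (h2 (\<Phi> w)) ^ 18)
         = norm (deriv (h1 \<circ> \<Phi>) w ^ 10 * deriv (h2 \<circ> \<Phi>) w ^ 20)" by (rule arg_cong)
      then have n: "norm (F * D) ^ 31 * norm (P1 (h1 (\<Phi> w))) ^ 9 * norm (P2 (h2 (\<Phi> w))) ^ 18
         = norm (deriv (h1 \<circ> \<Phi>) w) ^ 10 * norm (deriv (h2 \<circ> \<Phi>) w) ^ 20"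
        by (simp only: norm_mult norm_power)
      show "norm (f U \<phi> (\<phi> (\<Phi> w)) * deriv (\<phi> \<circ> \<Phi>) w) * (1 + norm (h1 (\<Phi> w))) * (1 + norm (h2 (\<Phi> w)))
         \<le> (K1 * K2 ^ 2) powr (1/31) * (R - norm w) powr (-30/31)"
        unfolding F_def[symmetric] D_def[symmetric]
        by (rule power_estimate[OF _ _ _ _ _ _ _ _ K1(1) K2(1) n E1[OF disc w] E2[OF disc w]])
           (use w P1 P2 in auto)
    qed
    then obtain p where p: "((\<lambda>t. \<Phi> (of_real t * \<zeta>)) \<longlongrightarrow> p) (at_left 1)" by blast
    have "p \<notin> zeros v" by (rule flat_map_limit_not_zero[OF \<Phi> v R \<zeta> p])
    then show "\<exists>p\<in>(\<Union>(V, F)\<in>flat_atlas v. V). ((\<lambda>t. \<Phi> (of_real t * \<zeta>)) \<longlongrightarrow> p) (at_left 1)"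
      unfolding flat_atlas_cover[OF v] using p by blast
  qed
  then obtain \<Phi> where \<Phi>: "\<And>R. translation_map (flat_atlas v) (\<Phi> R) (ball 0 R)" "\<And>R. \<Phi> R 0 = p0" by metis
  obtain U \<phi> where U: "(U, \<phi>) \<in> B" "p0 \<in> U" using ex_chart by metis
  define c where "c = norm (d1 U \<phi> (\<phi> p0) * v U \<phi> (\<phi> p0))"
  have "v U \<phi> (\<phi> p0) \<noteq> 0" "d1 U \<phi> (\<phi> p0) \<noteq> 0"
    using field_zeros_chart[OF v U] form_zeros_chart[OF d1 U] zv p0 by auto
  then have c: "c > 0" by (simp add: c_def)
  define M where "M = K1 * norm (P1 (h1 p0)) ^ 9 * (1 + norm (h1 p0)) ^ 2"
  have M: "M \<ge> 0" using K1 by (simp add: M_def)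
  have bound: "(c * R) ^ 10 \<le> M" if R: "R > 0" for R
  proof -
    note disc = flat_map_disc[OF \<Phi>(1)[of R]]
    have z: "(0::complex) \<in> ball 0 R" "\<Phi> R 0 \<in> U" using R U by (auto simp: \<Phi>(2))
    have "deriv (\<phi> \<circ> \<Phi> R) 0 = v U \<phi> (\<phi> p0)"
      using DERIV_imp_deriv[OF flat_map_deriv(1)[OF \<Phi>(1) z(1) U(1) z(2)]] by (simp add: \<Phi>(2))
    then have "deriv (h1 \<circ> \<Phi> R) 0 = d1 U \<phi> (\<phi> p0) * v U \<phi> (\<phi> p0)"
      using DERIV_imp_deriv[OF disc_hol_fun[OF h1 disc z(1) U(1) z(2)]] by (simp add: \<Phi>(2) d1_def)
    then have "(c * R) ^ 10 * (1 + norm (h1 p0)) ^ 36 \<le> M"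
      using E1[OF disc, of 0] R by (simp add: c_def M_def \<Phi>(2))
    moreover have "(c * R) ^ 10 * 1 \<le> (c * R) ^ 10 * (1 + norm (h1 p0)) ^ 36"
      by (intro mult_left_mono one_le_power) auto
    ultimately show ?thesis by simp
  qed
  \<comment> \<open>A radius for which the bound fails, since \<open>M + 1 \<le> (M + 1) ^ 10\<close>.\<close>
  have "(M + 1) ^ 10 \<le> M" using bound[of "(M + 1) / c"] c M by simp
  moreover have "M + 1 \<le> (M + 1) ^ 10" using M by (intro self_le_power) auto
  ultimately show False by simp
qed

end

section \<open>Minimal immersions as real parts of null curves\<close>

lemma frechet_du_dv:
  assumes "f differentiable at z"
  shows "(f has_derivative (\<lambda>d. Re d *\<^sub>R du f z + Im d *\<^sub>R dv f z)) (at z)"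
proof -
  let ?D = "frechet_derivative f (at z)"
  have D: "(f has_derivative ?D) (at z)" using assms by (simp add: frechet_derivative_works)
  interpret linear ?D using D by (rule has_derivative_linear)
  have "?D d = Re d *\<^sub>R du f z + Im d *\<^sub>R dv f z" for d
  proof -
    have "d = Re d *\<^sub>R 1 + Im d *\<^sub>R \<i>" by (simp add: complex_eq_iff)
    then have "?D d = ?D (Re d *\<^sub>R 1 + Im d *\<^sub>R \<i>)" by simp
    then show ?thesis by (simp only: add scale du_def dv_def)
  qed
  then have "?D = (\<lambda>d. Re d *\<^sub>R du f z + Im d *\<^sub>R dv f z)" by blast
  then show ?thesis using D by simp
qed

lemma du_dv_unique:
  assumes "(f has_derivative D) (at z)"
  shows "du f z = D 1" "dv f z = D \<i>"
  using frechet_derivative_at[OF assms] by (simp_all add: du_def dv_def)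

lemma directional_derivatives:
  assumes "f differentiable at (z + of_real s)"
  shows "((\<lambda>t. f (z + of_real t)) has_vector_derivative du f (z + of_real s)) (at s)"
proof -
  have "((\<lambda>t. z + of_real t) has_derivative (\<lambda>t. of_real t)) (at s)"
    by (auto intro!: derivative_eq_intros)
  from has_derivative_compose[OF this frechet_du_dv[OF assms]]
  show ?thesis by (simp add: has_vector_derivative_def)
qed

lemma directional_derivatives_i:
  assumes "f differentiable at (z + \<i> * of_real s)"
  shows "((\<lambda>t. f (z + \<i> * of_real t)) has_vector_derivative dv f (z + \<i> * of_real s)) (at s)"
proof -
  have "((\<lambda>t. z + \<i> * of_real t) has_derivative (\<lambda>t. \<i> * of_real t)) (at s)"
    by (auto intro!: derivative_eq_intros)
  from has_derivative_compose[OF this frechet_du_dv[OF assms]]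
  show ?thesis by (simp add: has_vector_derivative_def)
qed

text \<open>
  The classical proof by the second difference over a small square, evaluated in both orders by the mean
  value theorem.
\<close>

lemma mixed_partials_real:
  fixes g :: "complex \<Rightarrow> real"
  assumes S: "open S" "z \<in> S" and g: "g differentiable_on S" "du g differentiable_on S" "dv g differentiable_on S"
    and c: "continuous_on S (dv (du g))" "continuous_on S (du (dv g))"
  shows "dv (du g) z = du (dv g) z"
proof -
  obtain r where r: "r > 0" "ball z r \<subseteq> S" using S openE by blast
  have at: "g differentiable at w" "du g differentiable at w" "dv g differentiable at w" if "w \<in> S" for w
    using g S(1) that by (simp_all add: differentiable_on_eq_differentiable_at)
  have inS: "z + of_real s + \<i> * of_real t \<in> S" if "0 \<le> s" "0 \<le> t" "s + t < r" for s t
  proof -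
    have "dist z (z + of_real s + \<i> * of_real t) = norm (of_real s + \<i> * of_real t)"
      by (metis add.assoc add_diff_cancel_left' dist_norm dist_commute)
    also have "\<dots> \<le> s + t"
      using norm_triangle_ineq[of "of_real s" "\<i> * of_real t"] that by (simp add: norm_mult)
    finally show ?thesis using r that by auto
  qed
  have ex: "\<exists>P Q. P \<in> ball z e \<inter> S \<and> Q \<in> ball z e \<inter> S \<and> dv (du g) P = du (dv g) Q" if "e > 0" for e
  proof -
    define h where "h = min r e / 3"
    have h: "h > 0" "2 * h < r" "2 * h < e" using r that by (auto simp: h_def)
    have near: "z + of_real s + \<i> * of_real t \<in> ball z e \<inter> S" if "0 \<le> s" "0 \<le> t" "s \<le> h" "t \<le> h" for s t
    proof -
      have "dist z (z + of_real s + \<i> * of_real t) = norm (of_real s + \<i> * of_real t)"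
        by (metis add.assoc add_diff_cancel_left' dist_norm dist_commute)
      also have "\<dots> \<le> s + t"
        using norm_triangle_ineq[of "of_real s" "\<i> * of_real t"] that by (simp add: norm_mult)
      finally show ?thesis using inS[of s t] h that by auto
    qed
    \<comment> \<open>Second difference over the square with corner \<open>z\<close> and side \<open>h\<close>.\<close>
    define \<Delta> where "\<Delta> = g (z + of_real h + \<i> * of_real h) - g (z + of_real h) - g (z + \<i> * of_real h) + g z"
    have "\<exists>\<xi>>0. \<xi> < h \<and> (g (z + of_real h + \<i> * of_real h) - g (z + of_real h)) - (g (z + of_real 0 + \<i> * of_real h) - g (z + of_real 0))
        = (h - 0) * (du g (z + of_real \<xi> + \<i> * of_real h) - du g (z + of_real \<xi>))"
    proof (rule MVT2[OF h(1)])
      fix s assume s: "0 \<le> s" "s \<le> h"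
      have "((\<lambda>t. g (z + \<i> * of_real h + of_real t)) has_vector_derivative du g (z + \<i> * of_real h + of_real s)) (at s)"
        by (rule directional_derivatives) (use inS[of s h] s h in \<open>auto intro!: at simp: add_ac\<close>)
      moreover have "((\<lambda>t. g (z + of_real t)) has_vector_derivative du g (z + of_real s)) (at s)"
        by (rule directional_derivatives) (use inS[of s 0] s h in \<open>auto intro!: at\<close>)
      ultimately show "((\<lambda>s. g (z + of_real s + \<i> * of_real h) - g (z + of_real s)) has_real_derivative
          du g (z + of_real s + \<i> * of_real h) - du g (z + of_real s)) (at s)"
        unfolding has_real_derivative_iff_has_vector_derivative
        by (intro has_vector_derivative_diff) (simp_all add: add_ac)
    qed
    then obtain \<xi> where \<xi>: "0 < \<xi>" "\<xi> < h" "\<Delta> = h * (du g (z + of_real \<xi> + \<i> * of_real h) - du g (z + of_real \<xi>))"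
      by (auto simp: \<Delta>_def algebra_simps)
    have "\<exists>\<eta>>0. \<eta> < h \<and> du g (z + of_real \<xi> + \<i> * of_real h) - du g (z + of_real \<xi> + \<i> * of_real 0)
        = (h - 0) * dv (du g) (z + of_real \<xi> + \<i> * of_real \<eta>)"
    proof (rule MVT2[OF h(1)])
      fix t assume t: "0 \<le> t" "t \<le> h"
      show "((\<lambda>t. du g (z + of_real \<xi> + \<i> * of_real t)) has_real_derivative dv (du g) (z + of_real \<xi> + \<i> * of_real t)) (at t)"
        unfolding has_real_derivative_iff_has_vector_derivative
        by (rule directional_derivatives_i) (use inS[of \<xi> t] t \<xi> h in \<open>auto intro!: at\<close>)
    qed
    then obtain \<eta> where \<eta>: "0 < \<eta>" "\<eta> < h" "\<Delta> = h * (h * dv (du g) (z + of_real \<xi> + \<i> * of_real \<eta>))"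
      using \<xi>(3) by auto
    have "\<exists>\<xi>>0. \<xi> < h \<and> (g (z + of_real h + \<i> * of_real h) - g (z + \<i> * of_real h)) - (g (z + of_real h + \<i> * of_real 0) - g (z + \<i> * of_real 0))
        = (h - 0) * (dv g (z + of_real h + \<i> * of_real \<xi>) - dv g (z + \<i> * of_real \<xi>))"
    proof (rule MVT2[OF h(1)])
      fix s assume s: "0 \<le> s" "s \<le> h"
      show "((\<lambda>s. g (z + of_real h + \<i> * of_real s) - g (z + \<i> * of_real s)) has_real_derivative
          dv g (z + of_real h + \<i> * of_real s) - dv g (z + \<i> * of_real s)) (at s)"
        unfolding has_real_derivative_iff_has_vector_derivative
        by (intro has_vector_derivative_diff directional_derivatives_i)
           (use inS[of h s] inS[of 0 s] s h in \<open>auto intro!: at\<close>)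
    qed
    then obtain \<xi>' where \<xi>': "0 < \<xi>'" "\<xi>' < h" "\<Delta> = h * (dv g (z + of_real h + \<i> * of_real \<xi>') - dv g (z + \<i> * of_real \<xi>'))"
      by (auto simp: \<Delta>_def algebra_simps)
    have "\<exists>\<eta>>0. \<eta> < h \<and> dv g (z + \<i> * of_real \<xi>' + of_real h) - dv g (z + \<i> * of_real \<xi>' + of_real 0)
        = (h - 0) * du (dv g) (z + \<i> * of_real \<xi>' + of_real \<eta>)"
    proof (rule MVT2[OF h(1)])
      fix t assume t: "0 \<le> t" "t \<le> h"
      show "((\<lambda>t. dv g (z + \<i> * of_real \<xi>' + of_real t)) has_real_derivative du (dv g) (z + \<i> * of_real \<xi>' + of_real t)) (at t)"
        unfolding has_real_derivative_iff_has_vector_derivative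
        by (rule directional_derivatives) (use inS[of t \<xi>'] t \<xi>' h in \<open>auto intro!: at simp: add_ac\<close>)
    qed
    then obtain \<eta>' where \<eta>': "0 < \<eta>'" "\<eta>' < h" "\<Delta> = h * (h * du (dv g) (z + of_real \<eta>' + \<i> * of_real \<xi>'))"
      using \<xi>'(3) by (auto simp: add_ac)
    have "dv (du g) (z + of_real \<xi> + \<i> * of_real \<eta>) = du (dv g) (z + of_real \<eta>' + \<i> * of_real \<xi>')"
      using \<eta>(3) \<eta>'(3) h(1) by simp
    moreover have "z + of_real \<xi> + \<i> * of_real \<eta> \<in> ball z e \<inter> S" "z + of_real \<eta>' + \<i> * of_real \<xi>' \<in> ball z e \<inter> S"
      using \<xi> \<eta> \<xi>' \<eta>' by (intro near; simp)+
    ultimately show ?thesis by blast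
  qed
  show ?thesis
  proof (rule ccontr)
    assume ne: "dv (du g) z \<noteq> du (dv g) z"
    define d where "d = \<bar>dv (du g) z - du (dv g) z\<bar> / 2"
    have d: "d > 0" using ne by (simp add: d_def)
    obtain e1 where e1: "e1 > 0" "\<And>w. w \<in> S \<Longrightarrow> dist w z < e1 \<Longrightarrow> dist (dv (du g) w) (dv (du g) z) < d"
      using c(1) S(2) d unfolding continuous_on_iff by blast
    obtain e2 where e2: "e2 > 0" "\<And>w. w \<in> S \<Longrightarrow> dist w z < e2 \<Longrightarrow> dist (du (dv g) w) (du (dv g) z) < d"
      using c(2) S(2) d unfolding continuous_on_iff by blast
    obtain P Q where PQ: "P \<in> ball z (min e1 e2) \<inter> S" "Q \<in> ball z (min e1 e2) \<inter> S" "dv (du g) P = du (dv g) Q"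
      using ex[of "min e1 e2"] e1(1) e2(1) by auto
    have "dist (dv (du g) P) (dv (du g) z) < d" "dist (du (dv g) Q) (du (dv g) z) < d"
      using PQ(1,2) by (intro e1(2) e2(2); simp add: dist_commute)+
    then show False using PQ(3) unfolding d_def dist_real_def by argo
  qed
qed

lemma du_dv_component:
  fixes f :: "complex \<Rightarrow> real ^ 'n"
  assumes "f differentiable at z"
  shows "(\<lambda>w. f w $ i) differentiable at z" "du (\<lambda>w. f w $ i) z = du f z $ i" "dv (\<lambda>w. f w $ i) z = dv f z $ i"
proof -
  have D: "((\<lambda>w. f w $ i) has_derivative (\<lambda>d. (Re d *\<^sub>R du f z + Im d *\<^sub>R dv f z) $ i)) (at z)"
    by (rule bounded_linear.has_derivative[OF bounded_linear_vec_nth frechet_du_dv[OF assms]])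
  then show "(\<lambda>w. f w $ i) differentiable at z" unfolding differentiable_def by blast
  show "du (\<lambda>w. f w $ i) z = du f z $ i" "dv (\<lambda>w. f w $ i) z = dv f z $ i"
    using du_dv_unique[OF D] by simp_all
qed

lemma du_dv_cong:
  assumes "open S" "z \<in> S" "\<And>w. w \<in> S \<Longrightarrow> f w = g w" "f differentiable at z"
  shows "g differentiable at z" "du g z = du f z" "dv g z = dv f z"
proof -
  have D: "(g has_derivative (\<lambda>d. Re d *\<^sub>R du f z + Im d *\<^sub>R dv f z)) (at z)"
    by (rule has_derivative_transform_within_open[OF frechet_du_dv[OF assms(4)] assms(1,2)]) (rule assms(3))
  then show "g differentiable at z" unfolding differentiable_def by blast
  show "du g z = du f z" "dv g z = dv f z"
    using du_dv_unique[OF D] by simp_all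
qed

lemma mixed_partials:
  fixes f :: "complex \<Rightarrow> real ^ 'n"
  assumes S: "open S" "z \<in> S" and f: "Ck_on 2 f S"
  shows "dv (du f) z = du (dv f) z"
proof -
  have d: "f differentiable at w" "du f differentiable at w" "dv f differentiable at w" if "w \<in> S" for w
    using f S(1) that by (simp_all add: numeral_2_eq_2 differentiable_on_eq_differentiable_at)
  have c: "continuous_on S (dv (du f))" "continuous_on S (du (dv f))"
    using f by (simp_all add: numeral_2_eq_2)
  have "dv (du f) z $ i = du (dv f) z $ i" for i
  proof -
    let ?g = "\<lambda>w. f w $ i"
    have u: "du f w $ i = du ?g w" "dv f w $ i = dv ?g w" if "w \<in> S" for w
      using du_dv_component[OF d(1)[OF that]] by simp_all
    have uu: "du ?g differentiable at w" "dv (du ?g) w = dv (du f) w $ i" if "w \<in> S" for w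
      using du_dv_cong[OF S(1) that u(1) du_dv_component(1)[OF d(2)[OF that]]] du_dv_component(3)[OF d(2)[OF that]]
      by simp_all
    have vv: "dv ?g differentiable at w" "du (dv ?g) w = du (dv f) w $ i" if "w \<in> S" for w
      using du_dv_cong[OF S(1) that u(2) du_dv_component(1)[OF d(3)[OF that]]] du_dv_component(2)[OF d(3)[OF that]]
      by simp_all
    have "dv (du ?g) z = du (dv ?g) z"
    proof (rule mixed_partials_real[OF S])
      show "?g differentiable_on S" "du ?g differentiable_on S" "dv ?g differentiable_on S"
        using S(1) du_dv_component(1)[OF d(1)] uu(1) vv(1) by (simp_all add: differentiable_on_eq_differentiable_at)
      have "continuous_on S (\<lambda>w. dv (du f) w $ i)" "continuous_on S (\<lambda>w. du (dv f) w $ i)"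
        using c by (intro continuous_intros; simp)+
      then show "continuous_on S (dv (du ?g))" "continuous_on S (du (dv ?g))"
        using uu(2) vv(2) by (simp_all cong: continuous_on_cong)
    qed
    then show ?thesis using uu(2)[OF S(2)] vv(2)[OF S(2)] by simp
  qed
  then show ?thesis by (simp add: vec_eq_iff)
qed

lemma inner_derivative:
  fixes a b :: "complex \<Rightarrow> 'v::real_inner"
  assumes "open S" "z \<in> S" "a differentiable at z" "b differentiable at z" "p differentiable at z" "q differentiable at z"
    "\<And>w. w \<in> S \<Longrightarrow> a w \<bullet> b w = p w \<bullet> q w"
  shows "a z \<bullet> du b z + du a z \<bullet> b z = p z \<bullet> du q z + du p z \<bullet> q z"
    "a z \<bullet> dv b z + dv a z \<bullet> b z = p z \<bullet> dv q z + dv p z \<bullet> q z"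
proof -
  have 1: "((\<lambda>w. a w \<bullet> b w) has_derivative (\<lambda>d. a z \<bullet> (Re d *\<^sub>R du b z + Im d *\<^sub>R dv b z) + (Re d *\<^sub>R du a z + Im d *\<^sub>R dv a z) \<bullet> b z)) (at z)"
    by (rule has_derivative_inner[OF frechet_du_dv[OF assms(3)] frechet_du_dv[OF assms(4)]])
  have 2: "((\<lambda>w. p w \<bullet> q w) has_derivative (\<lambda>d. p z \<bullet> (Re d *\<^sub>R du q z + Im d *\<^sub>R dv q z) + (Re d *\<^sub>R du p z + Im d *\<^sub>R dv p z) \<bullet> q z)) (at z)"
    by (rule has_derivative_inner[OF frechet_du_dv[OF assms(5)] frechet_du_dv[OF assms(6)]])
  have 3: "((\<lambda>w. p w \<bullet> q w) has_derivative (\<lambda>d. a z \<bullet> (Re d *\<^sub>R du b z + Im d *\<^sub>R dv b z) + (Re d *\<^sub>R du a z + Im d *\<^sub>R dv a z) \<bullet> b z)) (at z)"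
    by (rule has_derivative_transform_within_open[OF 1 assms(1,2)]) (rule assms(7))
  have "(\<lambda>d. a z \<bullet> (Re d *\<^sub>R du b z + Im d *\<^sub>R dv b z) + (Re d *\<^sub>R du a z + Im d *\<^sub>R dv a z) \<bullet> b z)
     = (\<lambda>d. p z \<bullet> (Re d *\<^sub>R du q z + Im d *\<^sub>R dv q z) + (Re d *\<^sub>R du p z + Im d *\<^sub>R dv p z) \<bullet> q z)"
    by (rule has_derivative_unique[OF 3 2])
  from fun_cong[OF this, of 1] fun_cong[OF this, of \<i>]
  show "a z \<bullet> du b z + du a z \<bullet> b z = p z \<bullet> du q z + du p z \<bullet> q z"
    "a z \<bullet> dv b z + dv a z \<bullet> b z = p z \<bullet> dv q z + dv p z \<bullet> q z" by simp_all
qed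

text \<open>
  The Laplacian of a conformal map is always normal, as one sees by differentiating the conformality relations,
  and its normal part is a multiple of the mean curvature vector.
\<close>

lemma conformal_minimal_harmonic:
  fixes f :: "complex \<Rightarrow> real ^ 'n"
  assumes S: "open S" "z \<in> S" and f: "Ck_on 2 f S"
    and conf: "\<And>w. w \<in> S \<Longrightarrow> norm (du f w) = norm (dv f w)" "\<And>w. w \<in> S \<Longrightarrow> du f w \<bullet> dv f w = 0"
    and imm: "du f z \<noteq> 0" and H: "mean_curvature_vector f z = 0"
  shows "du (du f) z + dv (dv f) z = 0"
proof -
  have d: "du f differentiable at z" "dv f differentiable at z"
    using f S by (simp_all add: numeral_2_eq_2 differentiable_on_eq_differentiable_at)
  note mix = mixed_partials[OF S f]
  define E where "E = du f z \<bullet> du f z"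
  have E0: "E > 0" using imm by (simp add: E_def)
  have sq: "du f w \<bullet> du f w = dv f w \<bullet> dv f w" if "w \<in> S" for w
    using conf(1)[OF that] by (simp add: dot_square_norm)
  have G: "dv f z \<bullet> dv f z = E" using sq[OF S(2)] by (simp add: E_def)
  have F: "du f z \<bullet> dv f z = 0" by (rule conf(2)[OF S(2)])
  note i1 = inner_derivative[OF S d(1,1) d(2,2) sq]
  have i2: "du f z \<bullet> du (dv f) z + du (du f) z \<bullet> dv f z = 0" "du f z \<bullet> dv (dv f) z + dv (du f) z \<bullet> dv f z = 0"
    using inner_derivative[OF S d(1,2), of "\<lambda>_. 0" "\<lambda>_. 0"] conf(2)
    by simp_all
  define L where "L = du (du f) z + dv (dv f) z"
  have Lu: "L \<bullet> du f z = 0"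
    using i1(1) i2(2) mix by (simp add: L_def inner_add_left inner_add_right inner_commute)
  have Lv: "L \<bullet> dv f z = 0"
    using i1(2) i2(1) mix by (simp add: L_def inner_add_left inner_add_right inner_commute)
  have np: "normal_part f z w = w - ((w \<bullet> du f z) / E) *\<^sub>R du f z - ((w \<bullet> dv f z) / E) *\<^sub>R dv f z" for w
    using E0 unfolding normal_part_def Let_def F G E_def[symmetric] by (simp add: power2_eq_square)
  have "mean_curvature_vector f z = (1 / (2 * (E * E))) *\<^sub>R (E *\<^sub>R normal_part f z (du (du f) z) + E *\<^sub>R normal_part f z (dv (dv f) z))"
    unfolding mean_curvature_vector_def Let_def F G E_def[symmetric] by simp
  also have "E *\<^sub>R normal_part f z (du (du f) z) + E *\<^sub>R normal_part f z (dv (dv f) z)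
     = E *\<^sub>R (normal_part f z (du (du f) z) + normal_part f z (dv (dv f) z))" by (simp add: scaleR_add_right)
  also have "normal_part f z (du (du f) z) + normal_part f z (dv (dv f) z) = normal_part f z L"
    unfolding np L_def by (simp add: inner_add_left add_divide_distrib algebra_simps)
  also have "normal_part f z L = L" unfolding np Lu Lv by simp
  finally show ?thesis using H E0 by (simp add: L_def)
qed

lemma real_part_derivative:
  assumes "H holomorphic_on S" "open S" "z \<in> S" "\<And>w. w \<in> S \<Longrightarrow> x w = Re (H w)"
  shows "(x has_derivative (\<lambda>d. Re (deriv H z * d))) (at z)"
    "(complex_of_real (du x z) - \<i> * complex_of_real (dv x z)) / 2 = deriv H z / 2"
proof -
  have "(H has_derivative (\<lambda>d. deriv H z * d)) (at z)"
    using holomorphic_derivI[OF assms(1-3)] by (simp add: has_field_derivative_def)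
  then have "((\<lambda>w. Re (H w)) has_derivative (\<lambda>d. Re (deriv H z * d))) (at z)"
    by (rule bounded_linear.has_derivative[OF bounded_linear_Re])
  then show D: "(x has_derivative (\<lambda>d. Re (deriv H z * d))) (at z)"
    by (rule has_derivative_transform_within_open[OF _ assms(2,3)]) (simp add: assms(4))
  show "(complex_of_real (du x z) - \<i> * complex_of_real (dv x z)) / 2 = deriv H z / 2"
    using du_dv_unique[OF D] by (simp add: complex_eq_iff)
qed

text \<open>
  The function \<open>du x - \<i> * dv x\<close> satisfies the Cauchy-Riemann equations, and the real part of its primitive
  differs from \<open>x\<close> by a constant.
\<close>

lemma harmonic_real_part:
  fixes x :: "complex \<Rightarrow> real"
  assumes x: "\<And>w. w \<in> ball a r \<Longrightarrow> x differentiable at w" "\<And>w. w \<in> ball a r \<Longrightarrow> du x differentiable at w"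
     "\<And>w. w \<in> ball a r \<Longrightarrow> dv x differentiable at w"
    and h: "\<And>w. w \<in> ball a r \<Longrightarrow> du (du x) w + dv (dv x) w = 0" "\<And>w. w \<in> ball a r \<Longrightarrow> dv (du x) w = du (dv x) w"
  obtains H where "H holomorphic_on ball a r" "\<And>w. w \<in> ball a r \<Longrightarrow> x w = Re (H w)"
proof -
  define q where "q = (\<lambda>w. complex_of_real (du x w) - \<i> * complex_of_real (dv x w))"
  have dq: "(q has_field_derivative (complex_of_real (du (du x) w) - \<i> * complex_of_real (dv (du x) w))) (at w)"
    if w: "w \<in> ball a r" for w
  proof -
    have "(q has_derivative (\<lambda>d. complex_of_real (Re d *\<^sub>R du (du x) w + Im d *\<^sub>R dv (du x) w)
        - \<i> * complex_of_real (Re d *\<^sub>R du (dv x) w + Im d *\<^sub>R dv (dv x) w))) (at w)"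
      unfolding q_def
      by (intro has_derivative_diff has_derivative_mult_right has_derivative_of_real frechet_du_dv x w)
    also have "(\<lambda>d. complex_of_real (Re d *\<^sub>R du (du x) w + Im d *\<^sub>R dv (du x) w)
        - \<i> * complex_of_real (Re d *\<^sub>R du (dv x) w + Im d *\<^sub>R dv (dv x) w))
      = (*) (complex_of_real (du (du x) w) - \<i> * complex_of_real (dv (du x) w))"
    proof
      fix d
      have "dv (dv x) w = - du (du x) w" using h(1)[OF w] by simp
      then show "complex_of_real (Re d *\<^sub>R du (du x) w + Im d *\<^sub>R dv (du x) w)
        - \<i> * complex_of_real (Re d *\<^sub>R du (dv x) w + Im d *\<^sub>R dv (dv x) w)
        = (complex_of_real (du (du x) w) - \<i> * complex_of_real (dv (du x) w)) * d"
        using h(2)[OF w] by (simp add: complex_eq_iff algebra_simps)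
    qed
    finally show ?thesis by (simp add: has_field_derivative_def)
  qed
  then have "q holomorphic_on ball a r" unfolding holomorphic_on_open[OF open_ball] by blast
  then obtain H0 where H0: "\<And>w. w \<in> ball a r \<Longrightarrow> (H0 has_field_derivative q w) (at w within ball a r)"
    using holomorphic_convex_primitive'[OF convex_ball open_ball] by blast
  have H: "(H0 has_field_derivative q w) (at w)" if "w \<in> ball a r" for w
    using H0[OF that] by (simp add: at_within_open[OF that open_ball])
  have "\<exists>c. \<forall>w\<in>ball a r. x w - Re (H0 w) = c"
  proof (rule has_derivative_zero_constant)
    fix w assume w: "w \<in> ball a r"
    have "((\<lambda>w. x w - Re (H0 w)) has_derivative (\<lambda>d. (Re d *\<^sub>R du x w + Im d *\<^sub>R dv x w) - Re (q w * d))) (at w)"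
      by (intro has_derivative_diff frechet_du_dv x w bounded_linear.has_derivative[OF bounded_linear_Re]
            H[OF w, unfolded has_field_derivative_def])
    then have "((\<lambda>w. x w - Re (H0 w)) has_derivative (\<lambda>d. 0)) (at w)"
      by (simp add: q_def algebra_simps)
    then show "((\<lambda>w. x w - Re (H0 w)) has_derivative (\<lambda>d. 0)) (at w within ball a r)"
      by (rule has_derivative_at_withinI)
  qed simp
  then obtain c where c: "\<And>w. w \<in> ball a r \<Longrightarrow> x w - Re (H0 w) = c" by blast
  show thesis
  proof (rule that[of "\<lambda>w. H0 w + of_real c"])
    show "(\<lambda>w. H0 w + of_real c) holomorphic_on ball a r"
      using H by (intro holomorphic_intros) (unfold holomorphic_on_open[OF open_ball], blast)
    show "x w = Re (H0 w + of_real c)" if "w \<in> ball a r" for w using c[OF that] by simp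
  qed
qed

text \<open>
  Locally \<open>f\<close> is the real part of a holomorphic null curve \<open>H\<close>: the local Weierstrass representation of a minimal
  surface. Unlike the definition by partial derivatives it is visibly stable under holomorphic and
  antiholomorphic changes of the parameter.
\<close>

definition null_rep :: "(complex \<Rightarrow> real^4) \<Rightarrow> complex \<Rightarrow> bool" where
  "null_rep f a \<longleftrightarrow> (\<exists>H r. r > 0 \<and> (\<forall>i. H i holomorphic_on ball a r) \<and>
     (\<forall>w\<in>ball a r. (\<forall>i. f w $ i = Re (H i w)) \<and> (\<Sum>i\<in>UNIV. (deriv (H i) w)\<^sup>2) = 0 \<and> (\<exists>i. deriv (H i) w \<noteq> 0)))"

definition dz_coeff :: "(complex \<Rightarrow> real^4) \<Rightarrow> 4 \<Rightarrow> complex \<Rightarrow> complex" where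
  "dz_coeff f i z = (complex_of_real (du (\<lambda>w. f w $ i) z) - \<i> * complex_of_real (dv (\<lambda>w. f w $ i) z)) / 2"

lemma form_coeff_eq: "form_coeff X U \<phi> i z = dz_coeff (X \<circ> inv_into U \<phi>) i z"
  by (simp add: form_coeff_def dz_coeff_def Let_def)

lemma null_repE:
  assumes "null_rep f a"
  obtains H r where "r > 0" "\<And>i. H i holomorphic_on ball a r"
    "\<And>i w. w \<in> ball a r \<Longrightarrow> f w $ i = Re (H i w)"
    "\<And>w. w \<in> ball a r \<Longrightarrow> (\<Sum>i\<in>UNIV. (deriv (H i) w)\<^sup>2) = 0"
    "\<And>w. w \<in> ball a r \<Longrightarrow> \<exists>i. deriv (H i) w \<noteq> 0"
    "\<And>i w. w \<in> ball a r \<Longrightarrow> dz_coeff f i w = deriv (H i) w / 2"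
    "\<And>i w. w \<in> ball a r \<Longrightarrow> ((\<lambda>w. f w $ i) has_derivative (\<lambda>d. Re (2 * dz_coeff f i w * d))) (at w)"
proof -
  obtain H r where H: "r > 0" "\<And>i. H i holomorphic_on ball a r"
    "\<And>w. w \<in> ball a r \<Longrightarrow> (\<forall>i. f w $ i = Re (H i w)) \<and> (\<Sum>i\<in>UNIV. (deriv (H i) w)\<^sup>2) = 0 \<and> (\<exists>i. deriv (H i) w \<noteq> 0)"
    using assms unfolding null_rep_def by blast
  have Re: "f w $ i = Re (H i w)" if "w \<in> ball a r" for i w using H(3)[OF that] by blast
  have D: "((\<lambda>w. f w $ i) has_derivative (\<lambda>d. Re (deriv (H i) w * d))) (at w)" if "w \<in> ball a r" for i w
    by (rule real_part_derivative(1)[OF H(2) open_ball that Re])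
  have c: "dz_coeff f i w = deriv (H i) w / 2" if "w \<in> ball a r" for i w
    unfolding dz_coeff_def by (rule real_part_derivative(2)[OF H(2) open_ball that Re])
  show thesis
  proof (rule that[OF H(1,2) Re])
    show "((\<lambda>w. f w $ i) has_derivative (\<lambda>d. Re (2 * dz_coeff f i w * d))) (at w)" if "w \<in> ball a r" for i w
      using D[OF that] by (simp add: c[OF that])
  qed (use H(3) c in blast)+
qed

lemma null_rep_coeff:
  assumes "null_rep f a"
  shows "(\<Sum>i\<in>UNIV. (dz_coeff f i a)\<^sup>2) = 0" "\<exists>i. dz_coeff f i a \<noteq> 0"
proof -
  obtain H r where N: "r > 0" "\<And>i. H i holomorphic_on ball a r"
    "\<And>i w. w \<in> ball a r \<Longrightarrow> f w $ i = Re (H i w)"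
    "\<And>w. w \<in> ball a r \<Longrightarrow> (\<Sum>i\<in>UNIV. (deriv (H i) w)\<^sup>2) = 0"
    "\<And>w. w \<in> ball a r \<Longrightarrow> \<exists>i. deriv (H i) w \<noteq> 0"
    "\<And>i w. w \<in> ball a r \<Longrightarrow> dz_coeff f i w = deriv (H i) w / 2"
    "\<And>i w. w \<in> ball a r \<Longrightarrow> ((\<lambda>w. f w $ i) has_derivative (\<lambda>d. Re (2 * dz_coeff f i w * d))) (at w)"
    by (rule null_repE[OF assms]) (rule that)
  have H: "(\<Sum>i\<in>UNIV. (deriv (H i) a)\<^sup>2) = 0" "\<exists>i. deriv (H i) a \<noteq> 0"
    "dz_coeff f i a = deriv (H i) a / 2" for i using N(4-6)[of a] N(1) by auto
  show "(\<Sum>i\<in>UNIV. (dz_coeff f i a)\<^sup>2) = 0"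
    using H(1) by (simp add: H(3) power_divide flip: sum_divide_distrib)
  show "\<exists>i. dz_coeff f i a \<noteq> 0" using H(2) by (simp add: H(3))
qed

lemma null_rep_derivative:
  assumes "null_rep f a"
  shows "((\<lambda>w. f w $ i) has_derivative (\<lambda>d. Re (2 * dz_coeff f i a * d))) (at a)"
proof -
  obtain H r where N: "r > 0" "\<And>i. H i holomorphic_on ball a r"
    "\<And>i w. w \<in> ball a r \<Longrightarrow> f w $ i = Re (H i w)"
    "\<And>w. w \<in> ball a r \<Longrightarrow> (\<Sum>i\<in>UNIV. (deriv (H i) w)\<^sup>2) = 0"
    "\<And>w. w \<in> ball a r \<Longrightarrow> \<exists>i. deriv (H i) w \<noteq> 0"
    "\<And>i w. w \<in> ball a r \<Longrightarrow> dz_coeff f i w = deriv (H i) w / 2"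
    "\<And>i w. w \<in> ball a r \<Longrightarrow> ((\<lambda>w. f w $ i) has_derivative (\<lambda>d. Re (2 * dz_coeff f i w * d))) (at w)"
    by (rule null_repE[OF assms]) (rule that)
  show ?thesis using N(7)[of a i] N(1) by simp
qed

lemma null_rep_holomorphic:
  assumes "\<And>a. a \<in> S \<Longrightarrow> null_rep f a" "open S"
  shows "dz_coeff f i holomorphic_on S"
  unfolding holomorphic_on_open[OF assms(2)]
proof
  fix a assume "a \<in> S"
  then have na: "null_rep f a" by (rule assms(1))
  obtain H r where H: "r > 0" "\<And>i. H i holomorphic_on ball a r"
    "\<And>i w. w \<in> ball a r \<Longrightarrow> f w $ i = Re (H i w)"
    "\<And>w. w \<in> ball a r \<Longrightarrow> (\<Sum>i\<in>UNIV. (deriv (H i) w)\<^sup>2) = 0"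
    "\<And>w. w \<in> ball a r \<Longrightarrow> \<exists>i. deriv (H i) w \<noteq> 0"
    "\<And>i w. w \<in> ball a r \<Longrightarrow> dz_coeff f i w = deriv (H i) w / 2"
    "\<And>i w. w \<in> ball a r \<Longrightarrow> ((\<lambda>w. f w $ i) has_derivative (\<lambda>d. Re (2 * dz_coeff f i w * d))) (at w)"
    by (rule null_repE[OF na]) (rule that)
  have "(\<lambda>w. deriv (H i) w / 2) holomorphic_on ball a r"
    by (intro holomorphic_intros holomorphic_deriv H(2)) auto
  then have "dz_coeff f i holomorphic_on ball a r"
    by (rule holomorphic_transform) (simp add: H(6))
  then show "\<exists>D. (dz_coeff f i has_field_derivative D) (at a)"
    using H(1) unfolding holomorphic_on_open[OF open_ball] by auto
qed

lemma null_rep_compose: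
  assumes f: "null_rep f (\<tau> a)" and N: "open N" "a \<in> N" "\<tau> holomorphic_on N" and g: "\<And>w. w \<in> N \<Longrightarrow> g w = f (\<tau> w)"
  shows "dz_coeff g i a = dz_coeff f i (\<tau> a) * deriv \<tau> a"
    "(\<And>w. w \<in> N \<Longrightarrow> deriv \<tau> w \<noteq> 0) \<Longrightarrow> null_rep g a"
proof -
  obtain H r where H: "r > 0" "\<And>i. H i holomorphic_on ball (\<tau> a) r"
    "\<And>i w. w \<in> ball (\<tau> a) r \<Longrightarrow> f w $ i = Re (H i w)"
    "\<And>w. w \<in> ball (\<tau> a) r \<Longrightarrow> (\<Sum>i\<in>UNIV. (deriv (H i) w)\<^sup>2) = 0"
    "\<And>w. w \<in> ball (\<tau> a) r \<Longrightarrow> \<exists>i. deriv (H i) w \<noteq> 0"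
    "\<And>i w. w \<in> ball (\<tau> a) r \<Longrightarrow> dz_coeff f i w = deriv (H i) w / 2"
    "\<And>i w. w \<in> ball (\<tau> a) r \<Longrightarrow> ((\<lambda>w. f w $ i) has_derivative (\<lambda>d. Re (2 * dz_coeff f i w * d))) (at w)"
    by (rule null_repE[OF f]) (rule that)
  have "open (N \<inter> \<tau> -` ball (\<tau> a) r)"
    using holomorphic_on_imp_continuous_on[OF N(3)] N(1) by (intro continuous_open_preimage) auto
  then obtain s where s: "s > 0" "ball a s \<subseteq> N \<inter> \<tau> -` ball (\<tau> a) r"
    by (rule openE) (use N H(1) in auto)
  define K where "K = (\<lambda>i. H i \<circ> \<tau>)"
  have K: "K i holomorphic_on ball a s" for i
    unfolding K_def
    by (rule holomorphic_on_compose_gen[OF _ H(2)]) (use s holomorphic_on_subset[OF N(3)] in auto)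
  have dK: "deriv (K i) w = deriv (H i) (\<tau> w) * deriv \<tau> w" if w: "w \<in> ball a s" for i w
    unfolding K_def
  proof (rule deriv_chain)
    show "\<tau> field_differentiable at w"
      using N s w holomorphic_on_imp_differentiable_at[OF N(3,1)] by auto
    show "H i field_differentiable at (\<tau> w)"
      using s w holomorphic_on_imp_differentiable_at[OF H(2) open_ball] by auto
  qed
  have gK: "g w $ i = Re (K i w)" if "w \<in> ball a s" for i w
    using g[of w] H(3)[of "\<tau> w" i] s that by (auto simp: K_def subset_iff)
  have as: "a \<in> ball a s" and ar: "\<tau> a \<in> ball (\<tau> a) r" using s(1) H(1) by auto
  have "dz_coeff g i a = deriv (K i) a / 2"
    unfolding dz_coeff_def by (rule real_part_derivative(2)[OF K open_ball as gK])
  then show "dz_coeff g i a = dz_coeff f i (\<tau> a) * deriv \<tau> a"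
    unfolding dK[OF as] H(6)[OF ar] by simp
  assume nz: "\<And>w. w \<in> N \<Longrightarrow> deriv \<tau> w \<noteq> 0"
  have "(\<Sum>i\<in>UNIV. (deriv (K i) w)\<^sup>2) = 0" "\<exists>i. deriv (K i) w \<noteq> 0" if w: "w \<in> ball a s" for w
  proof -
    have \<tau>w: "\<tau> w \<in> ball (\<tau> a) r" "w \<in> N" using s w by auto
    show "(\<Sum>i\<in>UNIV. (deriv (K i) w)\<^sup>2) = 0"
      using H(4)[OF \<tau>w(1)] by (simp add: dK[OF w] power_mult_distrib flip: sum_distrib_right)
    show "\<exists>i. deriv (K i) w \<noteq> 0" using H(5)[OF \<tau>w(1)] nz[OF \<tau>w(2)] by (simp add: dK[OF w])
  qed
  then show "null_rep g a" unfolding null_rep_def using s(1) K gK by blast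
qed

lemma null_rep_cnj:
  assumes "null_rep f (cnj a)"
  shows "null_rep (\<lambda>w. f (cnj w)) a" "dz_coeff (\<lambda>w. f (cnj w)) i a = cnj (dz_coeff f i (cnj a))"
proof -
  obtain H r where H: "r > 0" "\<And>i. H i holomorphic_on ball (cnj a) r"
    "\<And>i w. w \<in> ball (cnj a) r \<Longrightarrow> f w $ i = Re (H i w)"
    "\<And>w. w \<in> ball (cnj a) r \<Longrightarrow> (\<Sum>i\<in>UNIV. (deriv (H i) w)\<^sup>2) = 0"
    "\<And>w. w \<in> ball (cnj a) r \<Longrightarrow> \<exists>i. deriv (H i) w \<noteq> 0"
    "\<And>i w. w \<in> ball (cnj a) r \<Longrightarrow> dz_coeff f i w = deriv (H i) w / 2"
    "\<And>i w. w \<in> ball (cnj a) r \<Longrightarrow> ((\<lambda>w. f w $ i) has_derivative (\<lambda>d. Re (2 * dz_coeff f i w * d))) (at w)"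
    by (rule null_repE[OF assms]) (rule that)
  have b: "cnj w \<in> ball (cnj a) r" if "w \<in> ball a r" for w
    using that by (simp add: dist_norm complex_mod_cnj flip: complex_cnj_diff)
  define K where "K = (\<lambda>i w. cnj (H i (cnj w)))"
  have D: "(K i has_field_derivative cnj (deriv (H i) (cnj w))) (at w)" if w: "w \<in> ball a r" for i w
    using has_field_derivative_cnj_cnj[OF holomorphic_derivI[OF H(2) open_ball b[OF w]]]
    by (simp add: K_def o_def)
  have K: "K i holomorphic_on ball a r" for i
    unfolding holomorphic_on_open[OF open_ball] using D by blast
  have dK: "deriv (K i) w = cnj (deriv (H i) (cnj w))" if w: "w \<in> ball a r" for i w
    by (rule DERIV_imp_deriv[OF D[OF w]])
  have gK: "f (cnj w) $ i = Re (K i w)" if w: "w \<in> ball a r" for i w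
    using H(3)[OF b[OF w]] by (simp add: K_def)
  have "(\<Sum>i\<in>UNIV. (deriv (K i) w)\<^sup>2) = 0" "\<exists>i. deriv (K i) w \<noteq> 0" if w: "w \<in> ball a r" for w
  proof -
    have "(\<Sum>i\<in>UNIV. (deriv (K i) w)\<^sup>2) = cnj (\<Sum>i\<in>UNIV. (deriv (H i) (cnj w))\<^sup>2)"
      by (simp add: dK[OF w])
    then show "(\<Sum>i\<in>UNIV. (deriv (K i) w)\<^sup>2) = 0" using H(4)[OF b[OF w]] by simp
    show "\<exists>i. deriv (K i) w \<noteq> 0" using H(5)[OF b[OF w]] by (simp add: dK[OF w])
  qed
  then show "null_rep (\<lambda>w. f (cnj w)) a" unfolding null_rep_def using H(1) K gK by blast
  have ar: "a \<in> ball a r" using H(1) by simp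
  have "dz_coeff (\<lambda>w. f (cnj w)) i a = deriv (K i) a / 2"
    unfolding dz_coeff_def by (rule real_part_derivative(2)[OF K open_ball ar gK])
  then show "dz_coeff (\<lambda>w. f (cnj w)) i a = cnj (dz_coeff f i (cnj a))"
    unfolding dK[OF ar] H(6)[OF b[OF ar]] by simp
qed

text \<open>
  An antiholomorphic substitution replaces \<open>H\<close> by its conjugate, which has the same real part.
\<close>

lemma null_rep_compose_anti:
  assumes f: "null_rep f (cnj (\<kappa> a))" and N: "open N" "a \<in> N" "\<kappa> holomorphic_on N"
    and g: "\<And>w. w \<in> N \<Longrightarrow> g w = f (cnj (\<kappa> w))"
  shows "dz_coeff g i a = cnj (dz_coeff f i (cnj (\<kappa> a))) * deriv \<kappa> a"
    "(\<And>w. w \<in> N \<Longrightarrow> deriv \<kappa> w \<noteq> 0) \<Longrightarrow> null_rep g a"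
  using null_rep_compose[OF null_rep_cnj(1)[OF f] N g] null_rep_cnj(2)[OF f] by simp_all

text \<open>
  Conformality of the immersion becomes nullity of the curve and injectivity of the differential
  becomes its regularity.
\<close>

lemma minimal_immersion_null_rep:
  fixes f :: "complex \<Rightarrow> real ^ 4"
  assumes S: "open S" "a \<in> S" and f: "smooth_map_on f S"
    and c: "\<And>z. z \<in> S \<Longrightarrow> inj (frechet_derivative f (at z)) \<and> norm (du f z) = norm (dv f z) \<and> du f z \<bullet> dv f z = 0 \<and>
           mean_curvature_vector f z = 0"
  shows "null_rep f a"
proof -
  obtain r where r: "r > 0" "ball a r \<subseteq> S" using S openE by blast
  have C2: "Ck_on 2 f S" using f unfolding smooth_map_on_def by blast
  have d: "f differentiable at w" "du f differentiable at w" "dv f differentiable at w" if "w \<in> S" for w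
    using C2 S(1) that by (simp_all add: numeral_2_eq_2 differentiable_on_eq_differentiable_at)
  have nz: "du f z \<noteq> 0" if z: "z \<in> S" for z
  proof
    assume "du f z = 0"
    moreover have "frechet_derivative f (at z) 0 = 0"
      using d(1)[OF z] by (simp add: frechet_derivative_works has_derivative_def linear_0 bounded_linear.linear)
    ultimately have "frechet_derivative f (at z) 1 = frechet_derivative f (at z) 0" by (simp add: du_def)
    then show False using c[OF z] by (auto dest: injD)
  qed
  have "\<exists>H. H holomorphic_on ball a r \<and> (\<forall>w\<in>ball a r. f w $ i = Re (H w))" for i
  proof -
    let ?x = "\<lambda>w. f w $ i"
    have u: "?x differentiable at w" "du ?x w = du f w $ i" "dv ?x w = dv f w $ i" if "w \<in> S" for w
      using du_dv_component[OF d(1)[OF that]] by simp_all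
    have uu: "du ?x differentiable at w" "du (du ?x) w = du (du f) w $ i" "dv (du ?x) w = dv (du f) w $ i" if "w \<in> S" for w
      using du_dv_cong[OF S(1) that u(2)[symmetric] du_dv_component(1)[OF d(2)[OF that]]] du_dv_component(2,3)[OF d(2)[OF that]]
      by simp_all
    have vv: "dv ?x differentiable at w" "du (dv ?x) w = du (dv f) w $ i" "dv (dv ?x) w = dv (dv f) w $ i" if "w \<in> S" for w
      using du_dv_cong[OF S(1) that u(3)[symmetric] du_dv_component(1)[OF d(3)[OF that]]] du_dv_component(2,3)[OF d(3)[OF that]]
      by simp_all
    have h: "du (du ?x) w + dv (dv ?x) w = 0" if w: "w \<in> S" for w
    proof -
      have "du (du f) w + dv (dv f) w = 0"
        by (rule conformal_minimal_harmonic[OF S(1) w C2]) (use c nz w in auto)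
      then have "(du (du f) w + dv (dv f) w) $ i = 0" by simp
      then show ?thesis using uu[OF w] vv[OF w] by simp
    qed
    have m: "dv (du ?x) w = du (dv ?x) w" if w: "w \<in> S" for w
      using mixed_partials[OF S(1) w C2] uu[OF w] vv[OF w] by simp
    show ?thesis
      by (rule harmonic_real_part[of a r ?x]) (use r u uu vv h m in \<open>auto simp: subset_iff\<close>)
  qed
  then obtain H where H: "\<And>i. H i holomorphic_on ball a r" "\<And>i w. w \<in> ball a r \<Longrightarrow> f w $ i = Re (H i w)"
    by metis
  have dH: "deriv (H i) w = of_real (du f w $ i) - \<i> * of_real (dv f w $ i)" if w: "w \<in> ball a r" for i w
  proof -
    have wS: "w \<in> S" using r w by auto
    have "(complex_of_real (du (\<lambda>w. f w $ i) w) - \<i> * complex_of_real (dv (\<lambda>w. f w $ i) w)) / 2 = deriv (H i) w / 2"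
      by (rule real_part_derivative(2)[OF H(1) open_ball w H(2)])
    then show ?thesis unfolding du_dv_component(2,3)[OF d(1)[OF wS]] divide_cancel_right by auto
  qed
  have "(\<Sum>i\<in>UNIV. (deriv (H i) w)\<^sup>2) = 0" "\<exists>i. deriv (H i) w \<noteq> 0" if w: "w \<in> ball a r" for w
  proof -
    have wS: "w \<in> S" using r w by auto
    have "(\<Sum>i\<in>UNIV. (deriv (H i) w)\<^sup>2) = (\<Sum>i\<in>UNIV. of_real (du f w $ i * du f w $ i - dv f w $ i * dv f w $ i)
         - 2 * \<i> * of_real (du f w $ i * dv f w $ i))"
      by (rule sum.cong) (simp_all add: dH[OF w] power2_eq_square algebra_simps)
    also have "\<dots> = of_real (du f w \<bullet> du f w - dv f w \<bullet> dv f w) - 2 * \<i> * of_real (du f w \<bullet> dv f w)"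
      by (simp add: inner_vec_def sum_subtractf sum_distrib_left)
    also have "du f w \<bullet> du f w = dv f w \<bullet> dv f w" using c[OF wS] by (simp add: dot_square_norm)
    finally show "(\<Sum>i\<in>UNIV. (deriv (H i) w)\<^sup>2) = 0" using c[OF wS] by simp
    obtain i where "du f w $ i \<noteq> 0" using nz[OF wS] by (auto simp: vec_eq_iff)
    then have "deriv (H i) w \<noteq> 0" using dH[OF w, of i] by (auto simp: complex_eq_iff)
    then show "\<exists>i. deriv (H i) w \<noteq> 0" by blast
  qed
  then show ?thesis unfolding null_rep_def using r(1) H by blast
qed

section \<open>Local geometry of the double cover\<close>

text \<open>
  For a null vector \<open>q\<close> the real-linear map \<open>d \<mapsto> Re (q * d)\<close> is a similarity.
\<close>

lemma null_vector_norm: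
  fixes q :: "4 \<Rightarrow> complex"
  assumes "(\<Sum>i\<in>UNIV. (q i)\<^sup>2) = 0"
  shows "(norm (\<chi> i. Re (q i * d)))\<^sup>2 = (\<Sum>i\<in>UNIV. (norm (q i))\<^sup>2) / 2 * (norm d)\<^sup>2"
proof -
  have *: "(Re z)\<^sup>2 = ((norm z)\<^sup>2 + Re (z\<^sup>2)) / 2" for z
    unfolding cmod_power2 by (simp add: power2_eq_square)
  have "(norm (\<chi> i. Re (q i * d)))\<^sup>2 = (\<Sum>i\<in>UNIV. (Re (q i * d))\<^sup>2)"
    by (simp add: norm_vec_def L2_set_def sum_nonneg)
  also have "\<dots> = (\<Sum>i\<in>UNIV. ((norm (q i * d))\<^sup>2 + Re ((q i * d)\<^sup>2)) / 2)" by (simp only: *)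
  also have "\<dots> = (\<Sum>i\<in>UNIV. (norm (q i * d))\<^sup>2 / 2) + (\<Sum>i\<in>UNIV. Re ((q i * d)\<^sup>2)) / 2"
    by (simp only: add_divide_distrib sum.distrib sum_divide_distrib)
  also have "(\<Sum>i\<in>UNIV. Re ((q i * d)\<^sup>2)) = Re ((\<Sum>i\<in>UNIV. (q i)\<^sup>2) * d\<^sup>2)"
    by (simp add: power_mult_distrib sum_distrib_right)
  also have "\<dots> = 0" using assms by simp
  finally show ?thesis by (simp add: norm_mult power_mult_distrib sum_distrib_right sum_divide_distrib)
qed

text \<open>
  Near \<open>a\<close> the map is a small Lipschitz perturbation of its differential, which is a similarity.
\<close>

lemma null_rep_lower_lipschitz:
  assumes "null_rep f a"
  obtains c r where "c > 0" "r > 0" "\<And>z w. z \<in> ball a r \<Longrightarrow> w \<in> ball a r \<Longrightarrow> c * norm (z - w) \<le> norm (f z - f w)"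
proof -
  obtain H r where H: "r > 0" "\<And>i. H i holomorphic_on ball a r"
    "\<And>i w. w \<in> ball a r \<Longrightarrow> f w $ i = Re (H i w)"
    "\<And>w. w \<in> ball a r \<Longrightarrow> (\<Sum>i\<in>UNIV. (deriv (H i) w)\<^sup>2) = 0"
    "\<And>w. w \<in> ball a r \<Longrightarrow> \<exists>i. deriv (H i) w \<noteq> 0"
    "\<And>i w. w \<in> ball a r \<Longrightarrow> dz_coeff f i w = deriv (H i) w / 2"
    "\<And>i w. w \<in> ball a r \<Longrightarrow> ((\<lambda>w. f w $ i) has_derivative (\<lambda>d. Re (2 * dz_coeff f i w * d))) (at w)"
    by (rule null_repE[OF assms]) (rule that)
  define q where "q = (\<lambda>i. deriv (H i) a)"
  define l where "l = sqrt ((\<Sum>i\<in>UNIV. (norm (q i))\<^sup>2) / 2)"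
  have ar: "a \<in> ball a r" using H(1) by simp
  have q0: "(\<Sum>i\<in>UNIV. (q i)\<^sup>2) = 0" "\<exists>i. q i \<noteq> 0" unfolding q_def by (rule H(4)[OF ar] H(5)[OF ar])+
  have "(\<Sum>i\<in>UNIV. (norm (q i))\<^sup>2) \<noteq> 0" using q0(2) by (simp add: sum_nonneg_eq_0_iff)
  then have l: "l > 0" unfolding l_def by (simp add: less_le sum_nonneg)
  have nq: "norm (\<chi> i. Re (q i * d)) = l * norm d" for d
  proof -
    have "norm (\<chi> i. Re (q i * d)) = sqrt ((norm (\<chi> i. Re (q i * d)))\<^sup>2)" by simp
    then show ?thesis unfolding null_vector_norm[OF q0(1)]
      by (simp only: l_def real_sqrt_mult real_sqrt_abs abs_norm_cancel)
  qed
  have "\<exists>s>0. s \<le> r \<and> (\<forall>w\<in>ball a s. norm (deriv (H i) w - q i) \<le> l / 8)" for i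
  proof -
    have "isCont (deriv (H i)) a"
      using holomorphic_on_imp_continuous_on[OF holomorphic_deriv[OF H(2) open_ball]] ar
      by (simp add: continuous_on_eq_continuous_at)
    then obtain s where "s > 0" "\<And>w. dist w a < s \<Longrightarrow> dist (deriv (H i) w) (deriv (H i) a) < l / 8"
      unfolding continuous_at_eps_delta using l by (metis divide_pos_pos zero_less_numeral)
    then show ?thesis using H(1)
      by (intro exI[of _ "min s r"]) (auto simp: q_def dist_norm norm_minus_commute intro: less_imp_le)
  qed
  then obtain s where s: "\<And>i::4. s i > 0" "\<And>i. s i \<le> r" "\<And>i w. w \<in> ball a (s i) \<Longrightarrow> norm (deriv (H i) w - q i) \<le> l / 8"
    by metis
  define t where "t = Min (range s)"
  have t: "t > 0" "\<And>i. t \<le> s i" using s(1) by (auto simp: t_def)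
  show thesis
  proof (rule that[of "l / 2" t])
    fix z w assume z: "z \<in> ball a t" and w: "w \<in> ball a t"
    have F: "norm ((H i z - q i * z) - (H i w - q i * w)) \<le> l / 8 * norm (z - w)" for i
    proof (rule field_differentiable_bound[OF convex_ball[of a t] _ _ z w])
      fix u assume u: "u \<in> ball a t"
      then have "u \<in> ball a r" using t(2)[of i] s(2)[of i] by auto
      then have "(H i has_field_derivative deriv (H i) u) (at u within ball a t)"
        using holomorphic_derivI[OF H(2) open_ball] has_field_derivative_at_within by blast
      then show "((\<lambda>z. H i z - q i * z) has_field_derivative deriv (H i) u - q i) (at u within ball a t)"
        by (auto intro!: derivative_eq_intros)
      show "norm (deriv (H i) u - q i) \<le> l / 8" using s(3)[of u i] t(2)[of i] u by auto
    qed
    define E where "E = (\<chi> i. Re ((H i z - q i * z) - (H i w - q i * w)))"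
    have zr: "z \<in> ball a r" "w \<in> ball a r" using z w t(2)[of undefined] s(2)[of undefined] by auto
    have "f z - f w = (\<chi> i. Re (q i * (z - w))) + E"
      by (simp add: vec_eq_iff H(3)[OF zr(1)] H(3)[OF zr(2)] E_def algebra_simps)
    then have "norm (f z - f w) \<ge> norm (\<chi> i. Re (q i * (z - w))) - norm E"
      using norm_diff_ineq[of "\<chi> i. Re (q i * (z - w))" E] by simp
    moreover have "norm E \<le> (\<Sum>i\<in>UNIV. \<bar>E $ i\<bar>)" by (rule norm_le_l1_cart)
    moreover have "(\<Sum>i\<in>UNIV. \<bar>E $ i\<bar>) \<le> (\<Sum>i\<in>(UNIV::4 set). l / 8 * norm (z - w))"
    proof (rule sum_mono)
      fix i :: 4
      show "\<bar>E $ i\<bar> \<le> l / 8 * norm (z - w)"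
        using order_trans[OF abs_Re_le_cmod F[of i]] by (simp only: E_def vec_lambda_beta)
    qed
    ultimately show "l / 2 * norm (z - w) \<le> norm (f z - f w)" unfolding nq by simp
  qed (use l t in auto)
qed

text \<open>
  The derivative of a piecewise smooth curve may be unbounded, so the fundamental theorem is applied in the
  Henstock-Kurzweil sense; if the length is finite the derivative is also Lebesgue integrable, and the two integrals agree.
\<close>

lemma curve_length_lower_bound:
  fixes u :: "real \<Rightarrow> 'a::euclidean_space"
  assumes ab: "a \<le> b" and S: "finite S" and cont: "continuous_on {a..b} u"
    and der: "\<And>t. t \<in> {a<..<b} - S \<Longrightarrow> (u has_vector_derivative u' t) (at t)"
    and cont': "continuous_on ({a<..<b} - S) u'"
  shows "ennreal (norm (u b - u a)) \<le> (\<integral>\<^sup>+t\<in>{a..b}. ennreal (norm (u' t)) \<partial>lborel)"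
proof (cases "(\<integral>\<^sup>+t\<in>{a..b}. ennreal (norm (u' t)) \<partial>lborel) = \<infinity>")
  case False
  \<comment> \<open>Unlike the derivative itself, this function is Borel measurable.\<close>
  define h where "h = (\<lambda>t. indicator ({a<..<b} - S) t *\<^sub>R u' t)"
  have meas: "h \<in> borel_measurable lborel"
    unfolding h_def using cont' S
    by (simp add: borel_measurable_continuous_on_indicator borel_open open_Diff finite_imp_closed)
  have le: "(\<integral>\<^sup>+t. ennreal (norm (h t)) \<partial>lborel) \<le> (\<integral>\<^sup>+t\<in>{a..b}. ennreal (norm (u' t)) \<partial>lborel)"
    by (intro nn_integral_mono) (auto simp: h_def indicator_def)
  have int: "integrable lborel h"
    by (rule integrableI_bounded[OF meas]) (use le False in \<open>auto simp: top.not_eq_extremum less_top\<close>)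
  have "(u' has_integral (u b - u a)) {a..b}"
    using fundamental_theorem_of_calculus_interior_strong[OF S ab der cont] by auto
  then have "((\<lambda>t. if t \<in> {a..b} then u' t else 0) has_integral (u b - u a)) UNIV"
    by (simp only: has_integral_restrict_UNIV)
  then have "(h has_integral (u b - u a)) UNIV"
    by (rule has_integral_spike_finite[where S="insert a (insert b S)", rotated 2])
       (use S in \<open>auto simp: h_def\<close>)
  moreover have "(h has_integral integral\<^sup>L lborel h) UNIV" by (rule has_integral_integral_lborel[OF int])
  ultimately have "u b - u a = integral\<^sup>L lborel h" by (rule has_integral_unique)
  then have "ennreal (norm (u b - u a)) \<le> (\<integral>\<^sup>+t. ennreal (norm (h t)) \<partial>lborel)"
    using integral_norm_bound_ennreal[OF int] by simp
  then show ?thesis using le by (rule order_trans)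
qed simp

lemma first_exit:
  fixes \<gamma> :: "real \<Rightarrow> 'a::topological_space"
  assumes \<gamma>: "continuous_on {0..1} \<gamma>" and W: "open W" "\<gamma> 0 \<in> W" "\<gamma> 1 \<notin> W"
  obtains b where "0 < b" "b \<le> 1" "\<gamma> b \<notin> W" "\<And>t. 0 \<le> t \<Longrightarrow> t < b \<Longrightarrow> \<gamma> t \<in> W"
proof -
  have "closed ({0..1} \<inter> \<gamma> -` (- W))" using \<gamma> W(1) by (intro continuous_closed_preimage) auto
  moreover have "bounded ({0..1} \<inter> \<gamma> -` (- W))" by (rule bounded_subset[of "{0..1}"]) auto
  ultimately have "compact ({0..1} \<inter> \<gamma> -` (- W))" by (simp add: compact_eq_bounded_closed)
  moreover have "1 \<in> {0..1} \<inter> \<gamma> -` (- W)" using W(3) by simp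
  then have "{0..1} \<inter> \<gamma> -` (- W) \<noteq> {}" by blast
  ultimately obtain b where b: "b \<in> {0..1} \<inter> \<gamma> -` (- W)" "\<And>t. t \<in> {0..1} \<inter> \<gamma> -` (- W) \<Longrightarrow> b \<le> t"
    using compact_attains_inf by metis
  show thesis
  proof (rule that[of b])
    show "0 < b" using b(1) W(2) by (cases "b = 0") auto
    show "\<gamma> t \<in> W" if "0 \<le> t" "t < b" for t using b(2)[of t] b(1) that by force
  qed (use b in auto)
qed

definition chart_ball :: "'a set \<Rightarrow> ('a \<Rightarrow> complex) \<Rightarrow> complex \<Rightarrow> real \<Rightarrow> 'a set" where
  "chart_ball V \<psi> a r = V \<inter> \<psi> -` ball a r"

text \<open>
  The inverse image of the closed coordinate ball is compact, hence closed in the Hausdorff surface, so a path leaving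
  the open ball does so through its coordinate sphere.
\<close>

lemma first_exit_chart_ball:
  fixes \<gamma> :: "real \<Rightarrow> 'a::t2_space"
  assumes V: "is_chart V \<psi>" and r: "cball a r \<subseteq> \<psi> ` V" "r > 0"
    and \<gamma>: "continuous_on {0..1} \<gamma>" and s: "\<gamma> 0 \<in> chart_ball V \<psi> a r" "\<gamma> 1 \<notin> chart_ball V \<psi> a r"
  obtains b where "0 < b" "b \<le> 1" "\<gamma> ` {0..b} \<subseteq> V" "\<psi> ` \<gamma> ` {0..b} \<subseteq> cball a r" "dist a (\<psi> (\<gamma> b)) = r"
proof -
  have "open (chart_ball V \<psi> a r)" unfolding chart_ball_def by (rule chart_preimage[OF V open_ball])
  then obtain b where b: "0 < b" "b \<le> 1" "\<gamma> b \<notin> chart_ball V \<psi> a r" "\<And>t. 0 \<le> t \<Longrightarrow> t < b \<Longrightarrow> \<gamma> t \<in> chart_ball V \<psi> a r"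
    using first_exit[OF \<gamma> _ s] by metis
  define K where "K = inv_into V \<psi> ` cball a r"
  have "compact K" unfolding K_def
    by (intro compact_continuous_image continuous_on_subset[OF is_chartD(5)[OF V] r(1)]) simp
  then have "closed K" by (rule compact_imp_closed)
  have sub: "chart_ball V \<psi> a r \<subseteq> K"
  proof
    fix p assume p: "p \<in> chart_ball V \<psi> a r"
    then have "p = inv_into V \<psi> (\<psi> p)" "\<psi> p \<in> cball a r" using is_chartD(6)[OF V, of p] by (auto simp: chart_ball_def)
    then show "p \<in> K" unfolding K_def by blast
  qed
  have "\<gamma> ` closure {0..<b} \<subseteq> K"
    by (rule image_closure_subset[OF _ \<open>closed K\<close>])
       (use b sub in \<open>auto intro!: continuous_on_subset[OF \<gamma>]\<close>)
  then have gK: "\<gamma> ` {0..b} \<subseteq> K" using b(1) by simp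
  have K: "p \<in> V \<and> \<psi> p \<in> cball a r" if "p \<in> K" for p
    using that r(1) unfolding K_def by (auto simp: f_inv_into_f subset_iff intro: inv_into_into)
  have "\<gamma> b \<in> K" using gK b by auto
  then have "dist a (\<psi> (\<gamma> b)) = r" using K[of "\<gamma> b"] b(3) by (auto simp: chart_ball_def)
  then show thesis using that[OF b(1,2)] gK K by blast
qed

locale double_cover = surface B
  for B :: "('b::t2_space) chart set" +
  fixes A :: "('a::t2_space) chart set" and \<pi> :: "'b \<Rightarrow> 'a" and I :: "'b \<Rightarrow> 'b" and X :: "'a \<Rightarrow> real^4"
  assumes A: "dianalytic_atlas A" and X: "conformal_minimal_immersion A X"
    and cover: "orientable_double_cover B A \<pi> I" and complete: "complete_immersion A X"
begin

abbreviation Y :: "'b \<Rightarrow> real^4" where "Y \<equiv> X \<circ> \<pi>"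

lemma chartA: "(V, \<psi>) \<in> A \<Longrightarrow> is_chart V \<psi>"
  using A unfolding dianalytic_atlas_def chart_atlas_def by blast

lemma ex_chartA: obtains V \<psi> where "(V, \<psi>) \<in> A" "q \<in> V"
proof -
  have "(\<Union>(V, \<psi>)\<in>A. V) = UNIV" using A unfolding dianalytic_atlas_def chart_atlas_def by (elim conjE)
  then have "q \<in> (\<Union>(V, \<psi>)\<in>A. V)" by (metis UNIV_I)
  then show thesis using that by blast
qed

lemmas chartAD = is_chartD[OF chartA]

lemma covering: "covering_space UNIV \<pi> UNIV"
  using cover unfolding orientable_double_cover_def by (elim conjE)

lemma \<pi>_continuous: "continuous_on UNIV \<pi>"
  by (rule covering_space_imp_continuous[OF covering])

lemma \<pi>_surj: obtains p where "\<pi> p = q"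
  using covering_space_imp_surjective[OF covering] by (metis UNIV_I imageE)

lemma \<pi>_dianalytic:
  assumes "(U, \<phi>) \<in> B" "(V, \<psi>) \<in> A"
  shows "dianalytic_on (\<psi> \<circ> \<pi> \<circ> inv_into U \<phi>) (\<phi> ` (U \<inter> \<pi> -` V))"
proof -
  have "\<forall>(U, \<phi>)\<in>B. \<forall>(V, \<psi>)\<in>A. dianalytic_on (\<psi> \<circ> \<pi> \<circ> inv_into U \<phi>) (\<phi> ` (U \<inter> \<pi> -` V))"
    using cover unfolding orientable_double_cover_def by (elim conjE)
  from bspec[OF bspec[OF this assms(1), simplified] assms(2)] show ?thesis by simp
qed

lemma I_antiholomorphic:
  assumes "(U, \<phi>) \<in> B" "(V, \<psi>) \<in> B"
  shows "antiholomorphic_on (\<psi> \<circ> I \<circ> inv_into U \<phi>) (\<phi> ` (U \<inter> I -` V))"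
proof -
  have "\<forall>(U, \<phi>)\<in>B. \<forall>(V, \<psi>)\<in>B. antiholomorphic_on (\<psi> \<circ> I \<circ> inv_into U \<phi>) (\<phi> ` (U \<inter> I -` V))"
    using cover unfolding orientable_double_cover_def by (elim conjE)
  from bspec[OF bspec[OF this assms(1), simplified] assms(2)] show ?thesis by simp
qed

lemma I_continuous: "continuous_on UNIV I"
  using cover unfolding orientable_double_cover_def by (elim conjE)

lemma \<pi>_fibre: "\<pi> p = \<pi> q \<longleftrightarrow> q = p \<or> q = I p"
  using cover unfolding orientable_double_cover_def by (elim conjE) (simp only:)

lemma \<pi>_I: "\<pi> (I p) = \<pi> p" using \<pi>_fibre[of p "I p"] by simp

lemma null_rep_A:
  assumes V: "(V, \<psi>) \<in> A" and q: "q \<in> V"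
  shows "null_rep (X \<circ> inv_into V \<psi>) (\<psi> q)"
proof -
  let ?f = "X \<circ> inv_into V \<psi>"
  have *: "\<forall>(U, \<phi>)\<in>A. let f = X \<circ> inv_into U \<phi> in
        smooth_map_on f (\<phi> ` U) \<and>
        (\<forall>z\<in>\<phi> ` U.
           inj (frechet_derivative f (at z)) \<and>
           norm (du f z) = norm (dv f z) \<and> du f z \<bullet> dv f z = 0 \<and>
           mean_curvature_vector f z = 0)"
    using X unfolding conformal_minimal_immersion_def .
  have "smooth_map_on ?f (\<psi> ` V)" "\<And>z. z \<in> \<psi> ` V \<Longrightarrow> inj (frechet_derivative ?f (at z)) \<and>
           norm (du ?f z) = norm (dv ?f z) \<and> du ?f z \<bullet> dv ?f z = 0 \<and> mean_curvature_vector ?f z = 0"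
    using bspec[OF * V] by (simp_all only: Let_def prod.case)
  then show ?thesis by (intro minimal_immersion_null_rep[OF chartAD(2)[OF V]]) (use q in auto)
qed

text \<open>
  In charts the covering is near each point an injective holomorphic or antiholomorphic map.
\<close>

lemma \<pi>_local:
  assumes U: "(U, \<phi>) \<in> B" "p \<in> U" and V: "(V, \<psi>) \<in> A" "\<pi> p \<in> V"
  obtains N where "open N" "\<phi> p \<in> N" "N \<subseteq> \<phi> ` (U \<inter> \<pi> -` V)" "inj_on (\<psi> \<circ> \<pi> \<circ> inv_into U \<phi>) N"
    "(\<psi> \<circ> \<pi> \<circ> inv_into U \<phi>) holomorphic_on N \<or> (cnj \<circ> (\<psi> \<circ> \<pi> \<circ> inv_into U \<phi>)) holomorphic_on N"
proof -
  let ?\<tau> = "\<psi> \<circ> \<pi> \<circ> inv_into U \<phi>"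
  have pin: "\<phi> p \<in> \<phi> ` (U \<inter> \<pi> -` V)" using U V by auto
  then obtain W where W: "open W" "\<phi> p \<in> W" "W \<subseteq> \<phi> ` (U \<inter> \<pi> -` V)"
     "?\<tau> holomorphic_on W \<or> antiholomorphic_on ?\<tau> W"
    using \<pi>_dianalytic[OF U(1) V(1)] unfolding dianalytic_on_def by blast
  obtain T u q where T: "p \<in> T" "openin (top_of_set UNIV) T" "homeomorphism T u \<pi> q"
    by (rule covering_space_local_homeomorphism[OF covering UNIV_I]) (rule that)
  have injT: "inj_on \<pi> T" using T(3) unfolding homeomorphism_def by (intro inj_on_inverseI[where g=q]) blast
  define N where "N = W \<inter> \<phi> ` (U \<inter> T)"
  show thesis
  proof (rule that[of N])
    show "open N" unfolding N_def using W T chart_image_Int[OF chart[OF U(1)]] by auto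
    show "\<phi> p \<in> N" using W T U by (auto simp: N_def)
    show "N \<subseteq> \<phi> ` (U \<inter> \<pi> -` V)" using W by (auto simp: N_def)
    show "inj_on ?\<tau> N"
    proof (rule inj_onI)
      fix z w assume z: "z \<in> N" and w: "w \<in> N" and e: "?\<tau> z = ?\<tau> w"
      obtain a b where ab: "a \<in> U" "a \<in> T" "z = \<phi> a" "b \<in> U" "b \<in> T" "w = \<phi> b"
        using z w by (auto simp: N_def)
      have "\<pi> a \<in> V" "\<pi> b \<in> V"
        using z w W(3) ab chartD(3)[OF U(1)] unfolding N_def inj_on_def by blast+
      moreover have "\<psi> (\<pi> a) = \<psi> (\<pi> b)" using e ab chartD(6)[OF U(1)] by simp
      ultimately have "\<pi> a = \<pi> b" using chartAD(3)[OF V(1)] by (simp add: inj_on_eq_iff)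
      then show "z = w" using injT ab by (simp add: inj_on_eq_iff)
    qed
    show "?\<tau> holomorphic_on N \<or> (cnj \<circ> ?\<tau>) holomorphic_on N"
      using W(4) unfolding antiholomorphic_on_def o_def N_def by (meson holomorphic_on_subset inf_le1)
  qed
qed

lemma null_rep_B:
  assumes U: "(U, \<phi>) \<in> B" "p \<in> U"
  shows "null_rep (Y \<circ> inv_into U \<phi>) (\<phi> p)"
proof -
  obtain V \<psi> where V: "(V, \<psi>) \<in> A" "\<pi> p \<in> V" using ex_chartA by metis
  define \<tau> where "\<tau> = \<psi> \<circ> \<pi> \<circ> inv_into U \<phi>"
  obtain N where N: "open N" "\<phi> p \<in> N" "N \<subseteq> \<phi> ` (U \<inter> \<pi> -` V)" "inj_on \<tau> N"
    "\<tau> holomorphic_on N \<or> (cnj \<circ> \<tau>) holomorphic_on N"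
    by (rule \<pi>_local[OF U V, folded \<tau>_def]) (rule that)
  have g: "(Y \<circ> inv_into U \<phi>) w = (X \<circ> inv_into V \<psi>) (\<tau> w)" if w: "w \<in> N" for w
  proof -
    obtain a where "a \<in> U" "\<pi> a \<in> V" "w = \<phi> a" using N(3) w by auto
    then show ?thesis using chartD(6)[OF U(1)] chartAD(6)[OF V(1)] by (simp add: \<tau>_def)
  qed
  have \<tau>p: "\<tau> (\<phi> p) = \<psi> (\<pi> p)" using chartD(6)[OF U] by (simp add: \<tau>_def)
  note nA = null_rep_A[OF V]
  show ?thesis
  proof (cases "\<tau> holomorphic_on N")
    case True
    show ?thesis
      by (rule null_rep_compose(2)[where f="X \<circ> inv_into V \<psi>" and \<tau>=\<tau> and N=N])
         (use nA \<tau>p N True g holomorphic_injective_imp_regular[OF True N(1,4)] in auto)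
  next
    case False
    then have h: "(cnj \<circ> \<tau>) holomorphic_on N" using N(5) by blast
    have inj: "inj_on (cnj \<circ> \<tau>) N" using N(4) by (auto simp: inj_on_def)
    show ?thesis
      by (rule null_rep_compose_anti(2)[where f="X \<circ> inv_into V \<psi>" and \<kappa>="cnj \<circ> \<tau>" and N=N])
         (use nA \<tau>p N h g holomorphic_injective_imp_regular[OF h N(1) inj] in auto)
  qed
qed

lemma form_coeff_hol_form: "hol_form B (\<lambda>U \<phi>. form_coeff Y U \<phi> i)"
proof (rule hol_formI)
  fix U \<phi> assume U: "(U, \<phi>) \<in> B"
  have "dz_coeff (Y \<circ> inv_into U \<phi>) i holomorphic_on \<phi> ` U"
    by (rule null_rep_holomorphic[OF _ chartD(2)[OF U]]) (use null_rep_B[OF U] in auto)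
  then show "form_coeff Y U \<phi> i holomorphic_on \<phi> ` U"
    unfolding form_coeff_eq[abs_def] .
next
  fix U \<phi> V \<psi> p assume U: "(U, \<phi>) \<in> B" and V: "(V, \<psi>) \<in> B" and p: "p \<in> U" "p \<in> V"
  note n = near_transition[OF U V p]
  have t: "(\<psi> \<circ> inv_into U \<phi>) (\<phi> p) = \<psi> p" using chartD(6)[OF U p(1)] by simp
  have "dz_coeff (Y \<circ> inv_into U \<phi>) i (\<phi> p)
     = dz_coeff (Y \<circ> inv_into V \<psi>) i ((\<psi> \<circ> inv_into U \<phi>) (\<phi> p)) * deriv (\<psi> \<circ> inv_into U \<phi>) (\<phi> p)"
  proof (rule null_rep_compose(1)[OF _ n(1,2) transition[OF U V]])
    show "null_rep (Y \<circ> inv_into V \<psi>) ((\<psi> \<circ> inv_into U \<phi>) (\<phi> p))" unfolding t by (rule null_rep_B[OF V p(2)])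
    show "(Y \<circ> inv_into U \<phi>) w = (Y \<circ> inv_into V \<psi>) ((\<psi> \<circ> inv_into U \<phi>) w)" if "w \<in> \<phi> ` (U \<inter> V)" for w
      using n(3)[OF that] by simp
  qed
  then show "form_coeff Y U \<phi> i (\<phi> p) = form_coeff Y V \<psi> i (\<psi> p) * deriv (\<psi> \<circ> inv_into U \<phi>) (\<phi> p)"
    unfolding form_coeff_eq t .
qed

text \<open>
  The deck transformation preserves the immersion and reverses the orientation, so it conjugates the forms up to
  a common factor coming from the change of coordinates.
\<close>

lemma form_coeff_I:
  assumes U: "(U, \<phi>) \<in> B" "p \<in> U" and V: "(V, \<psi>) \<in> B" "I p \<in> V"
  obtains c where "\<And>i. form_coeff Y U \<phi> i (\<phi> p) = cnj (form_coeff Y V \<psi> i (\<psi> (I p))) * c"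
proof -
  define \<kappa> where "\<kappa> = cnj \<circ> (\<psi> \<circ> I \<circ> inv_into U \<phi>)"
  let ?N = "\<phi> ` (U \<inter> I -` V)"
  have "open (I -` V)" by (rule open_vimage[OF chartD(1)[OF V(1)] I_continuous])
  then have oN: "open ?N" by (rule chart_image_Int[OF chart[OF U(1)]])
  have pN: "\<phi> p \<in> ?N" using U V by auto
  have hol: "\<kappa> holomorphic_on ?N"
    using I_antiholomorphic[OF U(1) V(1)] by (simp add: antiholomorphic_on_def \<kappa>_def o_def)
  have \<kappa>p: "cnj (\<kappa> (\<phi> p)) = \<psi> (I p)" using chartD(6)[OF U] by (simp add: \<kappa>_def)
  have "dz_coeff (Y \<circ> inv_into U \<phi>) i (\<phi> p)
     = cnj (dz_coeff (Y \<circ> inv_into V \<psi>) i (cnj (\<kappa> (\<phi> p)))) * deriv \<kappa> (\<phi> p)" for i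
  proof (rule null_rep_compose_anti(1)[OF _ oN pN hol])
    show "null_rep (Y \<circ> inv_into V \<psi>) (cnj (\<kappa> (\<phi> p)))" unfolding \<kappa>p by (rule null_rep_B[OF V])
    fix w assume "w \<in> ?N"
    then obtain a where "a \<in> U" "I a \<in> V" "w = \<phi> a" by auto
    then show "(Y \<circ> inv_into U \<phi>) w = (Y \<circ> inv_into V \<psi>) (cnj (\<kappa> w))"
      using chartD(6)[OF U(1), of a] chartD(6)[OF V(1), of "I a"] by (simp add: \<kappa>_def \<pi>_I)
  qed
  then show thesis using that unfolding form_coeff_eq \<kappa>p by blast
qed

lemma disc_derivative:
  assumes \<Phi>: "hol_disc B \<Phi> R" and w: "w \<in> ball 0 R" and U: "(U, \<phi>) \<in> B" "\<Phi> w \<in> U"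
  shows "((\<lambda>w. Y (\<Phi> w) $ i) has_derivative
     (\<lambda>d. Re (2 * form_coeff Y U \<phi> i (\<phi> (\<Phi> w)) * deriv (\<phi> \<circ> \<Phi>) w * d))) (at w)"
proof -
  note d = disc_chart_deriv[OF \<Phi> w U]
  have 1: "((\<phi> \<circ> \<Phi>) has_derivative (\<lambda>d. deriv (\<phi> \<circ> \<Phi>) w * d)) (at w)"
    using d(2) by (simp add: has_field_derivative_def)
  have "((\<lambda>w. (Y \<circ> inv_into U \<phi>) w $ i) has_derivative
      (\<lambda>d. Re (2 * dz_coeff (Y \<circ> inv_into U \<phi>) i (\<phi> (\<Phi> w)) * d))) (at ((\<phi> \<circ> \<Phi>) w))"
    using null_rep_derivative[OF null_rep_B[OF U]] by simp
  from has_derivative_compose[OF 1 this]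
  have "((\<lambda>w. (Y \<circ> inv_into U \<phi>) ((\<phi> \<circ> \<Phi>) w) $ i) has_derivative
     (\<lambda>d. Re (2 * form_coeff Y U \<phi> i (\<phi> (\<Phi> w)) * deriv (\<phi> \<circ> \<Phi>) w * d))) (at w)"
    by (simp add: form_coeff_eq mult.assoc)
  then show ?thesis
    by (rule has_derivative_transform_within_open[OF _ d(1)]) (use w U chartD(6)[OF U(1)] in auto)
qed

lemma pw_C1_length_bound:
  assumes \<gamma>: "pw_C1_path A \<gamma>" and V: "(V, \<psi>) \<in> A" and ab: "0 \<le> a" "a \<le> b" "b \<le> 1" "\<gamma> ` {a..b} \<subseteq> V"
  shows "ennreal (norm (X (\<gamma> b) - X (\<gamma> a))) \<le> induced_length X \<gamma>"
proof -
  have "\<forall>(U, \<phi>)\<in>A. \<forall>a b. 0 \<le> a \<and> a \<le> b \<and> b \<le> 1 \<and> \<gamma> ` {a..b} \<subseteq> U \<longrightarrow>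
        (\<phi> \<circ> \<gamma>) piecewise_C1_differentiable_on {a..b}" using \<gamma> unfolding pw_C1_path_def by blast
  from bspec[OF this V] have "(\<psi> \<circ> \<gamma>) piecewise_C1_differentiable_on {a..b}" using ab by simp
  then obtain S where c: "continuous_on {a..b} (\<psi> \<circ> \<gamma>)" and S: "finite S" "(\<psi> \<circ> \<gamma>) C1_differentiable_on ({a..b} - S)"
    unfolding piecewise_C1_differentiable_on_def by blast
  from S(2) obtain D where D: "\<And>t. t \<in> {a..b} - S \<Longrightarrow> ((\<psi> \<circ> \<gamma>) has_vector_derivative D t) (at t)"
     "continuous_on ({a..b} - S) D" unfolding C1_differentiable_on_def by blast
  let ?f = "X \<circ> inv_into V \<psi>"
  have eq: "X (\<gamma> t) = ?f ((\<psi> \<circ> \<gamma>) t)" if "t \<in> {a..b}" for t 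
  proof -
    have "\<gamma> t \<in> V" using ab(4) that by blast
    then show ?thesis using chartAD(6)[OF V] by simp
  qed
  have inV: "(\<psi> \<circ> \<gamma>) t \<in> \<psi> ` V" if "t \<in> {a..b}" for t
    unfolding o_apply using ab(4) that by blast
  define q where "q = (\<lambda>z d. (\<chi> i. Re (2 * dz_coeff ?f i z * d)))"
  have df: "(?f has_derivative q z) (at z)" if "z \<in> \<psi> ` V" for z
  proof -
    have "null_rep ?f z" using null_rep_A[OF V] that by auto
    then have "((\<lambda>w. ?f w $ i) has_derivative (\<lambda>d. Re (2 * dz_coeff ?f i z * d))) (at z)" for i
      by (rule null_rep_derivative)
    then show ?thesis
      by (subst has_derivative_componentwise_within)
         (auto simp: Basis_vec_def inner_axis q_def cart_eq_inner_axis[symmetric])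
  qed
  have contf: "continuous_on (\<psi> ` V) ?f"
    using df by (intro has_derivative_continuous_on[where f'=q]) (auto intro: has_derivative_at_withinI)
  have holq: "dz_coeff ?f i holomorphic_on \<psi> ` V" for i
    by (rule null_rep_holomorphic[OF _ chartAD(2)[OF V]]) (use null_rep_A[OF V] in auto)
  define u where "u = X \<circ> \<gamma>"
  have u': "(u has_vector_derivative q ((\<psi> \<circ> \<gamma>) t) (D t)) (at t)" if t: "t \<in> {a<..<b} - S" for t
  proof -
    have tt: "t \<in> {a..b} - S" using t by auto
    have "(?f \<circ> (\<psi> \<circ> \<gamma>) has_vector_derivative q ((\<psi> \<circ> \<gamma>) t) (D t)) (at t)"
      by (rule vector_derivative_diff_chain_within[OF D(1)[OF tt] has_derivative_at_withinI[OF df[OF inV]]])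
         (use tt in auto)
    then show ?thesis
      by (rule has_vector_derivative_transform_within_open[of _ _ _ "{a<..<b}"]) (use t eq in \<open>auto simp: u_def\<close>)
  qed
  have "ennreal (norm (u b - u a)) \<le> (\<integral>\<^sup>+t\<in>{a..b}. ennreal (norm (vector_derivative u (at t))) \<partial>lborel)"
  proof (rule curve_length_lower_bound[OF ab(2) S(1)])
    have "continuous_on {a..b} (?f \<circ> (\<psi> \<circ> \<gamma>))"
      by (intro continuous_on_compose c continuous_on_subset[OF contf]) (use inV in auto)
    then show "continuous_on {a..b} u" by (rule continuous_on_eq) (use eq in \<open>auto simp: u_def\<close>)
    show "\<And>t. t \<in> {a<..<b} - S \<Longrightarrow> (u has_vector_derivative vector_derivative u (at t)) (at t)"
      using u' vector_derivative_works differentiableI_vector by blast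
    have "continuous_on ({a<..<b} - S) (\<lambda>t. q ((\<psi> \<circ> \<gamma>) t) (D t))"
      unfolding q_def
    proof (intro continuous_intros)
      fix i
      show "continuous_on ({a<..<b} - S) (\<lambda>t. dz_coeff ?f i ((\<psi> \<circ> \<gamma>) t))"
      proof (rule continuous_on_compose2[OF holomorphic_on_imp_continuous_on[OF holq]])
        show "continuous_on ({a<..<b} - S) (\<psi> \<circ> \<gamma>)" by (rule continuous_on_subset[OF c]) auto
      qed (use inV in auto)
      show "continuous_on ({a<..<b} - S) D" by (rule continuous_on_subset[OF D(2)]) auto
    qed
    then show "continuous_on ({a<..<b} - S) (\<lambda>t. vector_derivative u (at t))"
      by (rule continuous_on_eq) (use u' vector_derivative_at in force)
  qed
  also have "\<dots> \<le> induced_length X \<gamma>"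
    unfolding induced_length_def u_def by (intro nn_integral_mono) (use ab in \<open>auto simp: indicator_def\<close>)
  finally show ?thesis by (simp add: u_def)
qed

text \<open>
  The immersion contracts distances in the closed coordinate ball at most by the factor \<open>c\<close>, so a path between the two
  coordinate spheres has length at least \<open>c * r / 2\<close>.
\<close>

lemma path_leaving_chart_ball:
  assumes V: "(V, \<psi>) \<in> A" and r: "cball a r \<subseteq> \<psi> ` V" "r > 0" and c: "c > 0"
    "\<And>z w. z \<in> cball a r \<Longrightarrow> w \<in> cball a r \<Longrightarrow> c * norm (z - w) \<le> norm ((X \<circ> inv_into V \<psi>) z - (X \<circ> inv_into V \<psi>) w)"
    and \<gamma>: "pw_C1_path A \<gamma>" and len: "induced_length X \<gamma> < ennreal (c * r / 2)"
  shows "\<gamma> 0 \<in> chart_ball V \<psi> a (r/2) \<Longrightarrow> \<gamma> 1 \<in> chart_ball V \<psi> a r"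
    "\<gamma> 1 \<in> chart_ball V \<psi> a (r/2) \<Longrightarrow> \<gamma> 0 \<in> chart_ball V \<psi> a r"
proof -
  have cont: "continuous_on {0..1} \<gamma>" using \<gamma> unfolding pw_C1_path_def path_def by blast
  have short: False if ab: "0 \<le> s" "s \<le> t" "t \<le> 1" "\<gamma> ` {s..t} \<subseteq> V"
    and i: "\<psi> (\<gamma> s) \<in> cball a r" "\<psi> (\<gamma> t) \<in> cball a r" "dist (\<psi> (\<gamma> s)) (\<psi> (\<gamma> t)) \<ge> r / 2" for s t
  proof -
    have st: "\<gamma> s \<in> V" "\<gamma> t \<in> V" using ab by auto
    have "c * (r / 2) \<le> c * norm (\<psi> (\<gamma> t) - \<psi> (\<gamma> s))"
      using i(3) c(1) by (intro mult_left_mono) (auto simp: dist_norm norm_minus_commute)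
    also have "\<dots> \<le> norm (X (\<gamma> t) - X (\<gamma> s))" using c(2)[OF i(2,1)] chartAD(6)[OF V] st by simp
    finally have "ennreal (c * r / 2) \<le> ennreal (norm (X (\<gamma> t) - X (\<gamma> s)))" by (intro ennreal_leI) simp
    then show False using pw_C1_length_bound[OF \<gamma> V ab] len by (meson leD order_trans)
  qed
  have sub: "chart_ball V \<psi> a (r/2) \<subseteq> chart_ball V \<psi> a r" using r(2) by (auto simp: chart_ball_def)
  show "\<gamma> 1 \<in> chart_ball V \<psi> a r" if s: "\<gamma> 0 \<in> chart_ball V \<psi> a (r/2)"
  proof (rule ccontr)
    assume n: "\<gamma> 1 \<notin> chart_ball V \<psi> a r"
    obtain b where b: "0 < b" "b \<le> 1" "\<gamma> ` {0..b} \<subseteq> V" "\<psi> ` \<gamma> ` {0..b} \<subseteq> cball a r" "dist a (\<psi> (\<gamma> b)) = r"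
      by (rule first_exit_chart_ball[OF chartA[OF V] r cont _ n]) (use s sub in auto)
    show False
    proof (rule short[of 0 b])
      show "r / 2 \<le> dist (\<psi> (\<gamma> 0)) (\<psi> (\<gamma> b))"
        using s b(5) dist_triangle[of a "\<psi> (\<gamma> b)" "\<psi> (\<gamma> 0)"] by (simp add: chart_ball_def)
    qed (use b in \<open>auto simp: image_subset_iff\<close>)
  qed
  show "\<gamma> 0 \<in> chart_ball V \<psi> a r" if s: "\<gamma> 1 \<in> chart_ball V \<psi> a (r/2)"
  proof (rule ccontr)
    assume n: "\<gamma> 0 \<notin> chart_ball V \<psi> a r"
    \<comment> \<open>Only the continuous curve is reversed; its length is measured in the original direction.\<close>
    define \<delta> where "\<delta> = (\<lambda>t. \<gamma> (1 - t))"
    have c\<delta>: "continuous_on {0..1} \<delta>" unfolding \<delta>_def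
      by (intro continuous_on_compose2[OF cont] continuous_intros) auto
    obtain b where b: "0 < b" "b \<le> 1" "\<delta> ` {0..b} \<subseteq> V" "\<psi> ` \<delta> ` {0..b} \<subseteq> cball a r" "dist a (\<psi> (\<delta> b)) = r"
      by (rule first_exit_chart_ball[OF chartA[OF V] r c\<delta>]) (use s sub n in \<open>auto simp: \<delta>_def\<close>)
    have im: "\<gamma> t = \<delta> (1 - t)" for t by (simp add: \<delta>_def)
    show False
    proof (rule short[of "1 - b" 1])
      show "\<gamma> ` {1 - b..1} \<subseteq> V" using b(3) unfolding im by force
      show "\<psi> (\<gamma> (1 - b)) \<in> cball a r" "\<psi> (\<gamma> 1) \<in> cball a r" using b(1,4) unfolding im by (auto simp: image_subset_iff)
      show "r / 2 \<le> dist (\<psi> (\<gamma> (1 - b))) (\<psi> (\<gamma> 1))"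
        using s b(5) dist_triangle[of a "\<psi> (\<gamma> (1 - b))" "\<psi> (\<gamma> 1)"] by (simp add: chart_ball_def im dist_commute)
    qed (use b in auto)
  qed
qed

text \<open>
  Convergence in the induced distance implies convergence in the topology of the surface. The statement is in terms of
  paths and allows them to be traversed from either end, since the two applications have the base point at different ends.
\<close>

lemma short_paths_stay_near:
  assumes O': "open O'" "q \<in> O'"
  obtains \<delta> N where "\<delta> > 0" "open N" "q \<in> N"
    "\<And>\<gamma>. pw_C1_path A \<gamma> \<Longrightarrow> induced_length X \<gamma> < ennreal \<delta> \<Longrightarrow> \<gamma> 0 \<in> N \<Longrightarrow> \<gamma> 1 \<in> O'"
    "\<And>\<gamma>. pw_C1_path A \<gamma> \<Longrightarrow> induced_length X \<gamma> < ennreal \<delta> \<Longrightarrow> \<gamma> 1 \<in> N \<Longrightarrow> \<gamma> 0 \<in> O'"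
proof -
  obtain V \<psi> where V: "(V, \<psi>) \<in> A" "q \<in> V" using ex_chartA by metis
  obtain c s where c: "c > 0" "s > 0" "\<And>z w. z \<in> ball (\<psi> q) s \<Longrightarrow> w \<in> ball (\<psi> q) s \<Longrightarrow>
     c * norm (z - w) \<le> norm ((X \<circ> inv_into V \<psi>) z - (X \<circ> inv_into V \<psi>) w)"
    using null_rep_lower_lipschitz[OF null_rep_A[OF V]] by blast
  obtain r' where r': "r' > 0" "ball (\<psi> q) r' \<subseteq> \<psi> ` (V \<inter> O')"
    by (rule openE[OF chart_image_Int[OF chartA[OF V(1)] O'(1)], of "\<psi> q"]) (use V O' in auto)
  define r where "r = min s r' / 2"
  have r: "r > 0" "r < s" "r < r'" using c r' by (auto simp: r_def)
  have "cball (\<psi> q) r \<subseteq> ball (\<psi> q) r'" using r by auto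
  then have sub: "cball (\<psi> q) r \<subseteq> \<psi> ` V" using r'(2) by blast
  have lip: "c * norm (z - w) \<le> norm ((X \<circ> inv_into V \<psi>) z - (X \<circ> inv_into V \<psi>) w)"
    if "z \<in> cball (\<psi> q) r" "w \<in> cball (\<psi> q) r" for z w using that r by (intro c(3)) auto
  have cb: "chart_ball V \<psi> (\<psi> q) r \<subseteq> O'"
  proof
    fix p assume "p \<in> chart_ball V \<psi> (\<psi> q) r"
    then have p: "p \<in> V" "\<psi> p \<in> ball (\<psi> q) r'" using r by (auto simp: chart_ball_def)
    then obtain p' where "p' \<in> V" "p' \<in> O'" "\<psi> p = \<psi> p'" using r'(2) by blast
    then show "p \<in> O'" using p(1) chartAD(3)[OF V(1)] by (simp add: inj_on_eq_iff)
  qed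
  note L = path_leaving_chart_ball[OF V(1) sub r(1) c(1) lip]
  show thesis
  proof (rule that[of "c * r / 2" "chart_ball V \<psi> (\<psi> q) (r/2)"])
    show "open (chart_ball V \<psi> (\<psi> q) (r/2))" unfolding chart_ball_def by (rule chart_preimage[OF chartA[OF V(1)] open_ball])
    show "q \<in> chart_ball V \<psi> (\<psi> q) (r/2)" using V r by (simp add: chart_ball_def)
  qed (use L cb c r in \<open>auto\<close>)
qed

end

section \<open>Radii of finite length converge\<close>

text \<open>
  The exponent \<open>-30/31\<close> is integrable up to the boundary. The case \<open>s2 < s1\<close> is included because Cauchy
  sequences compare points in both orders.
\<close>

lemma power_integral_bound:
  fixes g :: "real \<Rightarrow> real"
  assumes s: "0 \<le> s1" "s1 < 1" "0 \<le> s2" "s2 < 1" and K: "K \<ge> 0"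
    and g: "\<And>t. 0 \<le> t \<Longrightarrow> t \<le> 1 \<Longrightarrow> g t \<le> K * \<bar>s2 - s1\<bar> * (1 - (s1 + t * (s2 - s1))) powr (-30/31)"
  shows "(\<integral>\<^sup>+t\<in>{0..1}. ennreal (g t) \<partial>lborel) \<le> ennreal (31 * K * (1 - min s1 s2) powr (1/31))"
proof -
  \<comment> \<open>The sign makes the antiderivative increasing whichever of the two parameters is larger.\<close>
  define \<sigma> :: real where "\<sigma> = (if s1 \<le> s2 then 1 else -1)"
  have \<sigma>: "\<bar>s2 - s1\<bar> = \<sigma> * (s2 - s1)" by (auto simp: \<sigma>_def)
  define f where "f = (\<lambda>t. K * \<bar>s2 - s1\<bar> * (1 - (s1 + t * (s2 - s1))) powr (-30/31))"
  define F where "F = (\<lambda>t. - (31 * K * \<sigma> * (1 - (s1 + t * (s2 - s1))) powr (1/31)))"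
  have pos: "1 - (s1 + t * (s2 - s1)) > 0" if t: "0 \<le> t" "t \<le> 1" for t
  proof -
    have "s1 + t * (s2 - s1) = (1 - t) * s1 + t * s2" by (simp add: algebra_simps)
    also have "\<dots> \<le> (1 - t) * max s1 s2 + t * max s1 s2" using t by (intro add_mono mult_left_mono) auto
    also have "\<dots> = max s1 s2" by (simp add: algebra_simps)
    also have "\<dots> < 1" using s by simp
    finally show ?thesis by simp
  qed
  have der: "(F has_real_derivative f t) (at t)" if t: "0 \<le> t" "t \<le> 1" for t
  proof -
    have "(F has_real_derivative - (31 * K * \<sigma> * ((1/31) * (1 - (s1 + t * (s2 - s1))) powr (1/31 - 1) * (- (s2 - s1))))) (at t)"
      unfolding F_def using pos[OF t] by (auto intro!: derivative_eq_intros)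
    moreover have "- (31 * K * \<sigma> * ((1/31) * (1 - (s1 + t * (s2 - s1))) powr (1/31 - 1) * (- (s2 - s1)))) = f t"
      unfolding f_def \<sigma> by (simp add: field_simps)
    ultimately show ?thesis by (simp only:)
  qed
  have "(\<integral>\<^sup>+t\<in>{0..1}. ennreal (g t) \<partial>lborel) \<le> (\<integral>\<^sup>+t. ennreal (f t) * indicator {0..1} t \<partial>lborel)"
    using g by (intro nn_integral_mono) (auto simp: indicator_def f_def intro!: ennreal_leI)
  also have "\<dots> = ennreal (F 1 - F 0)"
    by (rule nn_integral_FTC_Icc) (use der K in \<open>auto simp: f_def\<close>)
  also have "\<dots> \<le> ennreal (31 * K * (1 - min s1 s2) powr (1/31))"
  proof (rule ennreal_leI)
    have "F 1 - F 0 = 31 * K * (\<sigma> * ((1 - s1) powr (1/31) - (1 - s2) powr (1/31)))"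
      by (simp add: F_def algebra_simps)
    also have "\<dots> \<le> 31 * K * (1 - min s1 s2) powr (1/31)"
      using K by (intro mult_left_mono) (auto simp: \<sigma>_def min_def)
    finally show "F 1 - F 0 \<le> 31 * K * (1 - min s1 s2) powr (1/31)" .
  qed
  finally show ?thesis .
qed

lemma continuously_differentiable_piecewise_C1:
  fixes f :: "real \<Rightarrow> 'v::real_normed_vector"
  assumes "\<And>t0. t0 \<in> S \<Longrightarrow> \<exists>T D. open T \<and> t0 \<in> T \<and> (\<forall>t\<in>T. (f has_vector_derivative D t) (at t)) \<and> continuous_on T D"
  shows "f piecewise_C1_differentiable_on S"
proof (rule C1_differentiable_imp_piecewise)
  have "f differentiable at t \<and> isCont (\<lambda>x. vector_derivative f (at x)) t" if t: "t \<in> S" for t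
  proof -
    obtain T D where T: "open T" "t \<in> T" "\<And>s. s \<in> T \<Longrightarrow> (f has_vector_derivative D s) (at s)" "continuous_on T D"
      using assms[OF t] by blast
    have "continuous_on T (\<lambda>x. vector_derivative f (at x))"
      by (rule continuous_on_eq[OF T(4)]) (simp add: vector_derivative_at[OF T(3)])
    then show ?thesis using T differentiableI_vector[OF T(3)[OF T(2)]] by (simp add: continuous_on_eq_continuous_at)
  qed
  then show "f C1_differentiable_on S" unfolding C1_differentiable_on_eq by (auto intro: continuous_at_imp_continuous_on)
qed

lemma holomorphic_along_line:
  assumes k: "k holomorphic_on \<Omega>" "open \<Omega>" and t0: "a + of_real t0 * b \<in> \<Omega>"
  shows "\<exists>T D. open T \<and> t0 \<in> T \<and> (\<forall>t\<in>T. a + of_real t * b \<in> \<Omega>) \<and>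
     (\<forall>t\<in>T. ((\<lambda>t. k (a + of_real t * b)) has_vector_derivative D t) (at t)) \<and> continuous_on T D"
proof -
  define T where "T = (\<lambda>t::real. a + of_real t * b) -` \<Omega>"
  have cl: "continuous_on UNIV (\<lambda>t::real. a + of_real t * b)" by (intro continuous_intros)
  have T: "open T" unfolding T_def by (rule open_vimage[OF k(2) cl])
  have d: "((\<lambda>t. k (a + of_real t * b)) has_vector_derivative b * deriv k (a + of_real t * b)) (at t)" if "t \<in> T" for t
  proof -
    have "((\<lambda>t. a + of_real t * b) has_vector_derivative b) (at t)"
      by (auto intro!: derivative_eq_intros)
    moreover have "(k has_field_derivative deriv k (a + of_real t * b)) (at (a + of_real t * b))"
      using that by (intro holomorphic_derivI[OF k]) (simp add: T_def)
    ultimately show ?thesis using field_vector_diff_chain_at[of "\<lambda>t. a + of_real t * b" b t k] by (simp add: o_def)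
  qed
  have "continuous_on T (\<lambda>t. b * deriv k (a + of_real t * b))"
    by (intro continuous_intros continuous_on_compose2[OF holomorphic_on_imp_continuous_on[OF holomorphic_deriv[OF k]]])
       (auto simp: T_def)
  then show ?thesis using T t0 d unfolding T_def
    by (intro exI[of _ T] exI[of _ "\<lambda>t. b * deriv k (a + of_real t * b)"]) (auto simp: T_def)
qed

context double_cover
begin

lemma disc_path_piecewise_C1:
  assumes \<Phi>: "hol_disc B \<Phi> R" and line: "\<And>t. t \<in> {0..1} \<Longrightarrow> a + of_real t * b \<in> ball 0 R"
  shows "pw_C1_path A (\<lambda>t. \<pi> (\<Phi> (a + of_real t * b)))"
proof -
  let ?\<gamma> = "\<lambda>t. \<pi> (\<Phi> (a + of_real t * b))"
  have c\<Phi>: "continuous_on (ball 0 R) \<Phi>" using \<Phi> unfolding hol_disc_def by blast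
  have "continuous_on {0..1} (\<lambda>t. \<Phi> (a + of_real t * b))"
    by (rule continuous_on_compose2[OF c\<Phi>]) (use line in \<open>auto intro!: continuous_intros\<close>)
  then have "continuous_on {0..1} ?\<gamma>"
    by (intro continuous_on_compose2[OF \<pi>_continuous]) auto
  then have "path ?\<gamma>" by (simp add: path_def)
  moreover have "(\<psi> \<circ> ?\<gamma>) piecewise_C1_differentiable_on {s..s'}"
    if V: "(V, \<psi>) \<in> A" and s: "0 \<le> s" "s \<le> s'" "s' \<le> 1" "?\<gamma> ` {s..s'} \<subseteq> V" for V \<psi> s s'
  proof (rule continuously_differentiable_piecewise_C1)
    fix t0 assume t0: "t0 \<in> {s..s'}"
    let ?w = "a + of_real t0 * b"
    have w: "?w \<in> ball 0 R" using line t0 s by simp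
    have wV: "\<pi> (\<Phi> ?w) \<in> V" using s(4) t0 by blast
    obtain U \<phi> where U: "(U, \<phi>) \<in> B" "\<Phi> ?w \<in> U" using ex_chart by metis
    define \<tau> where "\<tau> = \<psi> \<circ> \<pi> \<circ> inv_into U \<phi>"
    obtain N where N: "open N" "\<phi> (\<Phi> ?w) \<in> N" "N \<subseteq> \<phi> ` (U \<inter> \<pi> -` V)" "inj_on \<tau> N"
      "\<tau> holomorphic_on N \<or> (cnj \<circ> \<tau>) holomorphic_on N"
      by (rule \<pi>_local[OF U V wV, folded \<tau>_def]) (rule that)
    have k: "(\<phi> \<circ> \<Phi>) holomorphic_on (ball 0 R \<inter> \<Phi> -` U)" using \<Phi> U(1) unfolding hol_disc_def by blast
    define \<Omega> where "\<Omega> = (ball 0 R \<inter> \<Phi> -` U) \<inter> (\<phi> \<circ> \<Phi>) -` N"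
    have o\<Omega>: "open \<Omega>" unfolding \<Omega>_def
      by (intro continuous_open_preimage holomorphic_on_imp_continuous_on k disc_chart_deriv(1)[OF \<Phi> w U] N)
    have w\<Omega>: "?w \<in> \<Omega>" using w U N by (simp add: \<Omega>_def)
    have k\<Omega>: "(\<phi> \<circ> \<Phi>) holomorphic_on \<Omega>" by (rule holomorphic_on_subset[OF k]) (auto simp: \<Omega>_def)
    have im: "(\<phi> \<circ> \<Phi>) ` \<Omega> \<subseteq> N" by (auto simp: \<Omega>_def)
    have eq: "\<psi> (\<pi> (\<Phi> w)) = \<tau> ((\<phi> \<circ> \<Phi>) w)" if "w \<in> \<Omega>" for w
      using that chartD(6)[OF U(1)] by (simp add: \<tau>_def \<Omega>_def)
    show "\<exists>T D. open T \<and> t0 \<in> T \<and> (\<forall>t\<in>T. (\<psi> \<circ> ?\<gamma> has_vector_derivative D t) (at t)) \<and> continuous_on T D"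
    proof (cases "\<tau> holomorphic_on N")
      case True
      have "(\<tau> \<circ> (\<phi> \<circ> \<Phi>)) holomorphic_on \<Omega>" by (rule holomorphic_on_compose_gen[OF k\<Omega> True im])
      from holomorphic_along_line[OF this o\<Omega> w\<Omega>] obtain T D where T: "open T" "t0 \<in> T" "\<And>t. t\<in>T \<Longrightarrow> a + of_real t * b \<in> \<Omega>"
        "\<And>t. t\<in>T \<Longrightarrow> ((\<lambda>t. (\<tau> \<circ> (\<phi> \<circ> \<Phi>)) (a + of_real t * b)) has_vector_derivative D t) (at t)" "continuous_on T D" by blast
      have "(\<psi> \<circ> ?\<gamma> has_vector_derivative D t) (at t)" if "t \<in> T" for t
        by (rule has_vector_derivative_transform_within_open[OF T(4)[OF that] T(1) that]) (use T(3) eq in auto)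
      then show ?thesis using T by blast
    next
      case False
      then have h: "(cnj \<circ> \<tau>) holomorphic_on N" using N by blast
      have "((cnj \<circ> \<tau>) \<circ> (\<phi> \<circ> \<Phi>)) holomorphic_on \<Omega>" by (rule holomorphic_on_compose_gen[OF k\<Omega> h im])
      from holomorphic_along_line[OF this o\<Omega> w\<Omega>] obtain T D where T: "open T" "t0 \<in> T" "\<And>t. t\<in>T \<Longrightarrow> a + of_real t * b \<in> \<Omega>"
        "\<And>t. t\<in>T \<Longrightarrow> ((\<lambda>t. ((cnj \<circ> \<tau>) \<circ> (\<phi> \<circ> \<Phi>)) (a + of_real t * b)) has_vector_derivative D t) (at t)" "continuous_on T D" by blast
      have "(\<psi> \<circ> ?\<gamma> has_vector_derivative cnj (D t)) (at t)" if "t \<in> T" for t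
        by (rule has_vector_derivative_transform_within_open[OF has_vector_derivative_cnj[OF T(4)[OF that]] T(1) that])
           (use T(3) eq in auto)
      moreover have "continuous_on T (\<lambda>t. cnj (D t))" using T(5) by (intro continuous_intros)
      ultimately show ?thesis using T(1,2) by (intro exI[of _ T] exI[of _ "\<lambda>t. cnj (D t)"] conjI ballI)
    qed
  qed
  ultimately show ?thesis unfolding pw_C1_path_def by blast
qed

lemma disc_path_speed:
  assumes \<Phi>: "hol_disc B \<Phi> R" and w: "a + of_real t * b \<in> ball 0 R" and U: "(U, \<phi>) \<in> B" "\<Phi> (a + of_real t * b) \<in> U"
    and K: "\<And>i. norm (form_coeff Y U \<phi> i (\<phi> (\<Phi> (a + of_real t * b))) * deriv (\<phi> \<circ> \<Phi>) (a + of_real t * b)) \<le> K"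
  shows "norm (vector_derivative (X \<circ> (\<lambda>t. \<pi> (\<Phi> (a + of_real t * b)))) (at t)) \<le> 8 * K * norm b"
proof -
  let ?w = "a + of_real t * b"
  define q where "q = (\<lambda>i. 2 * form_coeff Y U \<phi> i (\<phi> (\<Phi> ?w)) * deriv (\<phi> \<circ> \<Phi>) ?w)"
  have l: "((\<lambda>t. a + of_real t * b) has_derivative (\<lambda>h. of_real h * b)) (at t)"
    by (auto intro!: derivative_eq_intros)
  have D: "((\<lambda>t. Y (\<Phi> (a + of_real t * b)) $ i) has_derivative (\<lambda>h. Re (q i * (of_real h * b)))) (at t)" for i
    using has_derivative_compose[OF l disc_derivative[OF \<Phi> w U]] by (simp add: q_def)
  have "((\<lambda>t. Y (\<Phi> (a + of_real t * b))) has_derivative (\<lambda>h. \<chi> i. Re (q i * (of_real h * b)))) (at t)"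
    by (subst has_derivative_componentwise_within)
       (use D in \<open>auto simp: Basis_vec_def inner_axis cart_eq_inner_axis[symmetric] simp del: times_complex.simps\<close>)
  moreover have "(\<lambda>h. \<chi> i. Re (q i * (of_real h * b))) = (\<lambda>h. h *\<^sub>R (\<chi> i. Re (q i * b)))"
    by (intro ext) (simp add: vec_eq_iff algebra_simps)
  ultimately have "((X \<circ> (\<lambda>t. \<pi> (\<Phi> (a + of_real t * b)))) has_vector_derivative (\<chi> i. Re (q i * b))) (at t)"
    by (simp add: has_vector_derivative_def o_def)
  then have "vector_derivative (X \<circ> (\<lambda>t. \<pi> (\<Phi> (a + of_real t * b)))) (at t) = (\<chi> i. Re (q i * b))"
    by (rule vector_derivative_at)
  moreover have "norm (\<chi> i. Re (q i * b)) \<le> (\<Sum>i\<in>UNIV. \<bar>(\<chi> i. Re (q i * b)) $ i\<bar>)" by (rule norm_le_l1_cart)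
  moreover have "(\<Sum>i\<in>UNIV. \<bar>(\<chi> i. Re (q i * b)) $ i\<bar>) \<le> (\<Sum>i\<in>(UNIV :: 4 set). 2 * K * norm b)"
  proof (rule sum_mono)
    fix i :: 4
    have "\<bar>Re (q i * b)\<bar> \<le> norm (q i * b)" by (rule abs_Re_le_cmod)
    also have "\<dots> = 2 * norm (form_coeff Y U \<phi> i (\<phi> (\<Phi> ?w)) * deriv (\<phi> \<circ> \<Phi>) ?w) * norm b"
      by (simp add: q_def norm_mult)
    also have "\<dots> \<le> 2 * K * norm b" by (intro mult_right_mono mult_left_mono K) auto
    finally show "\<bar>(\<chi> i. Re (q i * b)) $ i\<bar> \<le> 2 * K * norm b" by (simp only: vec_lambda_beta)
  qed
  ultimately show ?thesis by simp
qed

lemma ray_length: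
  assumes \<Phi>: "hol_disc B \<Phi> R" and R: "R > 0" "norm \<zeta> = R"
    and K: "\<And>w U \<phi> i. norm w < R \<Longrightarrow> (U, \<phi>) \<in> B \<Longrightarrow> \<Phi> w \<in> U \<Longrightarrow>
       norm (form_coeff Y U \<phi> i (\<phi> (\<Phi> w)) * deriv (\<phi> \<circ> \<Phi>) w) \<le> K * (R - norm w) powr (-30/31)"
  obtains C where "C \<ge> 0" "\<And>s1 s2. 0 \<le> s1 \<Longrightarrow> s1 < 1 \<Longrightarrow> 0 \<le> s2 \<Longrightarrow> s2 < 1 \<Longrightarrow>
    pw_C1_path A (\<lambda>t. \<pi> (\<Phi> (of_real s1 * \<zeta> + of_real t * (of_real (s2 - s1) * \<zeta>)))) \<and>
    induced_length X (\<lambda>t. \<pi> (\<Phi> (of_real s1 * \<zeta> + of_real t * (of_real (s2 - s1) * \<zeta>))))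
      \<le> ennreal (C * (1 - min s1 s2) powr (1/31))"
proof -
  define K' where "K' = 8 * K * R powr (-30/31) * R"
  have K0: "K \<ge> 0"
  proof -
    obtain U \<phi> where U: "(U, \<phi>) \<in> B" "\<Phi> 0 \<in> U" using ex_chart by metis
    have "0 \<le> K * (R - norm (0::complex)) powr (-30/31)" by (rule order_trans[OF norm_ge_zero K[OF _ U]]) (use R in auto)
    then show ?thesis using R(1) by (simp add: zero_le_mult_iff)
  qed
  then have K'0: "K' \<ge> 0" using R(1) by (simp add: K'_def)
  show thesis
  proof (rule that[of "31 * K'"])
    show "31 * K' \<ge> 0" using K'0 by simp
    fix s1 s2 :: real assume s: "0 \<le> s1" "s1 < 1" "0 \<le> s2" "s2 < 1"
    let ?a = "of_real s1 * \<zeta>" and ?b = "of_real (s2 - s1) * \<zeta>"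
    let ?\<gamma> = "\<lambda>t. \<pi> (\<Phi> (?a + of_real t * ?b))"
    have S: "0 \<le> s1 + t * (s2 - s1) \<and> s1 + t * (s2 - s1) < 1" if t: "t \<in> {0..1}" for t
    proof -
      have e: "s1 + t * (s2 - s1) = (1 - t) * s1 + t * s2" by (simp add: algebra_simps)
      have "(1 - t) * s1 + t * s2 \<le> (1 - t) * max s1 s2 + t * max s1 s2" using t by (intro add_mono mult_left_mono) auto
      also have "\<dots> = max s1 s2" by (simp add: algebra_simps)
      also have "\<dots> < 1" using s by simp
      finally show ?thesis using t s unfolding e by simp
    qed
    have nl: "norm (?a + of_real t * ?b) = (s1 + t * (s2 - s1)) * R" if t: "t \<in> {0..1}" for t
    proof -
      have "?a + of_real t * ?b = of_real (s1 + t * (s2 - s1)) * \<zeta>" by (simp add: algebra_simps)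
      then have "norm (?a + of_real t * ?b) = \<bar>s1 + t * (s2 - s1)\<bar> * R" by (simp only: norm_mult norm_of_real R(2))
      then show ?thesis using S[OF t] by simp
    qed
    have inb: "?a + of_real t * ?b \<in> ball 0 R" if t: "t \<in> {0..1}" for t
      unfolding mem_ball_0 nl[OF t] using S[OF t] R(1) by simp
    have p: "pw_C1_path A ?\<gamma>" by (rule disc_path_piecewise_C1[OF \<Phi> inb])
    have "induced_length X ?\<gamma> \<le> ennreal (31 * K' * (1 - min s1 s2) powr (1/31))"
      unfolding induced_length_def
    proof (rule power_integral_bound[OF s K'0])
      fix t :: real assume "0 \<le> t" "t \<le> 1"
      then have t: "t \<in> {0..1}" by simp
      let ?w = "?a + of_real t * ?b"
      obtain U \<phi> where U: "(U, \<phi>) \<in> B" "\<Phi> ?w \<in> U" using ex_chart by metis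
      have "norm (vector_derivative (X \<circ> ?\<gamma>) (at t)) \<le> 8 * (K * (R - norm ?w) powr (-30/31)) * norm ?b"
        by (rule disc_path_speed[OF \<Phi> inb[OF t] U K[OF _ U]]) (use inb[OF t] in simp)
      also have "R - norm ?w = R * (1 - (s1 + t * (s2 - s1)))" unfolding nl[OF t] by (simp add: algebra_simps)
      also have "(R * (1 - (s1 + t * (s2 - s1)))) powr (-30/31) = R powr (-30/31) * (1 - (s1 + t * (s2 - s1))) powr (-30/31)"
        by (rule powr_mult)
      also have "norm ?b = \<bar>s2 - s1\<bar> * R" by (simp only: norm_mult norm_of_real R(2))
      also have "8 * (K * (R powr (-30/31) * (1 - (s1 + t * (s2 - s1))) powr (-30/31))) * (\<bar>s2 - s1\<bar> * R)
          = K' * \<bar>s2 - s1\<bar> * (1 - (s1 + t * (s2 - s1))) powr (-30/31)"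
        by (simp add: K'_def mult_ac)
      finally show "norm (vector_derivative (X \<circ> ?\<gamma>) (at t)) \<le> K' * \<bar>s2 - s1\<bar> * (1 - (s1 + t * (s2 - s1))) powr (-30/31)" .
    qed
    then show "pw_C1_path A ?\<gamma> \<and> induced_length X ?\<gamma> \<le> ennreal (31 * K' * (1 - min s1 s2) powr (1/31))"
      using p by blast
  qed
qed

text \<open>
  Near \<open>q\<close> the covering is trivial and the end of the curve, being connected, stays in one sheet.
\<close>

lemma lift_limit:
  fixes c :: "real \<Rightarrow> 'b"
  assumes c: "continuous_on {0<..<1} c" and lim: "((\<lambda>t. \<pi> (c t)) \<longlongrightarrow> q) (at_left 1)"
  shows "\<exists>p. (c \<longlongrightarrow> p) (at_left 1)"
proof -
  have "\<forall>q\<in>UNIV. \<exists>T. q \<in> T \<and> openin (top_of_set UNIV) T \<and> (\<exists>v. \<Union>v = UNIV \<inter> \<pi> -` T \<and> (\<forall>u\<in>v. openin (top_of_set UNIV) u) \<and>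
      pairwise disjnt v \<and> (\<forall>u\<in>v. \<exists>r. homeomorphism u T \<pi> r))"
    using covering unfolding covering_space_def by (elim conjE)
  from bspec[OF this UNIV_I, of q] obtain T v where "q \<in> T" "openin (top_of_set UNIV) T"
    and v': "\<Union>v = UNIV \<inter> \<pi> -` T" "\<forall>u\<in>v. openin (top_of_set UNIV) u" "pairwise disjnt v"
      "\<forall>u\<in>v. \<exists>r. homeomorphism u T \<pi> r" by (elim exE conjE)
  then have T: "q \<in> T" "open T" by auto
  have v: "\<Union>v = \<pi> -` T" "\<And>u. u \<in> v \<Longrightarrow> open u" "pairwise disjnt v"
      "\<And>u. u \<in> v \<Longrightarrow> \<exists>r. homeomorphism u T \<pi> r" using v' by simp_all
  have "\<forall>\<^sub>F t in at_left 1. \<pi> (c t) \<in> T" by (rule topological_tendstoD[OF lim T(2,1)])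
  then obtain b' where b': "b' < 1" "\<And>t. b' < t \<Longrightarrow> t < 1 \<Longrightarrow> \<pi> (c t) \<in> T"
    unfolding eventually_at_left_field by blast
  define b where "b = max b' 0"
  have b: "b < 1" "b \<ge> 0" using b' by (auto simp: b_def)
  have inT: "\<pi> (c t) \<in> T" if "t \<in> {b<..<1}" for t using that b' by (auto simp: b_def)
  define C where "C = c ` {b<..<1}"
  have "connected C" unfolding C_def
    by (intro connected_continuous_image continuous_on_subset[OF c]) (use b in auto)
  define t0 where "t0 = (b + 1) / 2"
  have t0: "t0 \<in> {b<..<1}" using b by (auto simp: t0_def)
  then have "c t0 \<in> \<Union>v" using inT v(1) by auto
  then obtain u where u: "u \<in> v" "c t0 \<in> u" by blast
  have "C \<subseteq> u"
  proof (rule ccontr)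
    assume "\<not> C \<subseteq> u"
    moreover have "C \<subseteq> \<Union>v" using inT v(1) unfolding C_def by auto
    ultimately have ne: "\<Union>(v - {u}) \<inter> C \<noteq> {}" and sub: "C \<subseteq> u \<union> \<Union>(v - {u})" by blast+
    have "u \<inter> \<Union>(v - {u}) = {}" using v(3) u(1) unfolding pairwise_def disjnt_def by blast
    then have "u \<inter> \<Union>(v - {u}) \<inter> C = {}" by simp
    moreover have "open u" "open (\<Union>(v - {u}))" using v(2) u(1) by auto
    moreover have "c t0 \<in> u \<inter> C" using u(2) t0 unfolding C_def by blast
    then have "u \<inter> C \<noteq> {}" by blast
    ultimately show False using connectedD[OF \<open>connected C\<close>, of u "\<Union>(v - {u})"] ne sub by blast
  qed
  obtain r where r: "homeomorphism u T \<pi> r" using v(4)[OF u(1)] by blast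
  have "isCont r q" using r T unfolding homeomorphism_def by (simp add: continuous_on_eq_continuous_at)
  then have "((\<lambda>t. r (\<pi> (c t))) \<longlongrightarrow> r q) (at_left 1)" using lim by (rule isCont_tendsto_compose)
  moreover have "\<forall>\<^sub>F t in at_left 1. r (\<pi> (c t)) = c t"
  proof -
    have "r (\<pi> (c t)) = c t" if "t \<in> {b<..<1}" for t
      using r \<open>C \<subseteq> u\<close> that unfolding homeomorphism_def C_def by blast
    then show ?thesis using b(1) by (intro eventually_at_leftI[of b]) auto
  qed
  ultimately have "(c \<longlongrightarrow> r q) (at_left 1)" by (rule Lim_transform_eventually)
  then show ?thesis by blast
qed

text \<open>
  Finite length makes points on the radius a Cauchy sequence for the induced distance. Completeness gives a
  limit on the nonorientable surface, short tails keep the whole radius near it, and the limit lifts to the cover.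
\<close>

lemma ray_limit:
  assumes \<Phi>: "hol_disc B \<Phi> R" and R: "R > 0" "norm \<zeta> = R"
    and K: "\<And>w U \<phi> i. norm w < R \<Longrightarrow> (U, \<phi>) \<in> B \<Longrightarrow> \<Phi> w \<in> U \<Longrightarrow>
       norm (form_coeff Y U \<phi> i (\<phi> (\<Phi> w)) * deriv (\<phi> \<circ> \<Phi>) w) \<le> K * (R - norm w) powr (-30/31)"
  shows "\<exists>p. ((\<lambda>t. \<Phi> (of_real t * \<zeta>)) \<longlongrightarrow> p) (at_left 1)"
proof -
  define \<gamma> where "\<gamma> = (\<lambda>s1 s2 t. \<pi> (\<Phi> (of_real s1 * \<zeta> + of_real t * (of_real (s2 - s1) * \<zeta>))))"
  obtain C where C0: "C \<ge> 0" "\<And>s1 s2. 0 \<le> s1 \<Longrightarrow> s1 < 1 \<Longrightarrow> 0 \<le> s2 \<Longrightarrow> s2 < 1 \<Longrightarrow>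
    pw_C1_path A (\<lambda>t. \<pi> (\<Phi> (of_real s1 * \<zeta> + of_real t * (of_real (s2 - s1) * \<zeta>)))) \<and>
    induced_length X (\<lambda>t. \<pi> (\<Phi> (of_real s1 * \<zeta> + of_real t * (of_real (s2 - s1) * \<zeta>))))
      \<le> ennreal (C * (1 - min s1 s2) powr (1/31))"
    by (rule ray_length[OF \<Phi> R K]) (assumption | rule that)+
  have C: "C \<ge> 0" "\<And>s1 s2. 0 \<le> s1 \<Longrightarrow> s1 < 1 \<Longrightarrow> 0 \<le> s2 \<Longrightarrow> s2 < 1 \<Longrightarrow> pw_C1_path A (\<gamma> s1 s2) \<and>
    induced_length X (\<gamma> s1 s2) \<le> ennreal (C * (1 - min s1 s2) powr (1/31))"
    unfolding \<gamma>_def by (rule C0)+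
  have \<gamma>0: "\<gamma> s1 s2 0 = \<pi> (\<Phi> (of_real s1 * \<zeta>))" and \<gamma>1: "\<gamma> s1 s2 1 = \<pi> (\<Phi> (of_real s2 * \<zeta>))" for s1 s2
    by (simp_all add: \<gamma>_def algebra_simps)
  have small: "\<exists>b<1. b \<ge> 0 \<and> (\<forall>s. b \<le> s \<longrightarrow> s < 1 \<longrightarrow> C * (1 - s) powr (1/31) < e)" if e: "e > 0" for e
  proof -
    have "((\<lambda>s. (1 - s) powr (1/31)) \<longlongrightarrow> 0) (at_left (1::real))"
    proof (rule tendsto_zero_powrI)
      show "((\<lambda>s::real. 1 - s) \<longlongrightarrow> 0) (at_left 1)" by (auto intro!: tendsto_eq_intros)
      show "\<forall>\<^sub>F x in at_left 1. 0 \<le> 1 - (x::real)" by (intro eventually_at_leftI[of 0]) auto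
      show "((\<lambda>x. 1/31) \<longlongrightarrow> (1/31::real)) (at_left (1::real))" by simp
    qed simp
    from tendsto_mult_right_zero[OF this, of C]
    have "((\<lambda>s. C * (1 - s) powr (1/31)) \<longlongrightarrow> 0) (at_left (1::real))" by simp
    then have "\<forall>\<^sub>F s in at_left (1::real). C * (1 - s) powr (1/31) < e" using e by (intro order_tendstoD) auto
    then obtain b where b: "b < 1" "\<And>s. b < s \<Longrightarrow> s < 1 \<Longrightarrow> C * (1 - s) powr (1/31) < e"
      unfolding eventually_at_left_field by blast
    show ?thesis using b by (intro exI[of _ "(max b 0 + 1) / 2"]) auto
  qed
  define s where "s = (\<lambda>n::nat. 1 - 1 / (real n + 2))"
  have s: "0 \<le> s n" "s n < 1" for n by (auto simp: s_def field_simps)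
  have slim: "\<exists>N. \<forall>n\<ge>N. b \<le> s n" if "b < 1" for b
  proof -
    obtain N where N: "1 / (1 - b) < real N" using reals_Archimedean2[of "1 / (1 - b)"] ..
    have "b \<le> s n" if "n \<ge> N" for n
    proof -
      have "1 / (1 - b) \<le> real n + 2" using N that by simp
      then have "1 / (real n + 2) \<le> 1 - b" using \<open>b < 1\<close> by (simp add: field_simps)
      then show ?thesis by (simp add: s_def)
    qed
    then show ?thesis by blast
  qed
  define x where "x = (\<lambda>n. \<pi> (\<Phi> (of_real (s n) * \<zeta>)))"
  have "\<forall>e>0. \<exists>N. \<forall>m\<ge>N. \<forall>n\<ge>N. induced_dist A X (x m) (x n) < e"
  proof (intro allI impI)
    fix e :: ennreal assume "e > 0"
    have "\<exists>e'>0. ennreal e' \<le> e"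
    proof (cases e)
      case (real r)
      then show ?thesis using \<open>e > 0\<close> by (intro exI[of _ r]) (auto simp: less_le)
    qed (auto intro!: exI[of _ 1])
    then obtain e' where e': "e' > 0" "ennreal e' \<le> e" by blast
    obtain b where b: "b < 1" "b \<ge> 0" "\<And>s. b \<le> s \<Longrightarrow> s < 1 \<Longrightarrow> C * (1 - s) powr (1/31) < e'" using small[OF e'(1)] by blast
    obtain N where N: "\<And>n. n \<ge> N \<Longrightarrow> b \<le> s n" using slim[OF b(1)] by blast
    have "induced_dist A X (x m) (x n) < e" if "m \<ge> N" "n \<ge> N" for m n
    proof -
      have "induced_dist A X (x m) (x n) \<le> induced_length X (\<gamma> (s m) (s n))"
        unfolding induced_dist_def
        by (rule INF_lower) (use C(2)[of "s m" "s n"] s in \<open>simp add: pathstart_def pathfinish_def \<gamma>0 \<gamma>1 x_def\<close>)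
      also have "\<dots> \<le> ennreal (C * (1 - min (s m) (s n)) powr (1/31))" using C(2) s by blast
      also have "\<dots> < ennreal e'"
        using b(3)[of "min (s m) (s n)"] N[OF that(1)] N[OF that(2)] s[of m] s[of n] by (intro ennreal_lessI e') linarith
      finally show ?thesis using e'(2) by order
    qed
    then show "\<exists>N. \<forall>m\<ge>N. \<forall>n\<ge>N. induced_dist A X (x m) (x n) < e" by blast
  qed
  then obtain q where q: "(\<lambda>n. induced_dist A X (x n) q) \<longlonglongrightarrow> 0"
    using complete unfolding complete_immersion_def by blast
  have "((\<lambda>t. \<pi> (\<Phi> (of_real t * \<zeta>))) \<longlongrightarrow> q) (at_left 1)"
  proof (rule topological_tendstoI)
    fix O' assume O': "open O'" "q \<in> O'"
    obtain \<delta>1 N1 where 1: "\<delta>1 > 0" "open N1" "q \<in> N1"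
      "\<And>\<gamma>. pw_C1_path A \<gamma> \<Longrightarrow> induced_length X \<gamma> < ennreal \<delta>1 \<Longrightarrow> \<gamma> 0 \<in> N1 \<Longrightarrow> \<gamma> 1 \<in> O'"
      using short_paths_stay_near[OF O'] by metis
    obtain \<delta>2 N2 where 2: "\<delta>2 > 0" "open N2" "q \<in> N2"
      "\<And>\<gamma>. pw_C1_path A \<gamma> \<Longrightarrow> induced_length X \<gamma> < ennreal \<delta>2 \<Longrightarrow> \<gamma> 1 \<in> N2 \<Longrightarrow> \<gamma> 0 \<in> N1"
      using short_paths_stay_near[OF 1(2,3)] by metis
    obtain b where b: "b < 1" "b \<ge> 0" "\<And>s. b \<le> s \<Longrightarrow> s < 1 \<Longrightarrow> C * (1 - s) powr (1/31) < \<delta>1" using small[OF 1(1)] by blast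
    obtain N where N: "\<And>n. n \<ge> N \<Longrightarrow> b \<le> s n" using slim[OF b(1)] by blast
    have "\<forall>\<^sub>F n in sequentially. induced_dist A X (x n) q < ennreal \<delta>2"
      using q 2(1) by (intro order_tendstoD) auto
    then have "\<forall>\<^sub>F n in sequentially. induced_dist A X (x n) q < ennreal \<delta>2 \<and> n \<ge> N"
      using eventually_ge_at_top[of N] by (rule eventually_conj)
    then obtain n where n: "induced_dist A X (x n) q < ennreal \<delta>2" "n \<ge> N"
      by (metis (no_types, lifting) eventually_happens trivial_limit_sequentially)
    then obtain \<beta> where \<beta>: "pw_C1_path A \<beta>" "\<beta> 0 = x n" "\<beta> 1 = q" "induced_length X \<beta> < ennreal \<delta>2"
      unfolding induced_dist_def INF_less_iff by (auto simp: pathstart_def pathfinish_def)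
    have xn: "x n \<in> N1" using 2(4)[OF \<beta>(1,4)] \<beta> 2(3) by simp
    have "\<pi> (\<Phi> (of_real t * \<zeta>)) \<in> O'" if t: "s n \<le> t" "t < 1" for t
    proof -
      have t0: "0 \<le> t" using s[of n] t by simp
      note P = C(2)[OF s[of n] t0 t(2)]
      have "induced_length X (\<gamma> (s n) t) \<le> ennreal (C * (1 - min (s n) t) powr (1/31))" using P by blast
      also have "\<dots> < ennreal \<delta>1" using b(3)[of "s n"] N[OF n(2)] s[of n] t C(1) 1(1) by (intro ennreal_lessI) (auto simp: min_def)
      finally have "\<gamma> (s n) t 1 \<in> O'" using 1(4)[of "\<gamma> (s n) t"] P xn by (simp add: \<gamma>0 x_def)
      then show ?thesis by (simp add: \<gamma>1)
    qed
    then show "\<forall>\<^sub>F t in at_left 1. \<pi> (\<Phi> (of_real t * \<zeta>)) \<in> O'"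
      using s[of n] by (intro eventually_at_leftI[of "s n"]) auto
  qed
  moreover have "continuous_on {0<..<1} (\<lambda>t. \<Phi> (of_real t * \<zeta>))"
  proof (rule continuous_on_compose2[of "ball 0 R" \<Phi>])
    show "continuous_on (ball 0 R) \<Phi>" using \<Phi> unfolding hol_disc_def by blast
    show "(\<lambda>t. of_real t * \<zeta>) ` {0<..<1} \<subseteq> ball 0 R" using R by (auto simp: norm_mult)
  qed (intro continuous_intros)
  ultimately show ?thesis by (intro lift_limit)
qed

end

section \<open>The Gauss maps as homogeneous coordinates of a rank one matrix\<close>

text \<open>
  The point of the Riemann sphere with homogeneous coordinates \<open>(x0, x1)\<close> and affine
  coordinate \<open>x1 / x0\<close>.
\<close>

definition sphere_pt :: "complex \<Rightarrow> complex \<Rightarrow> sphere" where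
  "sphere_pt x0 x1 = (if x0 = 0 then None else Some (x1 / x0))"

text \<open>
  A linear form on homogeneous coordinates that vanishes exactly at the point \<open>a\<close>.
\<close>

definition ell :: "sphere \<Rightarrow> complex \<Rightarrow> complex \<Rightarrow> complex" where
  "ell a x0 x1 = (case a of None \<Rightarrow> x0 | Some c \<Rightarrow> x1 - c * x0)"

lemma ell_simps [simp]: "ell None x0 x1 = x0" "ell (Some c) x0 x1 = x1 - c * x0"
  by (simp_all add: ell_def)

lemma ell_eq_0_iff:
  assumes "x0 \<noteq> 0 \<or> x1 \<noteq> 0"
  shows "ell a x0 x1 = 0 \<longleftrightarrow> sphere_pt x0 x1 = a"
  using assms by (cases a) (auto simp: sphere_pt_def field_simps)

text \<open>
  The ratio of the linear forms of two distinct points is a Moebius transformation.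
\<close>

lemma ell_ratio_inj:
  assumes "a \<noteq> a'" and x: "ell a x0 x1 \<noteq> 0" and r: "ell a r0 r1 \<noteq> 0"
    and e: "ell a' x0 x1 / ell a x0 x1 = ell a' r0 r1 / ell a r0 r1"
  shows "sphere_pt x0 x1 = sphere_pt r0 r1"
proof -
  have "ell a' x0 x1 * ell a r0 r1 = ell a' r0 r1 * ell a x0 x1" using x r e by (simp add: field_simps)
  moreover have "ell a' x0 x1 * ell a r0 r1 - ell a' r0 r1 * ell a x0 x1 = 0 \<longleftrightarrow> x1 * r0 = x0 * r1"
  proof (cases a; cases a')
    fix c e assume ce: "a = Some c" "a' = Some e"
    have "ell a' x0 x1 * ell a r0 r1 - ell a' r0 r1 * ell a x0 x1 = (e - c) * (x1 * r0 - x0 * r1)"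
      by (simp add: ce algebra_simps)
    then show ?thesis using assms(1) ce by auto
  qed (use assms(1) in \<open>auto simp: algebra_simps\<close>)
  ultimately have e: "x1 * r0 = x0 * r1" by simp
  have nz: "x0 \<noteq> 0 \<or> x1 \<noteq> 0" "r0 \<noteq> 0 \<or> r1 \<noteq> 0" using x r by (cases a; auto)+
  show ?thesis
  proof (cases "x0 = 0")
    case True
    then show ?thesis using e nz(1) by (simp add: sphere_pt_def)
  next
    case False
    then have "r0 \<noteq> 0" using e nz(2) by auto
    then show ?thesis using e False by (simp add: sphere_pt_def frac_eq_eq mult.commute)
  qed
qed

lemma ell_pair_bound:
  assumes "a \<noteq> a'"
  obtains C where "C > 0" "\<And>x0 x1. norm x0 + norm x1 \<le> C * (norm (ell a x0 x1) + norm (ell a' x0 x1))"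
proof -
  note goalI = that
  have 1: thesis if bd: "\<And>x0 x1. norm x0 \<le> D * (norm (ell a x0 x1) + norm (ell a' x0 x1))"
     "\<And>x0 x1. norm x1 \<le> D * (norm (ell a x0 x1) + norm (ell a' x0 x1))" and D: "D > 0" for D
  proof (rule goalI[of "2 * D"])
    show "norm x0 + norm x1 \<le> 2 * D * (norm (ell a x0 x1) + norm (ell a' x0 x1))" for x0 x1
      using add_mono[OF bd(1)[where ?x0.0=x0 and ?x1.0=x1] bd(2)[where ?x0.0=x0 and ?x1.0=x1]] by simp
  qed (use D in simp)
  have two: thesis if c: "(a = None \<and> a' = Some c) \<or> (a = Some c \<and> a' = None)" for c
  proof (rule 1[of "1 + norm c"])
    fix x0 x1
    have e: "norm (ell a x0 x1) + norm (ell a' x0 x1) = norm x0 + norm (x1 - c * x0)" using c by auto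
    have "0 \<le> norm c * norm x0" "0 \<le> norm c * norm (x1 - c * x0)" by simp_all
    then show "norm x0 \<le> (1 + norm c) * (norm (ell a x0 x1) + norm (ell a' x0 x1))"
      unfolding e by (simp add: algebra_simps add_increasing2)
    have "norm x1 \<le> norm (x1 - c * x0) + norm c * norm x0"
      using norm_triangle_ineq[of "x1 - c * x0" "c * x0"] by (simp add: norm_mult)
    then show "norm x1 \<le> (1 + norm c) * (norm (ell a x0 x1) + norm (ell a' x0 x1))"
      unfolding e using \<open>0 \<le> norm c * norm (x1 - c * x0)\<close> norm_ge_zero[of x0] by (simp add: algebra_simps del: norm_ge_zero)
  qed (simp add: add_pos_nonneg)
  show thesis
  proof (cases a)
    case None
    then obtain c where "a' = Some c" using assms by (cases a') auto
    then show thesis using two None by blast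
  next
    case (Some c)
    show thesis
    proof (cases a')
      case None
      then show thesis using two Some by blast
    next
      case s': (Some e)
      have ne: "e - c \<noteq> 0" using assms Some s' by auto
      define D where "D = 1 / norm (e - c)"
      have D: "D > 0" using ne by (simp add: D_def)
      have x0: "norm x0 \<le> D * (norm (ell a x0 x1) + norm (ell a' x0 x1))" for x0 x1
      proof -
        have "(e - c) * x0 = ell a x0 x1 - ell a' x0 x1" by (simp add: Some s' algebra_simps)
        then have "norm (e - c) * norm x0 \<le> norm (ell a x0 x1) + norm (ell a' x0 x1)"
          by (metis norm_mult norm_triangle_ineq4)
        then show ?thesis using ne by (simp add: D_def field_simps)
      qed
      show thesis
      proof (rule 1[of "D + 1 + norm c * D"])
        fix x0 x1
        let ?S = "norm (ell a x0 x1) + norm (ell a' x0 x1)"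
        have S: "0 \<le> ?S" "0 \<le> D * ?S" "0 \<le> norm c * D * ?S" using D by simp_all
        show "norm x0 \<le> (D + 1 + norm c * D) * ?S"
          using x0[of x0 x1] S unfolding distrib_right mult_1 by linarith
        have "norm x1 \<le> norm (ell a x0 x1) + norm c * norm x0"
          using norm_triangle_ineq[of "x1 - c * x0" "c * x0"] by (simp add: norm_mult Some)
        also have "\<dots> \<le> ?S + norm c * (D * ?S)"
          by (intro add_mono mult_left_mono x0) auto
        finally show "norm x1 \<le> (D + 1 + norm c * D) * ?S"
          using S unfolding distrib_right mult_1 mult.assoc by linarith
      qed (use D in \<open>simp add: add_pos_nonneg\<close>)
    qed
  qed
qed

lemma rank_one_factor:
  fixes a b c d :: complex
  assumes "a * d = b * c" "a \<noteq> 0 \<or> b \<noteq> 0 \<or> c \<noteq> 0 \<or> d \<noteq> 0"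
  obtains x0 x1 y0 y1 where "a = x0 * y0" "b = x1 * y0" "c = x0 * y1" "d = x1 * y1"
    "x0 \<noteq> 0 \<or> x1 \<noteq> 0" "y0 \<noteq> 0 \<or> y1 \<noteq> 0"
proof (cases "a = 0")
  case False
  then show thesis using assms by (intro that[of 1 a "b / a" c]) (auto simp: field_simps)
next
  case a: True
  show thesis
  proof (cases "b = 0")
    case False
    then show thesis using assms a by (intro that[of 0 b 1 d]) auto
  next
    case True
    then show thesis using assms a by (intro that[of c 0 d 1]) auto
  qed
qed

lemma Hausdorff_sphere: "Hausdorff_space sphere_topology"
proof -
  have "locally_compact_space (euclidean :: complex topology)" by (rule locally_compact_space_euclidean)
  then show ?thesis unfolding sphere_topology_def Hausdorff_space_Alexandroff_compactification by simp
qed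

lemma sphere_limit_finite:
  assumes "(f \<longlongrightarrow> l) F"
  shows "limitin sphere_topology (\<lambda>z. Some (f z)) (Some l) F"
  using continuous_map_limit[OF continuous_map_Some, of euclidean f l F] assms
  by (simp add: sphere_topology_def o_def)

lemma sphere_limit_infinite:
  assumes "filterlim f at_infinity F"
  shows "limitin sphere_topology (\<lambda>z. Some (f z)) None F"
  unfolding limitin_def
proof (intro conjI allI impI)
  show "None \<in> topspace sphere_topology" by (simp add: sphere_topology_def)
  fix U assume U: "openin sphere_topology U \<and> None \<in> U"
  then obtain C :: "complex set" where C: "compactin euclidean C" "U = insert None (Some ` (UNIV - C))"
    unfolding sphere_topology_def openin_Alexandroff_compactification by auto
  then have "bounded C" by (simp add: compact_imp_bounded)
  then obtain M where M: "\<And>z. z \<in> C \<Longrightarrow> norm z \<le> M" unfolding bounded_iff by blast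
  have "\<forall>\<^sub>F w in at_infinity. M + 1 \<le> norm (w::complex)" unfolding eventually_at_infinity by blast
  then have "\<forall>\<^sub>F z in F. M + 1 \<le> norm (f z)" using assms unfolding filterlim_iff by blast
  then show "\<forall>\<^sub>F z in F. Some (f z) \<in> U"
    by (rule eventually_mono) (use M C(2) in force)
qed

lemma sphere_quotient_limit_column:
  fixes n0 n1 :: "complex \<Rightarrow> complex"
  assumes n: "isCont n0 p" "isCont n1 p" and ev: "\<forall>\<^sub>F z in at p. n0 z \<noteq> (0::complex)"
    and x: "n0 p = x0 * y" "n1 p = x1 * y" "y \<noteq> 0" "x0 \<noteq> 0 \<or> x1 \<noteq> 0"
  shows "limitin sphere_topology (\<lambda>z. Some (n1 z / n0 z)) (sphere_pt x0 x1) (at p)"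
proof (cases "x0 = 0")
  case False
  then have "((\<lambda>z. n1 z / n0 z) \<longlongrightarrow> n1 p / n0 p) (at p)"
    using n x by (intro tendsto_divide) (auto simp: isCont_def)
  also have "n1 p / n0 p = x1 / x0" using x False by simp
  finally show ?thesis using sphere_limit_finite False by (simp add: sphere_pt_def)
next
  case True
  have 1: "(n1 \<longlongrightarrow> x1 * y) (at p)" "x1 * y \<noteq> 0" using n(2) x True by (auto simp: isCont_def)
  have 2: "filterlim n0 (at 0) (at p)"
    using n(1) x(1) True ev by (intro filterlim_atI) (auto simp: isCont_def)
  have "filterlim (\<lambda>z. n1 z / n0 z) at_infinity (at p)"
    by (rule filterlim_divide_at_infinity[OF 1(1) 2 1(2)])
  then show ?thesis using sphere_limit_infinite True by (simp add: sphere_pt_def)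
qed

text \<open>
  The limit exists even if numerator and denominator vanish at \<open>p\<close>: the matrix has rank one, so the quotient of
  either column represents the same function, and one of the columns does not vanish at \<open>p\<close>.
\<close>

lemma sphere_quotient_limit:
  fixes a b c d :: "complex \<Rightarrow> complex"
  assumes c: "isCont a p" "isCont b p" "isCont c p" "isCont d p"
    and det: "\<forall>\<^sub>F z in at p. a z * d z = b z * c z" and ev: "\<forall>\<^sub>F z in at p. a z \<noteq> (0::complex)"
    and f: "a p = x0 * y0" "b p = x1 * y0" "c p = x0 * y1" "d p = x1 * y1"
      "x0 \<noteq> 0 \<or> x1 \<noteq> 0" "y0 \<noteq> 0 \<or> y1 \<noteq> 0"
  shows "limitin sphere_topology (\<lambda>z. Some (b z / a z)) (sphere_pt x0 x1) (at p)"
proof (cases "y0 = 0")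
  case False
  then show ?thesis using sphere_quotient_limit_column[OF c(1,2) ev f(1,2) _ f(5)] by simp
next
  case True
  then have y1: "y1 \<noteq> 0" using f(6) by simp
  have "\<forall>\<^sub>F z in at p. c z \<noteq> 0 \<or> d z \<noteq> 0"
  proof (cases "x0 = 0")
    case False
    then have "c p \<noteq> 0" using f y1 by simp
    then have "\<forall>\<^sub>F z in at p. c z \<noteq> 0" using c(3) unfolding isCont_def by (rule tendsto_imp_eventually_ne[rotated])
    then show ?thesis by (rule eventually_mono) simp
  next
    case True
    then have "d p \<noteq> 0" using f y1 by simp
    then have "\<forall>\<^sub>F z in at p. d z \<noteq> 0" using c(4) unfolding isCont_def by (rule tendsto_imp_eventually_ne[rotated])
    then show ?thesis by (rule eventually_mono) simp
  qed
  \<comment> \<open>By the vanishing determinant the two columns have the same quotient.\<close>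
  then have e: "\<forall>\<^sub>F z in at p. c z \<noteq> 0 \<and> b z / a z = d z / c z"
    using det ev by eventually_elim (auto simp: field_simps)
  then have "\<forall>\<^sub>F z in at p. c z \<noteq> 0" by (rule eventually_mono) simp
  from sphere_quotient_limit_column[OF c(3,4) this f(3,4) y1 f(5)]
  have L: "limitin sphere_topology (\<lambda>z. Some (d z / c z)) (sphere_pt x0 x1) (at p)" .
  show ?thesis
  proof (rule limitin_transform_eventually[OF _ L])
    show "\<forall>\<^sub>F z in at p. Some (d z / c z) = Some (b z / a z)"
      using e by (rule eventually_mono) simp
  qed
qed

lemma (in surface) hol_form_diff:
  assumes k: "hol_form B k" and l: "hol_form B l"
  shows "hol_form B (\<lambda>U \<phi> z. k U \<phi> z - l U \<phi> z)"
proof (rule hol_formI)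
  fix U \<phi> assume U: "(U, \<phi>) \<in> B"
  show "(\<lambda>z. k U \<phi> z - l U \<phi> z) holomorphic_on \<phi> ` U"
    by (intro holomorphic_intros hol_formD(1)[OF k U] hol_formD(1)[OF l U])
next
  fix U \<phi> V \<psi> p assume U: "(U, \<phi>) \<in> B" and V: "(V, \<psi>) \<in> B" and p: "p \<in> U" "p \<in> V"
  show "k U \<phi> (\<phi> p) - l U \<phi> (\<phi> p) = (k V \<psi> (\<psi> p) - l V \<psi> (\<psi> p)) * deriv (\<psi> \<circ> inv_into U \<phi>) (\<phi> p)"
    unfolding hol_formD(2)[OF k U V p] hol_formD(2)[OF l U V p] by (simp add: algebra_simps)
qed

lemma (in surface) hol_form_add:
  assumes k: "hol_form B k" and l: "hol_form B l"
  shows "hol_form B (\<lambda>U \<phi> z. k U \<phi> z + l U \<phi> z)"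
proof (rule hol_formI)
  fix U \<phi> assume U: "(U, \<phi>) \<in> B"
  show "(\<lambda>z. k U \<phi> z + l U \<phi> z) holomorphic_on \<phi> ` U"
    by (intro holomorphic_intros hol_formD(1)[OF k U] hol_formD(1)[OF l U])
next
  fix U \<phi> V \<psi> p assume U: "(U, \<phi>) \<in> B" and V: "(V, \<psi>) \<in> B" and p: "p \<in> U" "p \<in> V"
  show "k U \<phi> (\<phi> p) + l U \<phi> (\<phi> p) = (k V \<psi> (\<psi> p) + l V \<psi> (\<psi> p)) * deriv (\<psi> \<circ> inv_into U \<phi>) (\<phi> p)"
    unfolding hol_formD(2)[OF k U V p] hol_formD(2)[OF l U V p] by (simp add: algebra_simps)
qed

lemma (in surface) hol_form_cmult:
  assumes k: "hol_form B k"
  shows "hol_form B (\<lambda>U \<phi> z. c * k U \<phi> z)"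
proof (rule hol_formI)
  fix U \<phi> assume U: "(U, \<phi>) \<in> B"
  show "(\<lambda>z. c * k U \<phi> z) holomorphic_on \<phi> ` U"
    by (intro holomorphic_intros hol_formD(1)[OF k U])
next
  fix U \<phi> V \<psi> p assume U: "(U, \<phi>) \<in> B" and V: "(V, \<psi>) \<in> B" and p: "p \<in> U" "p \<in> V"
  show "c * k U \<phi> (\<phi> p) = c * k V \<psi> (\<psi> p) * deriv (\<psi> \<circ> inv_into U \<phi>) (\<phi> p)"
    unfolding hol_formD(2)[OF k U V p] by simp
qed

lemma (in surface) form_quotient:
  assumes k: "hol_form B k" and f: "hol_form B f" "zeros f = {}"
  obtains h where "hol_fun B h" "\<And>U \<phi> p. (U, \<phi>) \<in> B \<Longrightarrow> p \<in> U \<Longrightarrow> h p = k U \<phi> (\<phi> p) / f U \<phi> (\<phi> p)"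
proof -
  have "\<exists>U \<phi>. (U, \<phi>) \<in> B \<and> p \<in> U" for p by (rule ex_chart[of p]) blast
  then obtain V \<psi> where V: "\<And>p. (V p, \<psi> p) \<in> B \<and> p \<in> V p" by metis
  define h where "h = (\<lambda>p. k (V p) (\<psi> p) (\<psi> p p) / f (V p) (\<psi> p) (\<psi> p p))"
  have fz: "f U \<phi> (\<phi> p) \<noteq> 0" if "(U, \<phi>) \<in> B" "p \<in> U" for U \<phi> p
    using form_zeros_chart[OF f(1) that] f(2) by simp
  have h: "h p = k U \<phi> (\<phi> p) / f U \<phi> (\<phi> p)" if U: "(U, \<phi>) \<in> B" and p: "p \<in> U" for U \<phi> p
  proof -
    have W: "(V p, \<psi> p) \<in> B" "p \<in> V p" using V by auto
    have "deriv (\<psi> p \<circ> inv_into U \<phi>) (\<phi> p) \<noteq> 0" using transition_deriv_nonzero[OF U W(1)] p W by simp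
    then show ?thesis unfolding h_def hol_formD(2)[OF k U W(1) p W(2)] hol_formD(2)[OF f(1) U W(1) p W(2)] by simp
  qed
  have "hol_fun B h" unfolding hol_fun_def
  proof clarify
    fix U \<phi> assume U: "(U, \<phi>) \<in> B"
    have "(\<lambda>z. k U \<phi> z / f U \<phi> z) holomorphic_on \<phi> ` U"
      by (intro holomorphic_intros hol_formD(1)[OF k U] hol_formD(1)[OF f(1) U]) (use fz[OF U] in auto)
    then show "(h \<circ> inv_into U \<phi>) holomorphic_on \<phi> ` U"
      by (rule holomorphic_transform) (use h[OF U] chartD(6)[OF U] in auto)
  qed
  then show thesis using h that by blast
qed

lemma (in surface) form_nonzero_near:
  assumes k: "hol_form B k" "zeros k \<noteq> UNIV" and U: "(U, \<phi>) \<in> B" "p \<in> U"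
  shows "\<forall>\<^sub>F z in at (\<phi> p). k U \<phi> z \<noteq> 0"
proof -
  note h = hol_formD(1)[OF k(1) U(1)]
  have pin: "\<phi> p \<in> \<phi> ` U" using U by simp
  show ?thesis
  proof (cases "k U \<phi> (\<phi> p) = 0")
    case False
    have "isCont (k U \<phi>) (\<phi> p)"
      using continuous_on_eq_continuous_at[OF chartD(2)[OF U(1)]] holomorphic_on_imp_continuous_on[OF h] pin by blast
    then show ?thesis using False unfolding isCont_def by (rule tendsto_imp_eventually_ne)
  next
    case True
    obtain r where r: "r > 0" "ball (\<phi> p) r \<subseteq> \<phi> ` U" by (rule openE[OF chartD(2)[OF U(1)] pin])
    have "\<exists>z\<in>ball (\<phi> p) r. k U \<phi> z \<noteq> 0"
    proof (rule ccontr)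
      assume n: "\<not> ?thesis"
      define N where "N = U \<inter> \<phi> -` ball (\<phi> p) r"
      have N: "open N" "p \<in> N" unfolding N_def using chart_preimage[OF chart[OF U(1)] open_ball] U r by auto
      have "N \<subseteq> zeros k" using n form_zeros_chart[OF k(1) U(1)] by (auto simp: N_def)
      then show False using form_zeros_identity[OF k(1) N(1)] N(2) k(2) by blast
    qed
    then obtain z where z: "z \<in> ball (\<phi> p) r" "k U \<phi> z \<noteq> 0" by blast
    have "k U \<phi> holomorphic_on ball (\<phi> p) r" using h r(2) holomorphic_on_subset by blast
    from isolated_zeros[OF this open_ball connected_ball _ True z] r(1)
    obtain s where s: "0 < s" "\<And>w. w \<in> ball (\<phi> p) s - {\<phi> p} \<Longrightarrow> k U \<phi> w \<noteq> 0" by (metis centre_in_ball)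
    then show ?thesis unfolding eventually_at
      by (intro exI[of _ s]) (auto simp: dist_commute)
  qed
qed

context double_cover
begin

text \<open>
  The four forms are the entries of a matrix of rank one, \<open>m00 = \<omega>\<close>, \<open>m10 = g1 * \<omega>\<close>,
  \<open>m01 = g2 * \<omega>\<close> and \<open>m11 = g1 * g2 * \<omega>\<close>. Both Gauss maps are read off from it without division by \<open>\<omega>\<close>.
\<close>

definition "m00 U \<phi> z = form_coeff Y U \<phi> 1 z - \<i> * form_coeff Y U \<phi> 2 z"
definition "m11 U \<phi> z = form_coeff Y U \<phi> 1 z + \<i> * form_coeff Y U \<phi> 2 z"
definition "m10 U \<phi> z = form_coeff Y U \<phi> 3 z + \<i> * form_coeff Y U \<phi> 4 z"
definition "m01 U \<phi> z = \<i> * form_coeff Y U \<phi> 4 z - form_coeff Y U \<phi> 3 z"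

lemma m_forms: "hol_form B m00" "hol_form B m01" "hol_form B m10" "hol_form B m11"
  unfolding m00_def[abs_def] m01_def[abs_def] m10_def[abs_def] m11_def[abs_def]
  by (intro hol_form_diff hol_form_add hol_form_cmult form_coeff_hol_form)+

text \<open>
  The determinant is the sum of the squares of the forms, which vanishes by conformality; the matrix
  itself does not vanish because the map is an immersion.
\<close>

lemma m_det_nonzero:
  assumes U: "(U, \<phi>) \<in> B" "p \<in> U"
  shows "m00 U \<phi> (\<phi> p) * m11 U \<phi> (\<phi> p) = m10 U \<phi> (\<phi> p) * m01 U \<phi> (\<phi> p)"
    "m00 U \<phi> (\<phi> p) \<noteq> 0 \<or> m10 U \<phi> (\<phi> p) \<noteq> 0 \<or> m01 U \<phi> (\<phi> p) \<noteq> 0 \<or> m11 U \<phi> (\<phi> p) \<noteq> 0"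
proof -
  let ?c = "\<lambda>i. form_coeff Y U \<phi> i (\<phi> p)"
  note n = null_rep_coeff[OF null_rep_B[OF U], folded form_coeff_eq]
  have "(?c 1)\<^sup>2 + (?c 2)\<^sup>2 + (?c 3)\<^sup>2 + (?c 4)\<^sup>2 = 0" using n(1) by (simp add: sum_4)
  moreover have "m00 U \<phi> (\<phi> p) * m11 U \<phi> (\<phi> p) - m10 U \<phi> (\<phi> p) * m01 U \<phi> (\<phi> p)
      = (?c 1)\<^sup>2 + (?c 2)\<^sup>2 + (?c 3)\<^sup>2 + (?c 4)\<^sup>2"
    by (simp add: m00_def m01_def m10_def m11_def power2_eq_square algebra_simps)
  ultimately show "m00 U \<phi> (\<phi> p) * m11 U \<phi> (\<phi> p) = m10 U \<phi> (\<phi> p) * m01 U \<phi> (\<phi> p)" by simp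
  have "2 * ?c 1 = m00 U \<phi> (\<phi> p) + m11 U \<phi> (\<phi> p)" "2 * \<i> * ?c 2 = m11 U \<phi> (\<phi> p) - m00 U \<phi> (\<phi> p)"
    "2 * ?c 3 = m10 U \<phi> (\<phi> p) - m01 U \<phi> (\<phi> p)" "2 * \<i> * ?c 4 = m10 U \<phi> (\<phi> p) + m01 U \<phi> (\<phi> p)"
    by (simp_all add: m00_def m01_def m10_def m11_def)
  moreover have "?c 1 \<noteq> 0 \<or> ?c 2 \<noteq> 0 \<or> ?c 3 \<noteq> 0 \<or> ?c 4 \<noteq> 0"
  proof -
    obtain i :: 4 where "?c i \<noteq> 0" using n(2) by blast
    then show ?thesis using exhaust_4[of i] by auto
  qed
  ultimately show "m00 U \<phi> (\<phi> p) \<noteq> 0 \<or> m10 U \<phi> (\<phi> p) \<noteq> 0 \<or> m01 U \<phi> (\<phi> p) \<noteq> 0 \<or> m11 U \<phi> (\<phi> p) \<noteq> 0"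
    by auto
qed

lemma form_coeff_le_m:
  "norm (form_coeff Y U \<phi> i z) \<le> norm (m00 U \<phi> z) + norm (m10 U \<phi> z) + norm (m01 U \<phi> z) + norm (m11 U \<phi> z)"
proof -
  let ?c = "\<lambda>i. form_coeff Y U \<phi> i z"
  have a: "norm u \<le> norm a + norm b" if "2 * u = a + b \<or> 2 * u = a - b" for u a b :: complex
  proof -
    have "norm (2 * u) \<le> norm a + norm b" using that norm_triangle_ineq[of a b] norm_triangle_ineq4[of a b] by metis
    then show ?thesis using norm_ge_zero[of u] by (simp add: norm_mult del: norm_ge_zero)
  qed
  have 1: "norm (?c 1) \<le> norm (m00 U \<phi> z) + norm (m11 U \<phi> z)" by (rule a) (simp add: m00_def m11_def)
  have "norm (\<i> * ?c 2) \<le> norm (m11 U \<phi> z) + norm (m00 U \<phi> z)" by (rule a) (simp add: m00_def m11_def)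
  then have 2: "norm (?c 2) \<le> norm (m11 U \<phi> z) + norm (m00 U \<phi> z)" by (simp add: norm_mult)
  have 3: "norm (?c 3) \<le> norm (m10 U \<phi> z) + norm (m01 U \<phi> z)" by (rule a) (simp add: m10_def m01_def)
  have "norm (\<i> * ?c 4) \<le> norm (m10 U \<phi> z) + norm (m01 U \<phi> z)" by (rule a) (simp add: m10_def m01_def)
  then have 4: "norm (?c 4) \<le> norm (m10 U \<phi> z) + norm (m01 U \<phi> z)" by (simp add: norm_mult)
  have nn: "0 \<le> norm (m00 U \<phi> z)" "0 \<le> norm (m10 U \<phi> z)" "0 \<le> norm (m01 U \<phi> z)" "0 \<le> norm (m11 U \<phi> z)"
    by simp_all
  show ?thesis using exhaust_4[of i] 1 2 3 4 nn by (elim disjE) (simp_all del: norm_ge_zero)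
qed

text \<open>
  Up to a factor, the deck transformation takes the matrix to the complex conjugate of its cofactor matrix.
\<close>

lemma m_I:
  assumes U: "(U, \<phi>) \<in> B" "p \<in> U" and V: "(V, \<psi>) \<in> B" "I p \<in> V"
  obtains c where "c \<noteq> 0" "m00 U \<phi> (\<phi> p) = cnj (m11 V \<psi> (\<psi> (I p))) * c" "m11 U \<phi> (\<phi> p) = cnj (m00 V \<psi> (\<psi> (I p))) * c"
    "m10 U \<phi> (\<phi> p) = - (cnj (m01 V \<psi> (\<psi> (I p))) * c)" "m01 U \<phi> (\<phi> p) = - (cnj (m10 V \<psi> (\<psi> (I p))) * c)"
proof -
  obtain c where c: "\<And>i. form_coeff Y U \<phi> i (\<phi> p) = cnj (form_coeff Y V \<psi> i (\<psi> (I p))) * c"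
    using form_coeff_I[OF U V] by blast
  have e: "m00 U \<phi> (\<phi> p) = cnj (m11 V \<psi> (\<psi> (I p))) * c" "m11 U \<phi> (\<phi> p) = cnj (m00 V \<psi> (\<psi> (I p))) * c"
    "m10 U \<phi> (\<phi> p) = - (cnj (m01 V \<psi> (\<psi> (I p))) * c)" "m01 U \<phi> (\<phi> p) = - (cnj (m10 V \<psi> (\<psi> (I p))) * c)"
    by (simp_all add: m00_def m01_def m10_def m11_def c algebra_simps)
  moreover have "c \<noteq> 0" using m_det_nonzero(2)[OF U] e by auto
  ultimately show thesis using that by blast
qed

text \<open>
  If \<open>\<omega>\<close> vanished identically, then so would \<open>m11\<close>, which is its conjugate under the deck transformation.
  Then exactly one of \<open>m10\<close> and \<open>m01\<close> is nonzero at each point, the same one everywhere by connectedness. But the deck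
  transformation exchanges them.
\<close>

lemma m00_zeros: "zeros m00 \<noteq> UNIV"
proof
  assume z: "zeros m00 = UNIV"
  have z00: "m00 U \<phi> (\<phi> p) = 0" if "(U, \<phi>) \<in> B" "p \<in> U" for U \<phi> p
    using form_zeros_chart[OF m_forms(1) that] z by simp
  have z11: "m11 U \<phi> (\<phi> p) = 0" if U: "(U, \<phi>) \<in> B" "p \<in> U" for U \<phi> p
  proof -
    obtain V \<psi> where V: "(V, \<psi>) \<in> B" "I p \<in> V" using ex_chart by metis
    show ?thesis using m_I[OF U V] z00[OF V] by (metis complex_cnj_zero mult_zero_left)
  qed
  have iff: "p \<in> zeros m10 \<longleftrightarrow> p \<notin> zeros m01" for p
  proof -
    obtain U \<phi> where U: "(U, \<phi>) \<in> B" "p \<in> U" using ex_chart by metis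
    show ?thesis using m_det_nonzero[OF U] z00[OF U] z11[OF U]
      by (auto simp: form_zeros_chart[OF m_forms(2) U] form_zeros_chart[OF m_forms(3) U])
  qed
  have I: "p \<in> zeros m10 \<longleftrightarrow> I p \<in> zeros m01" for p
  proof -
    obtain U \<phi> where U: "(U, \<phi>) \<in> B" "p \<in> U" using ex_chart by metis
    obtain V \<psi> where V: "(V, \<psi>) \<in> B" "I p \<in> V" using ex_chart by metis
    obtain c where "c \<noteq> 0" "m10 U \<phi> (\<phi> p) = - (cnj (m01 V \<psi> (\<psi> (I p))) * c)" using m_I[OF U V] by metis
    then show ?thesis by (simp add: form_zeros_chart[OF m_forms(2) V] form_zeros_chart[OF m_forms(3) U])
  qed
  have "zeros m10 = - zeros m01" using iff by auto
  then have "open (zeros m10)" using zeros_closed[OF m_forms(2)] by (simp add: open_Compl)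
  then have "zeros m10 = {} \<or> zeros m10 = UNIV" using zeros_closed[OF m_forms(3)] clopen_trivial by blast
  then show False using iff I by (metis UNIV_I empty_iff)
qed

lemma m_isCont:
  assumes k: "hol_form B k" and U: "(U, \<phi>) \<in> B" "p \<in> U"
  shows "isCont (k U \<phi>) (\<phi> p)"
  using continuous_on_eq_continuous_at[OF chartD(2)[OF U(1)]]
    holomorphic_on_imp_continuous_on[OF hol_formD(1)[OF k U(1)]] U(2) by blast

text \<open>
  Homogeneous coordinates \<open>x\<close> and \<open>y\<close> of the two Gauss maps at \<open>p\<close>, extracted from the rank one
  matrix.
\<close>

definition factor :: "'b set \<Rightarrow> ('b \<Rightarrow> complex) \<Rightarrow> 'b \<Rightarrow> complex \<Rightarrow> complex \<Rightarrow> complex \<Rightarrow> complex \<Rightarrow> bool" where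
  "factor U \<phi> p x0 x1 y0 y1 \<longleftrightarrow> m00 U \<phi> (\<phi> p) = x0 * y0 \<and> m10 U \<phi> (\<phi> p) = x1 * y0 \<and>
     m01 U \<phi> (\<phi> p) = x0 * y1 \<and> m11 U \<phi> (\<phi> p) = x1 * y1 \<and> (x0 \<noteq> 0 \<or> x1 \<noteq> 0) \<and> (y0 \<noteq> 0 \<or> y1 \<noteq> 0)"

lemma ex_factor:
  assumes U: "(U, \<phi>) \<in> B" "p \<in> U"
  obtains x0 x1 y0 y1 where "factor U \<phi> p x0 x1 y0 y1"
  using rank_one_factor[OF m_det_nonzero[OF U]] unfolding factor_def by metis

lemma factor_limits:
  assumes U: "(U, \<phi>) \<in> B" "p \<in> U" and x: "factor U \<phi> p x0 x1 y0 y1"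
  shows "limitin sphere_topology (\<lambda>z. Some (g1_coord Y U \<phi> z)) (sphere_pt x0 x1) (at (\<phi> p))"
    "limitin sphere_topology (\<lambda>z. Some (g2_coord Y U \<phi> z)) (sphere_pt y0 y1) (at (\<phi> p))"
proof -
  have "\<forall>\<^sub>F z in at (\<phi> p). z \<in> \<phi> ` U"
    using chartD(2)[OF U(1)] U(2) by (intro eventually_at_in_open') auto
  then have det: "\<forall>\<^sub>F z in at (\<phi> p). m00 U \<phi> z * m11 U \<phi> z = m10 U \<phi> z * m01 U \<phi> z"
    by (rule eventually_mono) (use m_det_nonzero(1)[OF U(1)] in auto)
  then have det': "\<forall>\<^sub>F z in at (\<phi> p). m00 U \<phi> z * m11 U \<phi> z = m01 U \<phi> z * m10 U \<phi> z"
    by (simp add: mult.commute)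
  note ev = form_nonzero_near[OF m_forms(1) m00_zeros U]
  note c = m_isCont[OF m_forms(1) U] m_isCont[OF m_forms(2) U] m_isCont[OF m_forms(3) U] m_isCont[OF m_forms(4) U]
  have "limitin sphere_topology (\<lambda>z. Some (m10 U \<phi> z / m00 U \<phi> z)) (sphere_pt x0 x1) (at (\<phi> p))"
    by (rule sphere_quotient_limit[OF c(1,3,2,4) det ev]) (use x in \<open>auto simp: factor_def\<close>)
  then show "limitin sphere_topology (\<lambda>z. Some (g1_coord Y U \<phi> z)) (sphere_pt x0 x1) (at (\<phi> p))"
    by (simp add: g1_coord_def m10_def m00_def)
  have "limitin sphere_topology (\<lambda>z. Some (m01 U \<phi> z / m00 U \<phi> z)) (sphere_pt y0 y1) (at (\<phi> p))"
    by (rule sphere_quotient_limit[OF c(1,2,3,4) det' ev]) (use x in \<open>auto simp: factor_def\<close>)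
  then show "limitin sphere_topology (\<lambda>z. Some (g2_coord Y U \<phi> z)) (sphere_pt y0 y1) (at (\<phi> p))"
    by (simp add: g2_coord_def m01_def m00_def)
qed

lemma factor_change:
  assumes U: "(U, \<phi>) \<in> B" "p \<in> U" and V: "(V, \<psi>) \<in> B" "p \<in> V" and x: "factor U \<phi> p x0 x1 y0 y1"
  obtains t where "t \<noteq> 0" "factor V \<psi> p (x0 * t) (x1 * t) y0 y1"
proof -
  define t where "t = deriv (\<phi> \<circ> inv_into V \<psi>) (\<psi> p)"
  have t: "t \<noteq> 0" unfolding t_def using transition_deriv_nonzero[OF V(1) U(1)] U V by simp
  have "factor V \<psi> p (x0 * t) (x1 * t) y0 y1"
    using x t unfolding factor_def
    by (simp add: hol_formD(2)[OF m_forms(1) V(1) U(1) V(2) U(2)] hol_formD(2)[OF m_forms(2) V(1) U(1) V(2) U(2)]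
      hol_formD(2)[OF m_forms(3) V(1) U(1) V(2) U(2)] hol_formD(2)[OF m_forms(4) V(1) U(1) V(2) U(2)] flip: t_def)
  then show thesis using t that by blast
qed

lemma sphere_pt_scale: "t \<noteq> 0 \<Longrightarrow> sphere_pt (x0 * t) (x1 * t) = sphere_pt x0 x1"
  by (simp add: sphere_pt_def)

lemma sphere_value_eq:
  assumes U: "(U, \<phi>) \<in> B" "p \<in> U"
    and lim: "\<And>V \<psi>. (V, \<psi>) \<in> B \<Longrightarrow> p \<in> V \<Longrightarrow> limitin sphere_topology (\<lambda>z. Some (r V \<psi> z)) w (at (\<psi> p))"
  shows "sphere_value B r p = w"
  unfolding sphere_value_def
proof (rule the_equality)
  show "\<forall>(U, \<phi>)\<in>B. p \<in> U \<longrightarrow> limitin sphere_topology (\<lambda>z. Some (r U \<phi> z)) w (at (\<phi> p))"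
    using lim by blast
  fix w' assume "\<forall>(U, \<phi>)\<in>B. p \<in> U \<longrightarrow> limitin sphere_topology (\<lambda>z. Some (r U \<phi> z)) w' (at (\<phi> p))"
  from bspec[OF this U(1)] U(2)
  have "limitin sphere_topology (\<lambda>z. Some (r U \<phi> z)) w' (at (\<phi> p))" by simp
  then show "w' = w" using lim[OF U] Hausdorff_sphere by (metis limitin_Hausdorff_unique trivial_limit_at)
qed

lemma gauss_factor:
  assumes U: "(U, \<phi>) \<in> B" "p \<in> U" and x: "factor U \<phi> p x0 x1 y0 y1"
  shows "gauss1 B Y p = sphere_pt x0 x1" "gauss2 B Y p = sphere_pt y0 y1"
proof -
  show "gauss1 B Y p = sphere_pt x0 x1" unfolding gauss1_def
  proof (rule sphere_value_eq[OF U])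
    fix V \<psi> assume V: "(V, \<psi>) \<in> B" "p \<in> V"
    obtain t where t: "t \<noteq> 0" "factor V \<psi> p (x0 * t) (x1 * t) y0 y1" using factor_change[OF U V x] .
    show "limitin sphere_topology (\<lambda>z. Some (g1_coord Y V \<psi> z)) (sphere_pt x0 x1) (at (\<psi> p))"
      using factor_limits(1)[OF V t(2)] sphere_pt_scale[OF t(1)] by simp
  qed
  show "gauss2 B Y p = sphere_pt y0 y1" unfolding gauss2_def
  proof (rule sphere_value_eq[OF U])
    fix V \<psi> assume V: "(V, \<psi>) \<in> B" "p \<in> V"
    obtain t where t: "t \<noteq> 0" "factor V \<psi> p (x0 * t) (x1 * t) y0 y1" using factor_change[OF U V x] .
    show "limitin sphere_topology (\<lambda>z. Some (g2_coord Y V \<psi> z)) (sphere_pt y0 y1) (at (\<psi> p))"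
      by (rule factor_limits(2)[OF V t(2)])
  qed
qed

lemma antipodal_sphere_pt:
  assumes "x0 \<noteq> 0 \<or> x1 \<noteq> 0"
  shows "antipodal (sphere_pt x0 x1) = sphere_pt (cnj x1) (- cnj x0)"
  using assms by (auto simp: antipodal_def sphere_pt_def)

lemma gauss_I:
  "gauss1 B Y (I p) = antipodal (gauss1 B Y p)" "gauss2 B Y (I p) = antipodal (gauss2 B Y p)"
proof -
  obtain V \<psi> where V: "(V, \<psi>) \<in> B" "p \<in> V" using ex_chart by metis
  obtain U \<phi> where U: "(U, \<phi>) \<in> B" "I p \<in> U" using ex_chart by metis
  obtain x0 x1 y0 y1 where x: "factor V \<psi> p x0 x1 y0 y1" using ex_factor[OF V] .
  have II: "I (I p) = p" using cover unfolding orientable_double_cover_def by blast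
  obtain c where c: "c \<noteq> 0" "m00 U \<phi> (\<phi> (I p)) = cnj (m11 V \<psi> (\<psi> p)) * c" "m11 U \<phi> (\<phi> (I p)) = cnj (m00 V \<psi> (\<psi> p)) * c"
    "m10 U \<phi> (\<phi> (I p)) = - (cnj (m01 V \<psi> (\<psi> p)) * c)" "m01 U \<phi> (\<phi> (I p)) = - (cnj (m10 V \<psi> (\<psi> p)) * c)"
    using m_I[OF U, of V \<psi>] V unfolding II by metis
  have F: "factor U \<phi> (I p) (cnj x1 * c) (- cnj x0 * c) (cnj y1) (- cnj y0)"
    using x c unfolding factor_def by auto
  have nz: "x0 \<noteq> 0 \<or> x1 \<noteq> 0" "y0 \<noteq> 0 \<or> y1 \<noteq> 0" using x unfolding factor_def by blast+
  show "gauss1 B Y (I p) = antipodal (gauss1 B Y p)"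
    unfolding gauss_factor(1)[OF U F] gauss_factor(1)[OF V x] sphere_pt_scale[OF c(1)] antipodal_sphere_pt[OF nz(1)] ..
  show "gauss2 B Y (I p) = antipodal (gauss2 B Y p)"
    unfolding gauss_factor(2)[OF U F] gauss_factor(2)[OF V x] antipodal_sphere_pt[OF nz(2)] ..
qed

end

section \<open>Omitted values of the generalized Gauss map\<close>

context double_cover
begin

text \<open>
  The matrix entry in bases adapted to \<open>a\<close> and \<open>b\<close>; in homogeneous coordinates it is the product of the two linear
  forms, so it vanishes where \<open>g1\<close> takes the value \<open>a\<close> or \<open>g2\<close> the value \<open>b\<close>.
\<close>

definition entry :: "sphere \<Rightarrow> sphere \<Rightarrow> 'b set \<Rightarrow> ('b \<Rightarrow> complex) \<Rightarrow> complex \<Rightarrow> complex" where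
  "entry a b U \<phi> z = ell a (ell b (m00 U \<phi> z) (m01 U \<phi> z)) (ell b (m10 U \<phi> z) (m11 U \<phi> z))"

lemma entry_form: "hol_form B (entry a b)"
proof -
  have col: "hol_form B (\<lambda>U \<phi> z. ell b (k U \<phi> z) (l U \<phi> z))" if "hol_form B k" "hol_form B l" for b k l
    using that by (cases b) (auto intro: hol_form_diff hol_form_cmult)
  show ?thesis unfolding entry_def[abs_def] by (intro col m_forms)
qed

lemma entry_factor:
  assumes "factor U \<phi> p x0 x1 y0 y1"
  shows "entry a b U \<phi> (\<phi> p) = ell a x0 x1 * ell b y0 y1"
  using assms unfolding entry_def factor_def by (cases a; cases b) (auto simp: algebra_simps)

lemma entry_zeros: "p \<in> zeros (entry a b) \<longleftrightarrow> gauss1 B Y p = a \<or> gauss2 B Y p = b"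
proof -
  obtain U \<phi> where U: "(U, \<phi>) \<in> B" "p \<in> U" using ex_chart by metis
  obtain x0 x1 y0 y1 where x: "factor U \<phi> p x0 x1 y0 y1" using ex_factor[OF U] .
  have nz: "x0 \<noteq> 0 \<or> x1 \<noteq> 0" "y0 \<noteq> 0 \<or> y1 \<noteq> 0" using x unfolding factor_def by blast+
  show ?thesis
    unfolding form_zeros_chart[OF entry_form U] entry_factor[OF x] mult_eq_0_iff
      ell_eq_0_iff[OF nz(1)] ell_eq_0_iff[OF nz(2)] gauss_factor[OF U x] ..
qed

lemma gauss1_closed: "closed {p. gauss1 B Y p = a}"
proof -
  have "{p. gauss1 B Y p = a} = zeros (entry a None) \<inter> zeros (entry a (Some 0))"
    by (auto simp: entry_zeros)
  then show ?thesis using zeros_closed[OF entry_form] by (simp add: closed_Int)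
qed

lemma gauss2_closed: "closed {p. gauss2 B Y p = a}"
proof -
  have "{p. gauss2 B Y p = a} = zeros (entry None a) \<inter> zeros (entry (Some 0) a)"
    by (auto simp: entry_zeros)
  then show ?thesis using zeros_closed[OF entry_form] by (simp add: closed_Int)
qed

lemma antipodal_neq: "antipodal z \<noteq> z"
proof (cases z)
  case (Some w)
  have "False" if w: "w \<noteq> 0" "- 1 / cnj w = w"
  proof -
    have "w * cnj w = -1" using w by (simp add: field_simps)
    then have "complex_of_real ((norm w)\<^sup>2) = -1" by (simp add: complex_norm_square del: of_real_power)
    then have "(norm w)\<^sup>2 = -1" by (metis of_real_eq_iff of_real_1 of_real_minus)
    then show False using zero_le_power2[of "norm w"] by linarith
  qed
  then show ?thesis using Some by (auto simp: antipodal_def)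
qed (simp add: antipodal_def)

lemma antipodal_antipodal: "antipodal (antipodal z) = z"
  by (auto simp: antipodal_def split: option.splits)

text \<open>
  On the connected cover a function with closed fibres and only two values is constant, but the
  antipodal map has no fixed point. Consequently neither Gauss map of the nonorientable surface is constant.
\<close>

lemma equivariant_not_two_valued:
  assumes cl: "\<And>a. closed {p. h p = (a::sphere)}" and I: "\<And>p. h (I p) = antipodal (h p)"
    and two: "\<And>p. h p = z \<or> h p = antipodal z"
  shows False
proof -
  have "- {p. h p = z} = {p. h p = antipodal z}" using two antipodal_neq[of z] by force
  then have "open {p. h p = z}" using cl[of "antipodal z"] by (metis open_Compl double_complement)
  then have "{p. h p = z} = {} \<or> {p. h p = z} = UNIV" using clopen_trivial[OF cl] by blast
  then show False
  proof
    assume "{p. h p = z} = {}"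
    then have ne: "h q \<noteq> z" for q by simp
    fix p :: 'b
    have "h p = antipodal z" using two[of p] ne[of p] by simp
    then have "h (I p) = z" using I[of p] antipodal_antipodal by simp
    then show False using ne by simp
  next
    assume "{p. h p = z} = UNIV"
    then have all: "h q = z" for q by (simp add: set_eq_iff)
    fix p :: 'b
    show False using I[of p] all[of p] all[of "I p"] antipodal_neq[of z] by simp
  qed
qed

lemma proj_RP2_eq: "proj_RP2 z = {z, antipodal z}"
  by (auto simp: proj_RP2_def antipodal_rel_def)

lemma proj_antipodal: "proj_RP2 (antipodal z) = proj_RP2 z"
  by (auto simp: proj_RP2_eq antipodal_antipodal)

text \<open>
  The map exists because the deck transformation changes the Gauss maps by the antipodal map, and it is
  unique because the covering is surjective.
\<close>

lemma gauss_map_spec: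
  assumes "generalized_gauss_map B \<pi> X = G"
  shows "G (\<pi> p) = (proj_RP2 (gauss1 B Y p), proj_RP2 (gauss2 B Y p))"
proof -
  define s where "s = (\<lambda>q. SOME p. \<pi> p = q)"
  have "\<exists>p. \<pi> p = q" for q by (rule \<pi>_surj[of q]) blast
  then have s: "\<pi> (s q) = q" for q unfolding s_def by (rule someI_ex)
  define G0 where "G0 = (\<lambda>q. (proj_RP2 (gauss1 B Y (s q)), proj_RP2 (gauss2 B Y (s q))))"
  have G0: "G0 (\<pi> p) = (proj_RP2 (gauss1 B Y p), proj_RP2 (gauss2 B Y p))" for p
  proof -
    have "\<pi> p = \<pi> (s (\<pi> p))" by (rule s[symmetric])
    then have "s (\<pi> p) = p \<or> s (\<pi> p) = I p" unfolding \<pi>_fibre .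
    then show ?thesis unfolding G0_def by (elim disjE) (simp_all add: gauss_I proj_antipodal)
  qed
  have "generalized_gauss_map B \<pi> X = G0" unfolding generalized_gauss_map_def
  proof (rule the_equality)
    show "\<forall>p. G0 (\<pi> p) = (proj_RP2 (gauss1 B Y p), proj_RP2 (gauss2 B Y p))" using G0 by blast
    fix G' assume "\<forall>p. G' (\<pi> p) = (proj_RP2 (gauss1 B Y p), proj_RP2 (gauss2 B Y p))"
    then have "G' (\<pi> (s q)) = G0 (\<pi> (s q))" for q using G0[of "s q"] by simp
    then have "G' q = G0 q" for q unfolding s .
    then show "G' = G0" by (rule ext)
  qed
  then show ?thesis using assms G0 by simp
qed

text \<open>
  Each omitted point of the projective plane is a pair of omitted antipodal points of the sphere.
\<close>

lemma omitted_sphere_points: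
  assumes D: "D \<subseteq> RP2" "finite D" "card D = q" "D \<inter> range h = {}" and h: "\<And>p. h (\<pi> p) = proj_RP2 (g p)"
    and n: "n \<le> 2 * q"
  obtains E where "finite E" "card E = n" "E \<inter> range g = {}"
proof -
  have cls: "\<exists>z. C = {z, antipodal z}" if "C \<in> D" for C
  proof -
    have "C \<in> RP2" using that D(1) by blast
    then obtain z where "C = antipodal_rel `` {z}" unfolding RP2_def by (rule quotientE)
    then show ?thesis using proj_RP2_eq[of z] unfolding proj_RP2_def by blast
  qed
  have card2: "finite C \<and> card C = 2" if "C \<in> D" for C
    using cls[OF that] antipodal_neq by (metis card_2_iff finite.emptyI finite.insertI)
  have mem: "C = proj_RP2 w" if C: "C \<in> D" "w \<in> C" for C w
  proof -
    obtain z where z: "C = {z, antipodal z}" using cls[OF C(1)] by blast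
    then have "w = z \<or> w = antipodal z" using C(2) by blast
    then show ?thesis using z proj_antipodal[of z] by (auto simp: proj_RP2_eq)
  qed
  have "pairwise disjnt D" unfolding pairwise_def disjnt_def using mem by blast
  then have "card (\<Union>D) = sum card D" using card2 by (intro card_Union_disjoint) auto
  also have "\<dots> = 2 * q" using card2 D(3) by simp
  finally obtain E where E: "E \<subseteq> \<Union>D" "card E = n" "finite E"
    using obtain_subset_with_card_n[of n "\<Union>D"] n by metis
  have "g p \<notin> \<Union>D" for p
  proof
    assume "g p \<in> \<Union>D"
    then obtain C where C: "C \<in> D" "g p \<in> C" by blast
    then have "C = h (\<pi> p)" using mem h by simp
    then show False using C(1) D(4) by blast
  qed
  then have "E \<inter> range g = {}" using E(1) by blast
  then show thesis using that E by blast
qed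

text \<open>
  One omitted point is moved to infinity, where it makes the function holomorphic; the others give omitted finite
  values.
\<close>

lemma moebius_values:
  assumes E: "finite E" "card E \<ge> 2"
  obtains a a' V where "a \<in> E" "a' \<in> E" "a \<noteq> a'" "finite V" "card V = card E - 1"
    "\<And>x0 x1. x0 \<noteq> 0 \<or> x1 \<noteq> 0 \<Longrightarrow> sphere_pt x0 x1 \<notin> E \<Longrightarrow> ell a' x0 x1 / ell a x0 x1 \<notin> V"
proof -
  obtain a a' where a: "a \<in> E" "a' \<in> E" "a \<noteq> a'"
    using E by (metis card_le_Suc0_iff_eq not_less_eq_eq numeral_2_eq_2)
  define r0 where "r0 = (\<lambda>d::sphere. case d of None \<Rightarrow> 0 | Some c \<Rightarrow> (1::complex))"
  define r1 where "r1 = (\<lambda>d::sphere. case d of None \<Rightarrow> 1 | Some c \<Rightarrow> (c::complex))"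
  have r: "sphere_pt (r0 d) (r1 d) = d" "r0 d \<noteq> 0 \<or> r1 d \<noteq> 0" for d
    by (cases d; simp add: r0_def r1_def sphere_pt_def)+
  have ra: "ell a (r0 d) (r1 d) \<noteq> 0" if "d \<noteq> a" for d
    using ell_eq_0_iff[OF r(2)] r(1) that by simp
  define val where "val = (\<lambda>d. ell a' (r0 d) (r1 d) / ell a (r0 d) (r1 d))"
  have "inj_on val (E - {a})"
  proof (rule inj_onI)
    fix d e assume d: "d \<in> E - {a}" and e: "e \<in> E - {a}" and v: "val d = val e"
    have "sphere_pt (r0 d) (r1 d) = sphere_pt (r0 e) (r1 e)"
      by (rule ell_ratio_inj[OF a(3) ra ra v[unfolded val_def]]) (use d e in auto)
    then show "d = e" by (simp add: r(1))
  qed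
  then have c: "card (val ` (E - {a})) = card E - 1" using E(1) a(1) by (simp add: card_image)
  show thesis
  proof (rule that[OF a _ c])
    show "finite (val ` (E - {a}))" using E(1) by simp
    fix x0 x1 assume x: "x0 \<noteq> 0 \<or> x1 \<noteq> 0" "sphere_pt x0 x1 \<notin> E"
    have xa: "ell a x0 x1 \<noteq> 0" using ell_eq_0_iff[OF x(1)] x(2) a(1) by auto
    show "ell a' x0 x1 / ell a x0 x1 \<notin> val ` (E - {a})"
    proof
      assume "ell a' x0 x1 / ell a x0 x1 \<in> val ` (E - {a})"
      then obtain d where d: "d \<in> E" "d \<noteq> a" "ell a' x0 x1 / ell a x0 x1 = val d" by blast
      have "sphere_pt x0 x1 = sphere_pt (r0 d) (r1 d)"
        by (rule ell_ratio_inj[OF a(3) xa ra[OF d(2)] d(3)[unfolded val_def]])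
      then show False using r(1) d(1) x(2) by simp
    qed
  qed
qed

text \<open>
  After moving an omitted value of each Gauss map to infinity, \<open>f\<close> is the form \<open>\<omega>\<close> in the new coordinates. It has no zeros,
  because \<open>\<omega>\<close> can only vanish at poles of the Gauss maps, and all matrix entries are combinations of \<open>f\<close>, \<open>h1 * f\<close>,
  \<open>h2 * f\<close> and \<open>h1 * h2 * f\<close>.
\<close>

lemma weierstrass_data:
  assumes E1: "finite E1" "card E1 \<ge> 2" "E1 \<inter> range (gauss1 B Y) = {}"
    and E2: "finite E2" "card E2 \<ge> 2" "E2 \<inter> range (gauss2 B Y) = {}"
    and nc: "\<not> gauss1 B Y constant_on UNIV" "\<not> gauss2 B Y constant_on UNIV"
  obtains f h1 h2 V1 V2 C where "hol_form B f" "zeros f = {}" "hol_fun B h1" "hol_fun B h2"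
    "\<not> h1 constant_on UNIV" "\<not> h2 constant_on UNIV"
    "finite V1" "card V1 = card E1 - 1" "range h1 \<inter> V1 = {}"
    "finite V2" "card V2 = card E2 - 1" "range h2 \<inter> V2 = {}"
    "C > 0" "\<And>U \<phi> p i. (U, \<phi>) \<in> B \<Longrightarrow> p \<in> U \<Longrightarrow>
       norm (form_coeff Y U \<phi> i (\<phi> p)) \<le> C * (norm (f U \<phi> (\<phi> p)) * (1 + norm (h1 p)) * (1 + norm (h2 p)))"
proof -
  obtain a a' V1 where a: "a \<in> E1" "a' \<in> E1" "a \<noteq> a'" and V1: "finite V1" "card V1 = card E1 - 1"
    and oV1: "\<And>x0 x1. x0 \<noteq> 0 \<or> x1 \<noteq> 0 \<Longrightarrow> sphere_pt x0 x1 \<notin> E1 \<Longrightarrow> ell a' x0 x1 / ell a x0 x1 \<notin> V1"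
    by (rule moebius_values[OF E1(1,2)]) (rule that)
  obtain b b' V2 where b: "b \<in> E2" "b' \<in> E2" "b \<noteq> b'" and V2: "finite V2" "card V2 = card E2 - 1"
    and oV2: "\<And>x0 x1. x0 \<noteq> 0 \<or> x1 \<noteq> 0 \<Longrightarrow> sphere_pt x0 x1 \<notin> E2 \<Longrightarrow> ell b' x0 x1 / ell b x0 x1 \<notin> V2"
    by (rule moebius_values[OF E2(1,2)]) (rule that)
  have g: "gauss1 B Y p \<notin> E1" "gauss2 B Y p \<notin> E2" for p using E1(3) E2(3) by blast+
  define f where "f = entry a b"
  have f: "hol_form B f" "zeros f = {}"
    unfolding f_def using entry_form entry_zeros g a(1) b(1) by fastforce+
  obtain h1 where h1: "hol_fun B h1" "\<And>U \<phi> p. (U, \<phi>) \<in> B \<Longrightarrow> p \<in> U \<Longrightarrow> h1 p = entry a' b U \<phi> (\<phi> p) / f U \<phi> (\<phi> p)"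
    by (rule form_quotient[OF entry_form f]) (rule that)
  obtain h2 where h2: "hol_fun B h2" "\<And>U \<phi> p. (U, \<phi>) \<in> B \<Longrightarrow> p \<in> U \<Longrightarrow> h2 p = entry a b' U \<phi> (\<phi> p) / f U \<phi> (\<phi> p)"
    by (rule form_quotient[OF entry_form f]) (rule that)
  have rep: "\<exists>U \<phi> x0 x1 y0 y1. (U, \<phi>) \<in> B \<and> p \<in> U \<and> factor U \<phi> p x0 x1 y0 y1" for p
    using ex_chart[of p] ex_factor by metis
  have val: "h1 p = ell a' x0 x1 / ell a x0 x1" "h2 p = ell b' y0 y1 / ell b y0 y1"
    "ell a x0 x1 \<noteq> 0" "ell b y0 y1 \<noteq> 0" "x0 \<noteq> 0 \<or> x1 \<noteq> 0" "y0 \<noteq> 0 \<or> y1 \<noteq> 0"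
    "sphere_pt x0 x1 \<notin> E1" "sphere_pt y0 y1 \<notin> E2"
    "f U \<phi> (\<phi> p) = ell a x0 x1 * ell b y0 y1"
    if U: "(U, \<phi>) \<in> B" "p \<in> U" and x: "factor U \<phi> p x0 x1 y0 y1" for U \<phi> p x0 x1 y0 y1
  proof -
    show nz: "x0 \<noteq> 0 \<or> x1 \<noteq> 0" "y0 \<noteq> 0 \<or> y1 \<noteq> 0" using x unfolding factor_def by blast+
    show s: "sphere_pt x0 x1 \<notin> E1" "sphere_pt y0 y1 \<notin> E2"
      using g[of p] unfolding gauss_factor[OF U x] by blast+
    show e: "ell a x0 x1 \<noteq> 0" "ell b y0 y1 \<noteq> 0"
      unfolding ell_eq_0_iff[OF nz(1)] ell_eq_0_iff[OF nz(2)] using s a(1) b(1) by blast+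
    show "f U \<phi> (\<phi> p) = ell a x0 x1 * ell b y0 y1" unfolding f_def by (rule entry_factor[OF x])
    show "h1 p = ell a' x0 x1 / ell a x0 x1" "h2 p = ell b' y0 y1 / ell b y0 y1"
      unfolding h1(2)[OF U] h2(2)[OF U] f_def entry_factor[OF x] using e by simp_all
  qed
  obtain C1 where C1: "C1 > 0" "\<And>x0 x1. norm x0 + norm x1 \<le> C1 * (norm (ell a x0 x1) + norm (ell a' x0 x1))"
    using ell_pair_bound[OF a(3)] by blast
  obtain C2 where C2: "C2 > 0" "\<And>x0 x1. norm x0 + norm x1 \<le> C2 * (norm (ell b x0 x1) + norm (ell b' x0 x1))"
    using ell_pair_bound[OF b(3)] by blast
  show thesis
  proof (rule that[OF f h1(1) h2(1) _ _ V1 _ V2])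
    show "\<not> h1 constant_on UNIV"
    proof
      assume "h1 constant_on UNIV"
      then obtain c where c: "\<And>p. h1 p = c" unfolding constant_on_def by blast
      have "gauss1 B Y p = gauss1 B Y q" for p q
      proof -
        obtain U \<phi> x0 x1 y0 y1 where x: "(U, \<phi>) \<in> B" "p \<in> U" "factor U \<phi> p x0 x1 y0 y1" using rep by blast
        obtain V \<psi> u0 u1 v0 v1 where u: "(V, \<psi>) \<in> B" "q \<in> V" "factor V \<psi> q u0 u1 v0 v1" using rep by blast
        note vx = val[OF x] and vu = val[OF u]
        have "ell a' x0 x1 / ell a x0 x1 = ell a' u0 u1 / ell a u0 u1" using vx(1) vu(1) c by metis
        then show ?thesis unfolding gauss_factor[OF x] gauss_factor[OF u]
          by (rule ell_ratio_inj[OF a(3) vx(3) vu(3)])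
      qed
      then show False using nc(1) unfolding constant_on_def by blast
    qed
    show "\<not> h2 constant_on UNIV"
    proof
      assume "h2 constant_on UNIV"
      then obtain c where c: "\<And>p. h2 p = c" unfolding constant_on_def by blast
      have "gauss2 B Y p = gauss2 B Y q" for p q
      proof -
        obtain U \<phi> x0 x1 y0 y1 where x: "(U, \<phi>) \<in> B" "p \<in> U" "factor U \<phi> p x0 x1 y0 y1" using rep by blast
        obtain V \<psi> u0 u1 v0 v1 where u: "(V, \<psi>) \<in> B" "q \<in> V" "factor V \<psi> q u0 u1 v0 v1" using rep by blast
        note vx = val[OF x] and vu = val[OF u]
        have "ell b' y0 y1 / ell b y0 y1 = ell b' v0 v1 / ell b v0 v1" using vx(2) vu(2) c by metis
        then show ?thesis unfolding gauss_factor[OF x] gauss_factor[OF u]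
          by (rule ell_ratio_inj[OF b(3) vx(4) vu(4)])
      qed
      then show False using nc(2) unfolding constant_on_def by blast
    qed
    have "h1 p \<notin> V1 \<and> h2 p \<notin> V2" for p
    proof -
      obtain U \<phi> x0 x1 y0 y1 where x: "(U, \<phi>) \<in> B" "p \<in> U" "factor U \<phi> p x0 x1 y0 y1" using rep by blast
      show ?thesis unfolding val(1)[OF x] val(2)[OF x]
        using oV1[OF val(5,7)[OF x]] oV2[OF val(6,8)[OF x]] by blast
    qed
    then show "range h1 \<inter> V1 = {}" "range h2 \<inter> V2 = {}" by blast+
    show "4 * (C1 * C2) > 0" using C1 C2 by simp
    fix U \<phi> p i assume U: "(U, \<phi>) \<in> B" "p \<in> U"
    obtain x0 x1 y0 y1 where x: "factor U \<phi> p x0 x1 y0 y1" using ex_factor[OF U] .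
    note v = val[OF U x]
    let ?F = "norm (f U \<phi> (\<phi> p)) * (1 + norm (h1 p)) * (1 + norm (h2 p))"
    have X: "norm x0 + norm x1 \<le> C1 * (norm (ell a x0 x1) * (1 + norm (h1 p)))"
      using C1(2)[of x0 x1] v(3) unfolding v(1) by (simp add: norm_divide distrib_left)
    have Yb: "norm y0 + norm y1 \<le> C2 * (norm (ell b y0 y1) * (1 + norm (h2 p)))"
      using C2(2)[of y0 y1] v(4) unfolding v(2) by (simp add: norm_divide distrib_left)
    have "(norm x0 + norm x1) * (norm y0 + norm y1) \<le> (C1 * (norm (ell a x0 x1) * (1 + norm (h1 p)))) * (C2 * (norm (ell b y0 y1) * (1 + norm (h2 p))))"
      using C1(1) by (intro mult_mono X Yb) auto
    also have "\<dots> = C1 * C2 * ?F" unfolding v(9) by (simp add: norm_mult mult_ac)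
    finally have P: "(norm x0 + norm x1) * (norm y0 + norm y1) \<le> C1 * C2 * ?F" .
    have "norm (form_coeff Y U \<phi> i (\<phi> p)) \<le> norm (x0 * y0) + norm (x1 * y0) + norm (x0 * y1) + norm (x1 * y1)"
      using form_coeff_le_m[of U \<phi> i "\<phi> p"] x unfolding factor_def by simp
    also have "\<dots> = (norm x0 + norm x1) * (norm y0 + norm y1)" by (simp add: norm_mult algebra_simps)
    also have "\<dots> \<le> C1 * C2 * ?F" by (rule P)
    also have "\<dots> \<le> 4 * (C1 * C2) * ?F"
    proof (rule mult_right_mono)
      show "C1 * C2 \<le> 4 * (C1 * C2)" using mult_pos_pos[OF C1(1) C2(1)] by simp
    qed simp
    finally show "norm (form_coeff Y U \<phi> i (\<phi> p)) \<le> 4 * (C1 * C2) * ?F" .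
  qed
qed

lemma omitted_5_3_contradiction:
  assumes f: "hol_form B f" "zeros f = {}" and h: "hol_fun B h1" "hol_fun B h2"
    "\<not> h1 constant_on UNIV" "\<not> h2 constant_on UNIV"
    and V: "finite V1" "card V1 = 5" "range h1 \<inter> V1 = {}"
    "finite V2" "card V2 = 3" "range h2 \<inter> V2 = {}"
    and C: "C > 0" "\<And>U \<phi> p i. (U, \<phi>) \<in> B \<Longrightarrow> p \<in> U \<Longrightarrow>
       norm (form_coeff Y U \<phi> i (\<phi> p)) \<le> C * (norm (f U \<phi> (\<phi> p)) * (1 + norm (h1 p)) * (1 + norm (h2 p)))"
  shows False
proof (rule no_complete_metric[OF f h V])
  fix \<Phi> R K and \<zeta> :: complex
  assume R: "R > 0" and \<Phi>: "hol_disc B \<Phi> R" and \<zeta>: "norm \<zeta> = R"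
    and bd: "\<And>w U \<phi>. norm w < R \<Longrightarrow> (U, \<phi>) \<in> B \<Longrightarrow> \<Phi> w \<in> U \<Longrightarrow>
         norm (f U \<phi> (\<phi> (\<Phi> w)) * deriv (\<phi> \<circ> \<Phi>) w) * (1 + norm (h1 (\<Phi> w))) * (1 + norm (h2 (\<Phi> w)))
         \<le> K * (R - norm w) powr (-30/31)"
  show "\<exists>p. ((\<lambda>t. \<Phi> (of_real t * \<zeta>)) \<longlongrightarrow> p) (at_left 1)"
  proof (rule ray_limit[OF \<Phi> R \<zeta>])
    fix w U \<phi> i assume w: "norm w < R" and U: "(U, \<phi>) \<in> B" "\<Phi> w \<in> U"
    let ?D = "norm (deriv (\<phi> \<circ> \<Phi>) w)"
    have "norm (form_coeff Y U \<phi> i (\<phi> (\<Phi> w)) * deriv (\<phi> \<circ> \<Phi>) w)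
        \<le> C * (norm (f U \<phi> (\<phi> (\<Phi> w))) * (1 + norm (h1 (\<Phi> w))) * (1 + norm (h2 (\<Phi> w)))) * ?D"
      unfolding norm_mult by (intro mult_right_mono C(2)[OF U]) simp
    also have "\<dots> = C * (norm (f U \<phi> (\<phi> (\<Phi> w)) * deriv (\<phi> \<circ> \<Phi>) w) * (1 + norm (h1 (\<Phi> w))) * (1 + norm (h2 (\<Phi> w))))"
      by (simp add: norm_mult mult_ac)
    also have "\<dots> \<le> C * (K * (R - norm w) powr (-30/31))"
      using C(1) by (intro mult_left_mono bd[OF w U]) simp
    finally show "norm (form_coeff Y U \<phi> i (\<phi> (\<Phi> w)) * deriv (\<phi> \<circ> \<Phi>) w) \<le> C * K * (R - norm w) powr (-30/31)"
      by (simp add: mult_ac)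
  qed
qed

lemma gauss_omitted_contradiction:
  assumes E1: "finite E1" "E1 \<inter> range (gauss1 B Y) = {}" and E2: "finite E2" "E2 \<inter> range (gauss2 B Y) = {}"
    and nc: "\<not> gauss1 B Y constant_on UNIV" "\<not> gauss2 B Y constant_on UNIV"
    and c: "card E1 = 6 \<and> card E2 = 4 \<or> card E1 = 4 \<and> card E2 = 6"
  shows False
proof -
  have c2: "card E1 \<ge> 2" "card E2 \<ge> 2" using c by auto
  obtain f h1 h2 V1 V2 C where f: "hol_form B f" "zeros f = {}" and h: "hol_fun B h1" "hol_fun B h2"
    "\<not> h1 constant_on UNIV" "\<not> h2 constant_on UNIV"
    and V1: "finite V1" "card V1 = card E1 - 1" "range h1 \<inter> V1 = {}"
    and V2: "finite V2" "card V2 = card E2 - 1" "range h2 \<inter> V2 = {}"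
    and C: "C > 0" "\<And>U \<phi> p i. (U, \<phi>) \<in> B \<Longrightarrow> p \<in> U \<Longrightarrow>
       norm (form_coeff Y U \<phi> i (\<phi> p)) \<le> C * (norm (f U \<phi> (\<phi> p)) * (1 + norm (h1 p)) * (1 + norm (h2 p)))"
    by (rule weierstrass_data[OF E1(1) c2(1) E1(2) E2(1) c2(2) E2(2) nc]) (rule that)
  from c show False
  proof
    assume "card E1 = 6 \<and> card E2 = 4"
    then show False using omitted_5_3_contradiction[OF f h V1(1) _ V1(3) V2(1) _ V2(3) C] V1(2) V2(2) by simp
  next
    assume "card E1 = 4 \<and> card E2 = 6"
    then have k: "card V2 = 5" "card V1 = 3" using V1(2) V2(2) by simp_all
    show False
    proof (rule omitted_5_3_contradiction[OF f h(2,1,4,3) V2(1) k(1) V2(3) V1(1) k(2) V1(3) C(1)])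
      show "norm (form_coeff Y U \<phi> i (\<phi> p)) \<le> C * (norm (f U \<phi> (\<phi> p)) * (1 + norm (h2 p)) * (1 + norm (h1 p)))"
        if "(U, \<phi>) \<in> B" "p \<in> U" for U \<phi> p i
        using C(2)[OF that] by (simp add: mult_ac)
    qed
  qed
qed

end

theorem corollary3p4:
  fixes A :: "('a::t2_space) chart set" and X :: "'a \<Rightarrow> real^4"
    and B :: "('b::t2_space) chart set" and \<pi> :: "'b \<Rightarrow> 'a" and I :: "'b \<Rightarrow> 'b"
    and g1 g2 :: "'a \<Rightarrow> sphere set"
  assumes "nonorientable_riemann_surface A"
    and "conformal_minimal_immersion A X"
    and "complete_immersion A X"
    and "nonflat A X"
    and "orientable_double_cover B A \<pi> I"
    and "generalized_gauss_map B \<pi> X = (\<lambda>p. (g1 p, g2 p))"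
  shows "(\<not> g1 constant_on UNIV \<and> \<not> g2 constant_on UNIV \<longrightarrow>
            (\<forall>q1 q2 :: nat. omits_points g1 q1 \<and> omits_points g2 q2 \<and> q1 > 1 \<and> q2 > 1 \<longrightarrow>
               1 / (real q1 - 1) + 1 / (real q2 - 1) \<ge> 2))
       \<and> (g2 constant_on UNIV \<longrightarrow> (\<forall>q. omits_points g1 q \<longrightarrow> q \<le> 1))
       \<and> (g1 constant_on UNIV \<longrightarrow> (\<forall>q. omits_points g2 q \<longrightarrow> q \<le> 1))"
proof -
  have rs: "riemann_surface B" using assms(5) unfolding orientable_double_cover_def by (elim conjE)
  have da: "dianalytic_atlas A" using assms(1) unfolding nonorientable_riemann_surface_def by (elim conjE)
  interpret double_cover B A \<pi> I X
    by unfold_locales (rule rs da assms)+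
  have g: "g1 (\<pi> p) = proj_RP2 (gauss1 B Y p)" "g2 (\<pi> p) = proj_RP2 (gauss2 B Y p)" for p
    using gauss_map_spec[OF assms(6), of p] by simp_all
  have two: "gauss1 B Y p \<in> g1 (\<pi> p)" "gauss2 B Y p \<in> g2 (\<pi> p)" for p
    unfolding g proj_RP2_eq by simp_all
  \<comment> \<open>If the map downstairs is constant, the one upstairs takes only two antipodal values.\<close>
  have n1: "\<not> g1 constant_on UNIV"
  proof
    assume "g1 constant_on UNIV"
    then obtain c where c: "\<And>q. g1 q = c" unfolding constant_on_def by blast
    fix p0 :: 'b
    have "gauss1 B Y p \<in> {gauss1 B Y p0, antipodal (gauss1 B Y p0)}" for p
      using two(1)[of p] c[of "\<pi> p"] c[of "\<pi> p0"] g(1)[of p0] unfolding proj_RP2_eq by simp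
    then show False
      using equivariant_not_two_valued[OF gauss1_closed gauss_I(1), of "gauss1 B Y p0"] by blast
  qed
  have n2: "\<not> g2 constant_on UNIV"
  proof
    assume "g2 constant_on UNIV"
    then obtain c where c: "\<And>q. g2 q = c" unfolding constant_on_def by blast
    fix p0 :: 'b
    have "gauss2 B Y p \<in> {gauss2 B Y p0, antipodal (gauss2 B Y p0)}" for p
      using two(2)[of p] c[of "\<pi> p"] c[of "\<pi> p0"] g(2)[of p0] unfolding proj_RP2_eq by simp
    then show False
      using equivariant_not_two_valued[OF gauss2_closed gauss_I(2), of "gauss2 B Y p0"] by blast
  qed
  have nc: "\<not> gauss1 B Y constant_on UNIV" "\<not> gauss2 B Y constant_on UNIV"
  proof -
    show "\<not> gauss1 B Y constant_on UNIV"
      using equivariant_not_two_valued[OF gauss1_closed gauss_I(1)] unfolding constant_on_def by blast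
    show "\<not> gauss2 B Y constant_on UNIV"
      using equivariant_not_two_valued[OF gauss2_closed gauss_I(2)] unfolding constant_on_def by blast
  qed
  have q2: "q1 = 2 \<and> q2 = 2" if o: "omits_points g1 q1" "omits_points g2 q2" and q: "q1 > 1" "q2 > 1" for q1 q2
  proof (rule ccontr)
    assume "\<not> (q1 = 2 \<and> q2 = 2)"
    then have c: "q1 \<ge> 3 \<or> q2 \<ge> 3" using q by auto
    obtain D1 where D1: "D1 \<subseteq> RP2" "finite D1" "card D1 = q1" "D1 \<inter> range g1 = {}"
      using o(1) unfolding omits_points_def by blast
    obtain D2 where D2: "D2 \<subseteq> RP2" "finite D2" "card D2 = q2" "D2 \<inter> range g2 = {}"
      using o(2) unfolding omits_points_def by blast
    \<comment> \<open>Two omitted points on one side and three on the other already suffice.\<close>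
    define k1 :: nat where "k1 = (if q1 \<ge> 3 then 6 else 4)"
    define k2 :: nat where "k2 = (if q1 \<ge> 3 then 4 else 6)"
    have k: "k1 \<le> 2 * q1" "k2 \<le> 2 * q2" "k1 = 6 \<and> k2 = 4 \<or> k1 = 4 \<and> k2 = 6"
      using c q by (auto simp: k1_def k2_def)
    obtain E1 where E1: "finite E1" "card E1 = k1" "E1 \<inter> range (gauss1 B Y) = {}"
      by (rule omitted_sphere_points[OF D1 g(1) k(1)])
    obtain E2 where E2: "finite E2" "card E2 = k2" "E2 \<inter> range (gauss2 B Y) = {}"
      by (rule omitted_sphere_points[OF D2 g(2) k(2)])
    show False
      by (rule gauss_omitted_contradiction[OF E1(1,3) E2(1,3) nc]) (use k(3) E1(2) E2(2) in simp)
  qed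
  show ?thesis
  proof (intro conjI impI allI)
    fix q1 q2 :: nat
    assume "omits_points g1 q1 \<and> omits_points g2 q2 \<and> q1 > 1 \<and> q2 > 1"
    then have "q1 = 2 \<and> q2 = 2" by (intro q2) auto
    then show "1 / (real q1 - 1) + 1 / (real q2 - 1) \<ge> 2" by simp
  qed (use n1 n2 in blast)+
qed

end
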